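(* Suppose the problem described in the context has a unique solution $u\in C^{(4,4)}([0,L]\times[0,T])$ and let $\{u_i^k: 0\le i\le M,\ 0\le k\le N\}$ be the solution of the difference scheme described in the context. Let $U_i^k=u(x_i,t_k)$ and define $\widehat e_i^k=U_i^k-\widehat u_i^k$ for $0\le i\le M$, $2\le k\le N$, and $\widehat e_i^k=U_i^k-u_i^k$ for $0\le i\le M$, $k=0,1$. Then there is a positive constant $c_5$ (independent of $\tau$ and $h$) such that $$\|\widehat e^k\|_\infty\le c_5(\tau^2+h^2),\qquad 0\le k\le N.$$
   Context: Problem: for $\alpha\in(1,2)$, $L,T>0$, ${}_C\mathrm{D}_{0,t}^\alpha u=u_{xx}+f(x,t)$ on $(0,L)\times(0,T]$, $u(x,0)=\varphi(x)$, $u_t(x,0)=\psi(x)$, $u(0,t)=u(L,t)=0$, where ${}_C\mathrm{D}_{0,t}^\alpha u=\frac{1}{\Gamma(2-\alpha)}\int_0^t u_{ss}(x,s)(t-s)^{1-\alpha}\mathrm{d}s$. $C^{(4,4)}$ means continuous partial derivatives up to order 4 in $x$ and up to order 4 in $t$. Grids: $\sigma=1-\alpha/2$; $\tau=T/N$, $t_k=k\tau$, $t_{k+\sigma}=t_k+\sigma\tau$, $t_{1-\alpha/3}=(1-\alpha/3)\tau$; $h=L/M$, $x_i=ih$; $\delta_x^2v_i=(v_{i+1}-2v_i+v_{i-1})/h^2$; $\|v\|_\infty=\max_{0\le i\le M}|v_i|$; $\psi_i=\psi(x_i)$. Time differences: $u_i^{j+\frac12}=(u_i^j+u_i^{j+1})/2$,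 $\delta_t^2u_i^0=\frac2\tau\big[\frac{u_i^1-u_i^0}{\tau}-\psi_i\big]$, $\delta_t^2u_i^j=(u_i^{j+1}-2u_i^j+u_i^{j-1})/\tau^2$ for $j\ge1$. Coefficients: for $k\ge1$, $a_1^{(k,\alpha)}=\frac32\tau^{2-\alpha}\int_0^{1/2}(s-\frac13)(k+\sigma-s)^{1-\alpha}\mathrm{d}s$; $a_l^{(k,\alpha)}=\tau^{2-\alpha}\int_0^1(s-\frac12)(k+\sigma-l+\frac32-s)^{1-\alpha}\mathrm{d}s$ ($2\le l\le k$); $b_l^{(k,\alpha)}=\tau^{2-\alpha}\int_0^1(\frac32-s)(k+\sigma-l+\frac12-s)^{1-\alpha}\mathrm{d}s$ ($1\le l\le k-1$); $b_k^{(k,\alpha)}=\tau^{2-\alpha}\int_0^{\sigma+1/2}s^{1-\alpha}\mathrm{d}s$; $c_l^{(k,\alpha)}=a_{k-l}^{(k,\alpha)}+b_{k-l}^{(k,\alpha)}$ ($0\le l\le k-1$), $c_k^{(k,\alpha)}=\frac32\tau^{2-\alpha}\int_0^{1/2}(1-s)(k+\sigma-s)^{1-\alpha}\mathrm{d}s$. Scheme (unknowns $u_i^k$, $0\le i\le M$, $0\le k\le N$): $\frac{1}{\Gamma(3-\alpha)}t_{1-\frac\alpha3}^{2-\alpha}\delta_t^2u_i^0=\delta_x^2\big[(1-\frac\alpha3)u_i^1+\frac\alpha3u_i^0\big]+f(x_i,t_{1-\frac\alpha3})$, $1\le i\le M-1$; $\frac{1}{\Gamma(2-\alpha)}\sum_{l=0}^kc_l^{(k,\alpha)}\delta_t^2u_i^{k-l}=(\frac12+\sigma)\delta_x^2u_i^{k+\frac12}+(\frac12-\sigma)\delta_x^2u_i^{k-\frac12}+f(x_i,t_{k+\sigma})$,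 $1\le i\le M-1$, $1\le k\le N-1$; $u_i^0=\varphi(x_i)$, $1\le i\le M-1$; $u_0^k=u_M^k=0$, $0\le k\le N$. For $1\le k\le N-1$: $\widehat u_i^{k+1}=(\frac32-\sigma)[(\frac12+\sigma)u_i^{k+1}+(\frac12-\sigma)u_i^k]-(\frac12-\sigma)[(\frac12+\sigma)u_i^k+(\frac12-\sigma)u_i^{k-1}]$. *)

theory Defs
  imports "HOL-Analysis.Analysis"
begin

text \<open>Regularity class C^(4,4) on [0,L] x [0,T]: D i j x t stands for the mixed partial
  derivative d^i/dx^i d^j/dt^j u (x,t), for i,j \<le> 4, all continuous on the closed rectangle;
  derivatives on the boundary are one-sided (taken within the rectangle).\<close>
definition C44 :: "real \<Rightarrow> real \<Rightarrow> (real \<Rightarrow> real \<Rightarrow> real)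
    \<Rightarrow> (nat \<Rightarrow> nat \<Rightarrow> real \<Rightarrow> real \<Rightarrow> real) \<Rightarrow> bool" where
  "C44 L T u D \<longleftrightarrow>
     (\<forall>x t. D 0 0 x t = u x t) \<and>
     (\<forall>i\<le>4. \<forall>j\<le>4. continuous_on ({0..L} \<times> {0..T}) (\<lambda>(x,t). D i j x t)) \<and>
     (\<forall>i<4. \<forall>j\<le>4. \<forall>x\<in>{0..L}. \<forall>t\<in>{0..T}.
        ((\<lambda>y. D i j y t) has_real_derivative D (Suc i) j x t) (at x within {0..L})) \<and>
     (\<forall>i\<le>4. \<forall>j<4. \<forall>x\<in>{0..L}. \<forall>t\<in>{0..T}.
        ((\<lambda>s. D i j x s) has_real_derivative D i (Suc j) x t) (at t within {0..T}))"

definition caputo :: "real \<Rightarrow> (real \<Rightarrow> real) \<Rightarrow> real \<Rightarrow> real" where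
  "caputo \<alpha> Dtt t = 1 / Gamma (2 - \<alpha>) * integral {0..t} (\<lambda>s. Dtt s * (t - s) powr (1 - \<alpha>))"

definition is_solution :: "real \<Rightarrow> real \<Rightarrow> real \<Rightarrow> (real \<Rightarrow> real) \<Rightarrow> (real \<Rightarrow> real)
    \<Rightarrow> (real \<Rightarrow> real \<Rightarrow> real) \<Rightarrow> (real \<Rightarrow> real \<Rightarrow> real)
    \<Rightarrow> (nat \<Rightarrow> nat \<Rightarrow> real \<Rightarrow> real \<Rightarrow> real) \<Rightarrow> bool" where
  "is_solution \<alpha> L T \<phi> \<psi> f u D \<longleftrightarrow>
     (\<forall>x\<in>{0<..<L}. \<forall>t\<in>{0<..T}. caputo \<alpha> (\<lambda>s. D 0 2 x s) t = D 2 0 x t + f x t) \<and>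
     (\<forall>x\<in>{0..L}. u x 0 = \<phi> x \<and> D 0 1 x 0 = \<psi> x) \<and>
     (\<forall>t\<in>{0..T}. u 0 t = 0 \<and> u L t = 0)"

definition sig :: "real \<Rightarrow> real" where
  "sig \<alpha> = 1 - \<alpha> / 2"

text \<open>coef_a alpha tau k l = a_l^(k,alpha) (1 \<le> l \<le> k)\<close>
definition coef_a :: "real \<Rightarrow> real \<Rightarrow> nat \<Rightarrow> nat \<Rightarrow> real" where
  "coef_a \<alpha> \<tau> k l =
     (if l = 1 then 3/2 * \<tau> powr (2 - \<alpha>) *
        integral {0..1/2} (\<lambda>s. (s - 1/3) * (real k + sig \<alpha> - s) powr (1 - \<alpha>))
      else \<tau> powr (2 - \<alpha>) *
        integral {0..1} (\<lambda>s. (s - 1/2) * (real k + sig \<alpha> - real l + 3/2 - s) powr (1 - \<alpha>)))"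

text \<open>coef_b alpha tau k l = b_l^(k,alpha) (1 \<le> l \<le> k)\<close>
definition coef_b :: "real \<Rightarrow> real \<Rightarrow> nat \<Rightarrow> nat \<Rightarrow> real" where
  "coef_b \<alpha> \<tau> k l =
     (if l = k then \<tau> powr (2 - \<alpha>) * integral {0..sig \<alpha> + 1/2} (\<lambda>s. s powr (1 - \<alpha>))
      else \<tau> powr (2 - \<alpha>) *
        integral {0..1} (\<lambda>s. (3/2 - s) * (real k + sig \<alpha> - real l + 1/2 - s) powr (1 - \<alpha>)))"

text \<open>coef_c alpha tau k l = c_l^(k,alpha) (0 \<le> l \<le> k)\<close>
definition coef_c :: "real \<Rightarrow> real \<Rightarrow> nat \<Rightarrow> nat \<Rightarrow> real" where
  "coef_c \<alpha> \<tau> k l =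
     (if l = k then 3/2 * \<tau> powr (2 - \<alpha>) *
        integral {0..1/2} (\<lambda>s. (1 - s) * (real k + sig \<alpha> - s) powr (1 - \<alpha>))
      else coef_a \<alpha> \<tau> k (k - l) + coef_b \<alpha> \<tau> k (k - l))"

definition dxx :: "real \<Rightarrow> (nat \<Rightarrow> real) \<Rightarrow> nat \<Rightarrow> real" where
  "dxx h v i = (v (i + 1) - 2 * v i + v (i - 1)) / h\<^sup>2"

definition dtt :: "real \<Rightarrow> real \<Rightarrow> (real \<Rightarrow> real) \<Rightarrow> (nat \<Rightarrow> nat \<Rightarrow> real) \<Rightarrow> nat \<Rightarrow> nat \<Rightarrow> real" where
  "dtt \<tau> h \<psi> w i j =
     (if j = 0 then 2 / \<tau> * ((w i 1 - w i 0) / \<tau> - \<psi> (real i * h))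
      else (w i (j + 1) - 2 * w i j + w i (j - 1)) / \<tau>\<^sup>2)"

definition is_scheme_solution :: "real \<Rightarrow> real \<Rightarrow> real \<Rightarrow> (real \<Rightarrow> real) \<Rightarrow> (real \<Rightarrow> real)
    \<Rightarrow> (real \<Rightarrow> real \<Rightarrow> real) \<Rightarrow> nat \<Rightarrow> nat \<Rightarrow> (nat \<Rightarrow> nat \<Rightarrow> real) \<Rightarrow> bool" where
  "is_scheme_solution \<alpha> L T \<phi> \<psi> f N M w \<longleftrightarrow>
     (let \<tau> = T / real N; h = L / real M; \<sigma> = sig \<alpha> in
      (\<forall>i. 1 \<le> i \<and> i \<le> M - 1 \<longrightarrow>
         1 / Gamma (3 - \<alpha>) * ((1 - \<alpha>/3) * \<tau>) powr (2 - \<alpha>) * dtt \<tau> h \<psi> w i 0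
         = dxx h (\<lambda>m. (1 - \<alpha>/3) * w m 1 + \<alpha>/3 * w m 0) i + f (real i * h) ((1 - \<alpha>/3) * \<tau>)) \<and>
      (\<forall>i k. 1 \<le> i \<and> i \<le> M - 1 \<and> 1 \<le> k \<and> k \<le> N - 1 \<longrightarrow>
         1 / Gamma (2 - \<alpha>) * (\<Sum>l = 0..k. coef_c \<alpha> \<tau> k l * dtt \<tau> h \<psi> w i (k - l))
         = (1/2 + \<sigma>) * dxx h (\<lambda>m. (w m k + w m (k + 1)) / 2) i
           + (1/2 - \<sigma>) * dxx h (\<lambda>m. (w m (k - 1) + w m k) / 2) i
           + f (real i * h) (real k * \<tau> + \<sigma> * \<tau>)) \<and>
      (\<forall>i. 1 \<le> i \<and> i \<le> M - 1 \<longrightarrow> w i 0 = \<phi> (real i * h)) \<and>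
      (\<forall>k\<le>N. w 0 k = 0 \<and> w M k = 0))"

text \<open>The hatted approximation, for 2 \<le> k \<le> N.\<close>
definition uhat :: "real \<Rightarrow> (nat \<Rightarrow> nat \<Rightarrow> real) \<Rightarrow> nat \<Rightarrow> nat \<Rightarrow> real" where
  "uhat \<alpha> w i k =
     (let \<sigma> = sig \<alpha> in
      (3/2 - \<sigma>) * ((1/2 + \<sigma>) * w i k + (1/2 - \<sigma>) * w i (k - 1))
      - (1/2 - \<sigma>) * ((1/2 + \<sigma>) * w i (k - 1) + (1/2 - \<sigma>) * w i (k - 2)))"

definition err_hat :: "real \<Rightarrow> real \<Rightarrow> real \<Rightarrow> (real \<Rightarrow> real \<Rightarrow> real) \<Rightarrow> nat \<Rightarrow> nat
    \<Rightarrow> (nat \<Rightarrow> nat \<Rightarrow> real) \<Rightarrow> nat \<Rightarrow> nat \<Rightarrow> real" where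
  "err_hat \<alpha> L T u N M w i k =
     u (real i * (L / real M)) (real k * (T / real N))
     - (if k \<le> 1 then w i k else uhat \<alpha> w i k)"

definition max_norm :: "nat \<Rightarrow> (nat \<Rightarrow> real) \<Rightarrow> real" where
  "max_norm M v = Max ((\<lambda>i. \<bar>v i\<bar>) ` {0..M})"

end

theory Submission
  imports Defs
begin

text \<open>
  Let \<open>e\<close> be the error, \<open>v\<close> its backward difference quotients in time, \<open>a = 1/2 + \<sigma>\<close> and
  \<open>ebar\<^sup>k = a e\<^sup>k + (1 - a) e\<^sup>k\<^sup>-\<^sup>1\<close>. The scheme is an Alikhanov-type convolution in \<open>v\<close> with the right-hand side
  \<open>\<delta>\<^sub>x\<^sup>2 (ebar\<^sup>k\<^sup>+\<^sup>1 + ebar\<^sup>k) / 2\<close>, except that the coefficients acting on the first two steps deviate from the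
  convolution kernel. Testing the first two equations separately gives \<open>v\<^sup>1, v\<^sup>2 = O(\<tau>\<^sup>\<alpha>\<^sup>-\<^sup>1 R)\<close> in \<open>l\<^sup>2\<close>, where \<open>R\<close> bounds the
  truncation error, so the deviation is a source term of size \<open>O(R)\<close>. Testing the resulting convolution
  equation with \<open>a v\<^sup>k\<^sup>+\<^sup>1 + (1 - a) v\<^sup>k = (ebar\<^sup>k\<^sup>+\<^sup>1 - ebar\<^sup>k) / \<tau>\<close> telescopes the right-hand side, and the decreasing
  kernel controls \<open>\<tau> \<Sum> |v|\<^sup>2\<close>; hence \<open>ebar\<close> is \<open>O(R)\<close> in the discrete \<open>H\<^sup>1\<close> norm and therefore in the maximum norm.
  The truncation error is \<open>O(\<tau>\<^sup>2 + h\<^sup>2)\<close> because the quadrature interpolates \<open>u\<^sub>t\<^sub>t\<close> linearly and its last,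
  one-point piece uses the barycentre of the singular kernel. Finally \<open>uhat\<close> is a combination of two
  values of \<open>ebar\<close> that reproduces affine functions of time.
\<close>

section \<open>Energy estimate for convolution schemes\<close>

text \<open>The obstacle is positivity. The test function is offset by \<open>a\<close>, and the
  kernel of the scheme changes with the time level. For a genuine convolution kernel
  \<open>A\<close>, Alikhanov's argument compares the offset product with half the increments of
  squares, provided that \<open>A\<close> decreases and
  \<open>a^2 * A 1 \<le> (2 * a - 1) * A 0\<close>. With \<sigma> = 1 - \<alpha>/2 one has
  \<open>2 * a - 1 = 2 - \<alpha>\<close>, which cancels the denominator of the integral of the
  singular kernel over the last interval; this is what makes the condition true. The same \<sigma>
  puts the barycentre of that kernel at t_k, so stability and consistency ask for the same offset.
  The gain \<tau>^(\<alpha>-1) in the first two steps is exactly what is needed: the deviating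
  coefficients multiply differences of \<open>v\<close> by a factor of size \<tau>^(1-\<alpha>).
  Since the coercive term absorbs the test function, neither a Gronwall argument nor a step-size
  restriction enters.\<close>

lemma abel_weighted_differences_ge:
  fixes A p :: "nat \<Rightarrow> real"
  assumes "\<And>m. 1 \<le> m \<Longrightarrow> A (Suc m) \<le> A m" and "\<And>j. 0 \<le> p j" and "1 \<le> k"
  shows "A k * p 0 - A 1 * p k \<le> (\<Sum>j<k. A (k - j) * (p j - p (Suc j)))"
  using assms(3,2)
proof (induction k arbitrary: p rule: nat_induct_at_least)
  case base
  then show ?case by (simp add: algebra_simps)
next
  case (Suc k)
  have "A k * p 1 - A 1 * p (Suc k) \<le> (\<Sum>j<k. A (k - j) * (p (Suc j) - p (Suc (Suc j))))"
    using Suc.IH[of "\<lambda>j. p (Suc j)"] Suc.prems by simp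
  \<comment> \<open>Monotonicity enters when the weight of \<open>p 1\<close> is exchanged. The
    arguments of \<open>A\<close> stay at least 1, so \<open>A 0\<close> remains available for the
    newest difference below.\<close>
  moreover have "A (Suc k) * p 1 \<le> A k * p 1"
    using assms(1) Suc by (intro mult_right_mono) auto
  moreover have "(\<Sum>j<Suc k. A (Suc k - j) * (p j - p (Suc j)))
      = A (Suc k) * (p 0 - p 1) + (\<Sum>j<k. A (k - j) * (p (Suc j) - p (Suc (Suc j))))"
    by (subst sum.lessThan_Suc_shift) simp
  ultimately show ?case by (simp add: algebra_simps)
qed

text \<open>Alikhanov's inequality. By
  \<open>2*y*(w - v) - (w^2 - v^2) = (y - v)^2 - (y - w)^2\<close>, the defect is half a weighted
  sum of differences of \<open>p j = (y - v j)^2\<close>. Abel summation leaves the deficit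
  \<open>A 1 * p k\<close>; it and the newest term, which carries \<open>A 0\<close>, are both
  multiples of \<open>d^2\<close>, and \<open>A01\<close> says that the latter pays for the
  former.\<close>

lemma weighted_kernel_product_ge:
  fixes A v :: "nat \<Rightarrow> real" and a :: real
  assumes dec: "\<And>m. 1 \<le> m \<Longrightarrow> A (Suc m) \<le> A m" and nonneg: "\<And>m. 0 \<le> A m"
    and a: "1/2 \<le> a" and A01: "a\<^sup>2 * A 1 \<le> (2 * a - 1) * A 0"
  shows "1/2 * (\<Sum>j\<le>k. A (k - j) * ((v (Suc j))\<^sup>2 - (v j)\<^sup>2))
    \<le> (a * v (Suc k) + (1 - a) * v k) * (\<Sum>j\<le>k. A (k - j) * (v (Suc j) - v j))"
proof -
  define y where "y = a * v (Suc k) + (1 - a) * v k"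
  define p where "p j = (y - v j)\<^sup>2" for j
  have "y * (\<Sum>j\<le>k. A (k - j) * (v (Suc j) - v j))
      - 1/2 * (\<Sum>j\<le>k. A (k - j) * ((v (Suc j))\<^sup>2 - (v j)\<^sup>2))
      = 1/2 * (\<Sum>j\<le>k. A (k - j) * (p j - p (Suc j)))"
    unfolding sum_distrib_left sum_subtractf[symmetric] p_def
    by (intro sum.cong refl) (simp add: power2_eq_square algebra_simps)
  moreover have "0 \<le> (\<Sum>j\<le>k. A (k - j) * (p j - p (Suc j)))"
  proof -
    define d where "d = v (Suc k) - v k"
    have pk: "p k = a\<^sup>2 * d\<^sup>2" "p k - p (Suc k) = (2 * a - 1) * d\<^sup>2"
      by (simp_all add: p_def y_def d_def power2_eq_square algebra_simps)
    have split: "(\<Sum>j\<le>k. A (k - j) * (p j - p (Suc j)))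
        = (\<Sum>j<k. A (k - j) * (p j - p (Suc j))) + A 0 * ((2 * a - 1) * d\<^sup>2)"
      by (simp add: lessThan_Suc_atMost[symmetric] pk(2)[symmetric])
    show ?thesis
    proof (cases "k = 0")
      case True
      then show ?thesis unfolding split using nonneg[of 0] a by simp
    next
      case False
      then have "A k * p 0 - A 1 * p k \<le> (\<Sum>j<k. A (k - j) * (p j - p (Suc j)))"
        by (intro abel_weighted_differences_ge dec) (auto simp: p_def)
      moreover have "0 \<le> A k * p 0" using nonneg[of k] by (simp add: p_def)
      moreover have "A 1 * p k \<le> A 0 * ((2 * a - 1) * d\<^sup>2)"
        using mult_right_mono[OF A01, of "d\<^sup>2"] by (simp add: pk(1) algebra_simps)
      ultimately show ?thesis unfolding split by linarith
    qed
  qed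
  ultimately show ?thesis by (simp add: y_def)
qed

text \<open>The subtracted part of the row for \<open>Suc n\<close> equals the whole previous total,
  so only the last row of weights survives.\<close>

lemma sum_convolution_differences:
  fixes A V :: "nat \<Rightarrow> real"
  assumes "V 0 = 0"
  shows "(\<Sum>k\<le>n. \<Sum>j\<le>k. A (k - j) * (V (Suc j) - V j)) = (\<Sum>j\<le>n. A (n - j) * V (Suc j))"
proof (induction n)
  case 0
  then show ?case by (simp add: assms)
next
  case (Suc n)
  have "(\<Sum>j\<le>Suc n. A (Suc n - j) * V j) = (\<Sum>j\<le>n. A (n - j) * V (Suc j))"
    by (subst sum.atMost_Suc_shift) (simp add: assms)
  then show ?case using Suc by (simp add: right_diff_distrib sum_subtractf)
qed

lemma sum_weighted_kernel_product_ge: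
  fixes A v :: "nat \<Rightarrow> real" and a :: real
  assumes dec: "\<And>m. A (Suc m) \<le> A m" and nonneg: "\<And>m. 0 \<le> A m"
    and a: "1/2 \<le> a" and A01: "a\<^sup>2 * A 1 \<le> (2 * a - 1) * A 0" and v0: "v 0 = 0"
  shows "1/2 * A n * (\<Sum>j\<le>n. (v (Suc j))\<^sup>2)
    \<le> (\<Sum>k\<le>n. (a * v (Suc k) + (1 - a) * v k) * (\<Sum>j\<le>k. A (k - j) * (v (Suc j) - v j)))"
proof -
  have anti: "A n \<le> A m" if "m \<le> n" for m n
    by (rule lift_Suc_antimono_le[of A]) (use dec that in auto)
  \<comment> \<open>Each weight \<open>A (n - j)\<close> is at least \<open>A n\<close>, which turns
    the weighted sum into a plain sum of squares.\<close>
  have "1/2 * A n * (\<Sum>j\<le>n. (v (Suc j))\<^sup>2) \<le> 1/2 * (\<Sum>j\<le>n. A (n - j) * (v (Suc j))\<^sup>2)"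
    unfolding mult.assoc sum_distrib_left
    by (intro sum_mono mult_left_mono mult_right_mono anti) auto
  also have "\<dots> = (\<Sum>k\<le>n. 1/2 * (\<Sum>j\<le>k. A (k - j) * ((v (Suc j))\<^sup>2 - (v j)\<^sup>2)))"
    unfolding sum_distrib_left[of "1/2", symmetric]
    using sum_convolution_differences[of "\<lambda>j. (v j)\<^sup>2" A n] v0 by simp
  also have "\<dots> \<le> (\<Sum>k\<le>n. (a * v (Suc k) + (1 - a) * v k) * (\<Sum>j\<le>k. A (k - j) * (v (Suc j) - v j)))"
    by (intro sum_mono weighted_kernel_product_ge assms)
  finally show ?thesis .
qed

section \<open>Summation by parts in space and the discrete Sobolev inequality\<close>

lemma sum_dxx_by_parts:
  assumes "z 0 = 0" "z M = 0" "1 \<le> M"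
  shows "(\<Sum>i\<in>{1..<M}. dxx h v i * z i) = - ((\<Sum>i<M. (v (Suc i) - v i) * (z (Suc i) - z i)) / h\<^sup>2)"
proof -
  have "(\<Sum>i\<in>{1..<M}. (v (i + 1) - 2 * v i + v (i - 1)) * z i)
    = (v M - v (M - 1)) * z M - (v 1 - v 0) * z 0 - (\<Sum>i<M. (v (Suc i) - v i) * (z (Suc i) - z i))"
    using assms(3)
  proof (induction M rule: nat_induct_at_least)
    case base
    then show ?case by (simp add: algebra_simps)
  next
    case (Suc n)
    then show ?case by (simp add: algebra_simps)
  qed
  then have "(\<Sum>i\<in>{1..<M}. (v (i + 1) - 2 * v i + v (i - 1)) * z i)
    = - (\<Sum>i<M. (v (Suc i) - v i) * (z (Suc i) - z i))"
    using assms by simp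
  then show ?thesis
    by (simp add: dxx_def sum_divide_distrib[symmetric] times_divide_eq_left)
qed

text \<open>An average times an increment is half a difference of squares; hence testing with the
  increment of \<open>E\<close> telescopes in time.\<close>

lemma sum_dxx_average_increment:
  assumes "E1 0 = 0" "E1 M = 0" "E2 0 = 0" "E2 M = 0" "1 \<le> M"
  shows "(\<Sum>i\<in>{1..<M}. dxx h (\<lambda>m. (E2 m + E1 m) / 2) i * (E2 i - E1 i))
    = ((\<Sum>i<M. (E1 (Suc i) - E1 i)\<^sup>2) - (\<Sum>i<M. (E2 (Suc i) - E2 i)\<^sup>2)) / (2 * h\<^sup>2)"
proof -
  have "(\<Sum>i\<in>{1..<M}. dxx h (\<lambda>m. (E2 m + E1 m) / 2) i * (E2 i - E1 i))
    = - ((\<Sum>i<M. ((E2 (Suc i) + E1 (Suc i)) / 2 - (E2 i + E1 i) / 2) *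
        ((E2 (Suc i) - E1 (Suc i)) - (E2 i - E1 i))) / h\<^sup>2)"
    using assms by (subst sum_dxx_by_parts) auto
  also have "(\<Sum>i<M. ((E2 (Suc i) + E1 (Suc i)) / 2 - (E2 i + E1 i) / 2) *
        ((E2 (Suc i) - E1 (Suc i)) - (E2 i - E1 i)))
      = ((\<Sum>i<M. (E2 (Suc i) - E2 i)\<^sup>2) - (\<Sum>i<M. (E1 (Suc i) - E1 i)\<^sup>2)) / 2"
    unfolding sum_subtractf[symmetric] sum_divide_distrib
    by (intro sum.cong refl) (simp add: field_simps power2_eq_square)
  finally show ?thesis by (simp add: minus_divide_left)
qed

text \<open>Cauchy-Schwarz on the telescoping sum that starts at the boundary. The factor
  \<open>real M\<close> is later compensated by \<open>h^2\<close>, together with the number of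
  nodes in the bound for the residual.\<close>

lemma discrete_sobolev:
  fixes z :: "nat \<Rightarrow> real"
  assumes "z 0 = 0" "i \<le> M"
  shows "(z i)\<^sup>2 \<le> real M * (\<Sum>j<M. (z (Suc j) - z j)\<^sup>2)"
proof -
  have "z i = (\<Sum>j<i. (z (Suc j) - z j))"
    using assms(1) by (simp add: sum_lessThan_telescope)
  then have "(z i)\<^sup>2 \<le> (\<Sum>j<i. (z (Suc j) - z j)\<^sup>2) * card {..<i}"
    using sum_squared_le_sum_of_squares[of "\<lambda>j. z (Suc j) - z j" "{..<i}"] by simp
  also have "\<dots> \<le> (\<Sum>j<M. (z (Suc j) - z j)\<^sup>2) * real M"
    using assms(2) by (intro mult_mono sum_mono2) (auto intro: sum_nonneg)
  finally show ?thesis by (simp add: mult.commute)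
qed

lemma sum_mult_le_weighted_squares:
  fixes x y :: "'a \<Rightarrow> real"
  assumes "0 < \<mu>"
  shows "(\<Sum>i\<in>I. x i * y i) \<le> \<mu> / 2 * (\<Sum>i\<in>I. (y i)\<^sup>2) + (\<Sum>i\<in>I. (x i)\<^sup>2) / (2 * \<mu>)"
proof -
  have "x i * y i \<le> \<mu> / 2 * (y i)\<^sup>2 + (x i)\<^sup>2 / (2 * \<mu>)" for i
  proof -
    have "0 \<le> (\<mu> * y i - x i)\<^sup>2 / (2 * \<mu>)" using assms by simp
    also have "\<dots> = \<mu> / 2 * (y i)\<^sup>2 + (x i)\<^sup>2 / (2 * \<mu>) - x i * y i"
      using assms by (simp add: field_simps power2_eq_square)
    finally show ?thesis by simp
  qed
  then show ?thesis
    by (simp add: sum_distrib_left sum_divide_distrib sum.distrib[symmetric] sum_mono)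
qed

text \<open>The lower bound \<open>\<mu> * \<tau>\<close> of the kernel yields a coercive term,
  \<open>\<mu> / 2\<close> times the sum of all \<open>v^2\<close>. Young's inequality with the same
  \<open>\<mu>\<close> bounds the source by at most this term plus \<open>s / (2 * \<mu>)\<close>
  per level, so \<open>v\<close> cancels completely and only the telescoped gradient energy of
  \<open>E\<close> remains.\<close>

lemma energy_estimate:
  fixes A :: "nat \<Rightarrow> real" and v E S :: "nat \<Rightarrow> nat \<Rightarrow> real"
  assumes dec: "\<And>m. A (Suc m) \<le> A m" and nonneg: "\<And>m. 0 \<le> A m"
    and a: "1/2 \<le> a" "a \<le> 1" and A01: "a\<^sup>2 * A 1 \<le> (2 * a - 1) * A 0"
    and pos: "0 < \<tau>" "0 < \<mu>" "1 \<le> M" "0 < h" and lower: "\<And>m. m < N \<Longrightarrow> \<mu> * \<tau> \<le> A m"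
    and v0: "\<And>i. v i 0 = 0" and E0: "\<And>i. E i 0 = 0"
    and bdry: "\<And>k. k \<le> N \<Longrightarrow> E 0 k = 0 \<and> E M k = 0"
    and vE: "\<And>i k. \<lbrakk>1 \<le> i; i < M; k < N\<rbrakk> \<Longrightarrow> E i (Suc k) - E i k = \<tau> * (a * v i (Suc k) + (1 - a) * v i k)"
    and eq: "\<And>i k. \<lbrakk>1 \<le> i; i < M; k < N\<rbrakk> \<Longrightarrow>
      1 / \<tau> * (\<Sum>j\<le>k. A (k - j) * (v i (Suc j) - v i j))
        = G * dxx h (\<lambda>m. (E m (Suc k) + E m k) / 2) i + S i k"
    and S: "\<And>k. k < N \<Longrightarrow> (\<Sum>i\<in>{1..<M}. (S i k)\<^sup>2) \<le> s"
    and n: "n < N"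
  shows "G * (\<Sum>i<M. (E (Suc i) (Suc n) - E i (Suc n))\<^sup>2) / h\<^sup>2 \<le> \<tau> * real (Suc n) * s / \<mu>"
proof -
  define y where "y i k = a * v i (Suc k) + (1 - a) * v i k" for i k
  define H where "H k = (\<Sum>i<M. (E (Suc i) k - E i k)\<^sup>2)" for k
  define V where "V = (\<Sum>i\<in>{1..<M}. \<Sum>j\<le>n. (v i (Suc j))\<^sup>2)"
  have "\<mu> / 2 * V \<le> (\<Sum>i\<in>{1..<M}. 1 / \<tau> * (\<Sum>k\<le>n. y i k * (\<Sum>j\<le>k. A (k - j) * (v i (Suc j) - v i j))))"
    unfolding V_def
  proof (subst sum_distrib_left, rule sum_mono)
    fix i
    have "\<mu> / 2 * (\<Sum>j\<le>n. (v i (Suc j))\<^sup>2) = 1 / \<tau> * (1/2 * (\<mu> * \<tau>) * (\<Sum>j\<le>n. (v i (Suc j))\<^sup>2))"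
      using pos by simp
    also have "\<dots> \<le> 1 / \<tau> * (1/2 * A n * (\<Sum>j\<le>n. (v i (Suc j))\<^sup>2))"
      using lower[OF n] pos by (intro mult_left_mono mult_right_mono) (auto intro: sum_nonneg)
    also have "\<dots> \<le> 1 / \<tau> * (\<Sum>k\<le>n. y i k * (\<Sum>j\<le>k. A (k - j) * (v i (Suc j) - v i j)))"
      unfolding y_def using pos
      by (intro mult_left_mono sum_weighted_kernel_product_ge dec nonneg a A01 v0) auto
    finally show "\<mu> / 2 * (\<Sum>j\<le>n. (v i (Suc j))\<^sup>2)
      \<le> 1 / \<tau> * (\<Sum>k\<le>n. y i k * (\<Sum>j\<le>k. A (k - j) * (v i (Suc j) - v i j)))" .
  qed
  also have "\<dots> = (\<Sum>i\<in>{1..<M}. \<Sum>k\<le>n. y i k * (G * dxx h (\<lambda>m. (E m (Suc k) + E m k) / 2) i + S i k))"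
    unfolding sum_distrib_left[of "1/\<tau>"]
  proof (intro sum.cong refl)
    fix i k assume "i \<in> {1..<M}" "k \<in> {..n}"
    then show "1 / \<tau> * (y i k * (\<Sum>j\<le>k. A (k - j) * (v i (Suc j) - v i j)))
        = y i k * (G * dxx h (\<lambda>m. (E m (Suc k) + E m k) / 2) i + S i k)"
      using eq[of i k, symmetric] n by simp
  qed
  also have "\<dots> = (\<Sum>k\<le>n. G * (\<Sum>i\<in>{1..<M}. dxx h (\<lambda>m. (E m (Suc k) + E m k) / 2) i * y i k))
      + (\<Sum>k\<le>n. \<Sum>i\<in>{1..<M}. S i k * y i k)"
    unfolding sum_distrib_left by (subst sum.swap) (simp add: sum.distrib[symmetric] algebra_simps)
  also have "(\<Sum>k\<le>n. G * (\<Sum>i\<in>{1..<M}. dxx h (\<lambda>m. (E m (Suc k) + E m k) / 2) i * y i k))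
      = (\<Sum>k\<le>n. - (G / (2 * \<tau> * h\<^sup>2)) * (H (Suc k) - H k))"
  proof (rule sum.cong[OF refl])
    fix k assume "k \<in> {..n}"
    then have k: "k < N" using n by simp
    have "(\<Sum>i\<in>{1..<M}. dxx h (\<lambda>m. (E m (Suc k) + E m k) / 2) i * y i k)
        = (\<Sum>i\<in>{1..<M}. dxx h (\<lambda>m. (E m (Suc k) + E m k) / 2) i * (E i (Suc k) - E i k)) / \<tau>"
      unfolding sum_divide_distrib using vE[of _ k] k pos by (intro sum.cong) (auto simp: y_def)
    also have "\<dots> = (H k - H (Suc k)) / (2 * h\<^sup>2) / \<tau>"
      using bdry[of k] bdry[of "Suc k"] k pos unfolding H_def by (subst sum_dxx_average_increment) auto
    finally show "G * (\<Sum>i\<in>{1..<M}. dxx h (\<lambda>m. (E m (Suc k) + E m k) / 2) i * y i k)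
      = - (G / (2 * \<tau> * h\<^sup>2)) * (H (Suc k) - H k)" by (simp add: diff_divide_distrib right_diff_distrib mult_ac)
  qed
  \<comment> \<open>The sum telescopes, and the initial energy vanishes because
    \<open>E i 0 = 0\<close>.\<close>
  also have "\<dots> = - (G / (2 * \<tau> * h\<^sup>2)) * H (Suc n)"
    unfolding sum_distrib_left[symmetric] using sum_lessThan_telescope[of H "Suc n"]
    by (simp add: H_def E0 lessThan_Suc_atMost)
  also have "(\<Sum>k\<le>n. \<Sum>i\<in>{1..<M}. S i k * y i k) \<le> (\<Sum>k\<le>n. \<mu> / 2 * (\<Sum>i\<in>{1..<M}. (y i k)\<^sup>2) + s / (2 * \<mu>))"
  proof (rule sum_mono)
    fix k assume "k \<in> {..n}"
    then have "(\<Sum>i\<in>{1..<M}. (S i k)\<^sup>2) / (2 * \<mu>) \<le> s / (2 * \<mu>)"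
      using S[of k] n pos by (intro divide_right_mono) auto
    then show "(\<Sum>i\<in>{1..<M}. S i k * y i k) \<le> \<mu> / 2 * (\<Sum>i\<in>{1..<M}. (y i k)\<^sup>2) + s / (2 * \<mu>)"
      using sum_mult_le_weighted_squares[OF pos(2), of "\<lambda>i. S i k" "\<lambda>i. y i k" "{1..<M}"] by linarith
  qed
  also have "\<dots> = \<mu> / 2 * (\<Sum>i\<in>{1..<M}. \<Sum>k\<le>n. (y i k)\<^sup>2) + real (Suc n) * s / (2 * \<mu>)"
    by (subst sum.swap) (simp add: sum.distrib sum_distrib_left)
  also have "\<dots> \<le> \<mu> / 2 * V + real (Suc n) * s / (2 * \<mu>)"
  proof -
    \<comment> \<open>The combination \<open>y\<close> costs no more than \<open>v\<close>:
      convexity of the square, followed by an index shift that is free because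
      \<open>v i 0 = 0\<close>.\<close>
    have "(\<Sum>k\<le>n. (y i k)\<^sup>2) \<le> (\<Sum>j\<le>n. (v i (Suc j))\<^sup>2)" for i
    proof -
      have "(y i k)\<^sup>2 \<le> a * (v i (Suc k))\<^sup>2 + (1 - a) * (v i k)\<^sup>2" for k
      proof -
        have "0 \<le> a * (1 - a) * (v i (Suc k) - v i k)\<^sup>2" using a by simp
        then show ?thesis by (simp add: y_def power2_eq_square algebra_simps)
      qed
      then have "(\<Sum>k\<le>n. (y i k)\<^sup>2) \<le> (\<Sum>k\<le>n. a * (v i (Suc k))\<^sup>2 + (1 - a) * (v i k)\<^sup>2)"
        by (intro sum_mono)
      also have "\<dots> = a * (\<Sum>k\<le>n. (v i (Suc k))\<^sup>2) + (1 - a) * (\<Sum>k\<le>n. (v i k)\<^sup>2)"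
        by (simp add: sum.distrib sum_distrib_left)
      also have "\<dots> \<le> a * (\<Sum>k\<le>n. (v i (Suc k))\<^sup>2) + (1 - a) * (\<Sum>k\<le>n. (v i (Suc k))\<^sup>2)"
      proof -
        have "(\<Sum>k\<le>n. (v i k)\<^sup>2) \<le> (\<Sum>k\<le>Suc n. (v i k)\<^sup>2)" by simp
        also have "\<dots> = (\<Sum>k\<le>n. (v i (Suc k))\<^sup>2)" by (subst sum.atMost_Suc_shift) (simp add: v0)
        finally show ?thesis using a by (simp add: mult_left_mono)
      qed
      finally show ?thesis by (simp add: algebra_simps)
    qed
    then show ?thesis unfolding V_def using pos 
      by (intro add_right_mono mult_left_mono sum_mono[where K = "{1..<M}"]) auto
  qed
  finally have "G / (2 * \<tau> * h\<^sup>2) * H (Suc n) \<le> real (Suc n) * s / (2 * \<mu>)"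
    by linarith
  then have "G * H (Suc n) / (2 * \<tau> * h\<^sup>2) \<le> real (Suc n) * s / (2 * \<mu>)"
    by (simp only: times_divide_eq_left)
  then have "2 * \<tau> * (G * H (Suc n) / (2 * \<tau> * h\<^sup>2)) \<le> 2 * \<tau> * (real (Suc n) * s / (2 * \<mu>))"
    using pos by (intro mult_left_mono) auto
  then show ?thesis using pos by (simp add: H_def mult.assoc)
qed

section \<open>Coefficients\<close>

text \<open>The coefficients of the scheme without the modification at the initial interval: unlike
  \<^term>\<open>coef_c \<alpha> 1 k\<close> they do not depend on the time level, so they form a convolution kernel.\<close>
definition conv_coef :: "real \<Rightarrow> nat \<Rightarrow> real" where
  "conv_coef \<alpha> m =
     integral {0..1} (\<lambda>s. (s - 1/2) * (real m + sig \<alpha> + 3/2 - s) powr (1 - \<alpha>)) +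
     (if m = 0 then integral {0..sig \<alpha> + 1/2} (\<lambda>s. s powr (1 - \<alpha>))
      else integral {0..1} (\<lambda>s. (3/2 - s) * (real m + sig \<alpha> + 1/2 - s) powr (1 - \<alpha>)))"

lemma coef_c_scale: "coef_c \<alpha> \<tau> k l = \<tau> powr (2 - \<alpha>) * coef_c \<alpha> 1 k l"
  by (simp add: coef_c_def coef_a_def coef_b_def distrib_left)

text \<open>The exceptional formulas are those for \<open>l = k\<close> and for \<open>a_1\<close>,
  that is \<open>l = k - 1\<close>. In all others \<open>k\<close> enters only through
  \<open>k - (k - l) = l\<close>.\<close>

lemma coef_c_eq_conv_coef: "l + 2 \<le> k \<Longrightarrow> coef_c \<alpha> 1 k l = conv_coef \<alpha> l"
  by (auto simp: coef_c_def coef_a_def coef_b_def conv_coef_def of_nat_diff algebra_simps)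

section \<open>Integrals against the kernel: positivity, monotonicity and a lower bound\<close>

lemma kernel_continuous_on:
  "(\<And>s. s \<in> S \<Longrightarrow> s < c) \<Longrightarrow> continuous_on S (\<lambda>s. (c - s) powr p)" for c p :: real
  by (intro continuous_intros) force

text \<open>Chebyshev's argument: the weight \<open>s - 1/2\<close> has mean zero, so
  \<open>F (1/2)\<close> may be subtracted, and then both factors change sign together at
  1/2.\<close>

lemma integral_centred_weight_mono_nonneg:
  fixes F :: "real \<Rightarrow> real"
  assumes cont: "continuous_on {0..1} F"
    and mono: "\<And>s t. \<lbrakk>0 \<le> s; s \<le> t; t \<le> 1\<rbrakk> \<Longrightarrow> F s \<le> F t"
  shows "0 \<le> integral {0..1} (\<lambda>s. (s - 1/2) * F s)"
proof -
  have "((\<lambda>s::real. (s - 1/2) * F (1/2)) has_integral ((1 - 1/2)\<^sup>2 / 2 * F (1/2) - (0 - 1/2)\<^sup>2 / 2 * F (1/2))) {0..1}"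
    by (intro fundamental_theorem_of_calculus)
      (auto intro!: derivative_eq_intros simp: has_real_derivative_iff_has_vector_derivative[symmetric])
  then have 0: "((\<lambda>s::real. (s - 1/2) * F (1/2)) has_integral 0) {0..1}" by (simp add: power2_eq_square)
  have "(\<lambda>s. (s - 1/2) * F s) integrable_on {0..1}"
    by (intro integrable_continuous_real continuous_intros cont)
  from has_integral_diff[OF integrable_integral[OF this] 0]
  have "((\<lambda>s. (s - 1/2) * (F s - F (1/2))) has_integral integral {0..1} (\<lambda>s. (s - 1/2) * F s)) {0..1}"
    by (simp add: right_diff_distrib)
  then show ?thesis
  proof (rule has_integral_nonneg)
    fix s :: real assume "s \<in> {0..1}"
    then show "0 \<le> (s - 1/2) * (F s - F (1/2))"
      using mono[of s "1/2"] mono[of "1/2" s]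
      by (cases "s \<le> 1/2") (auto intro: mult_nonneg_nonneg mult_nonpos_nonpos)
  qed
qed

text \<open>Convexity of \<open>z powr p\<close> for negative \<open>p\<close>, in the form that
  makes the difference of two shifted kernels monotone.\<close>

lemma powr_diff_antimono:
  fixes p x y :: real
  assumes "p < 0" "0 < x" "x \<le> y"
  shows "y powr p - (y + 1) powr p \<le> x powr p - (x + 1) powr p"
proof (rule DERIV_nonpos_imp_nonincreasing[OF assms(3)])
  fix z assume z: "x \<le> z" "z \<le> y"
  then have "0 < z" using assms by simp
  have "((\<lambda>a. a powr p - (a + 1) powr p) has_real_derivative p * z powr (p - 1) - p * (z + 1) powr (p - 1)) (at z)"
    using \<open>0 < z\<close> by (auto intro!: derivative_eq_intros)
  moreover have "(z + 1) powr (p - 1) \<le> z powr (p - 1)"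
    using \<open>0 < z\<close> assms by (intro powr_mono2') auto
  then have "p * z powr (p - 1) - p * (z + 1) powr (p - 1) \<le> 0"
    using assms by (simp add: mult_left_mono_neg)
  ultimately show "\<exists>y. ((\<lambda>a. a powr p - (a + 1) powr p) has_real_derivative y) (at z) \<and> y \<le> 0" by blast
qed

context
  fixes \<alpha> :: real
  assumes \<alpha>: "1 < \<alpha>" "\<alpha> < 2"
begin

lemma sig_bounds: "0 < sig \<alpha>" "sig \<alpha> < 1/2"
  using \<alpha> by (auto simp: sig_def)

lemma integral_centred_kernel_nonneg:
  assumes "1 < c"
  shows "0 \<le> integral {0..1} (\<lambda>s. (s - 1/2) * (c - s) powr (1 - \<alpha>))"
  using \<alpha> assms
  by (intro integral_centred_weight_mono_nonneg kernel_continuous_on powr_mono2') auto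

text \<open>The weight changes sign, so the integrands cannot be compared pointwise. Instead, the
  difference of the two kernels is itself increasing in \<open>s\<close>, by convexity, and the
  mean-zero weight gives it a nonnegative integral.\<close>

lemma integral_centred_kernel_antimono:
  assumes "1 < c"
  shows "integral {0..1} (\<lambda>s. (s - 1/2) * (c + 1 - s) powr (1 - \<alpha>))
    \<le> integral {0..1} (\<lambda>s. (s - 1/2) * (c - s) powr (1 - \<alpha>))"
proof -
  have "0 \<le> integral {0..1} (\<lambda>s. (s - 1/2) * ((c - s) powr (1 - \<alpha>) - (c + 1 - s) powr (1 - \<alpha>)))"
  proof (intro integral_centred_weight_mono_nonneg continuous_on_diff kernel_continuous_on)
    fix s t :: real assume "0 \<le> s" "s \<le> t" "t \<le> 1"
    then show "(c - s) powr (1 - \<alpha>) - (c + 1 - s) powr (1 - \<alpha>) \<le> (c - t) powr (1 - \<alpha>) - (c + 1 - t) powr (1 - \<alpha>)"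
      using powr_diff_antimono[of "1 - \<alpha>" "c - t" "c - s"] \<alpha> assms by (simp add: algebra_simps)
  qed (use assms in auto)
  also have "\<dots> = integral {0..1} (\<lambda>s. (s - 1/2) * (c - s) powr (1 - \<alpha>))
      - integral {0..1} (\<lambda>s. (s - 1/2) * (c + 1 - s) powr (1 - \<alpha>))"
    unfolding right_diff_distrib using assms
    by (intro integral_diff integrable_continuous_real continuous_on_mult kernel_continuous_on) 
       (auto intro!: continuous_intros)
  finally show ?thesis by simp
qed

lemma integral_right_kernel_antimono:
  assumes "1 < c"
  shows "integral {0..1} (\<lambda>s. (3/2 - s) * (c + 1 - s) powr (1 - \<alpha>))
    \<le> integral {0..1} (\<lambda>s. (3/2 - s) * (c - s) powr (1 - \<alpha>))"
proof (rule integral_le)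
  fix s :: real assume "s \<in> {0..1}"
  then show "(3/2 - s) * (c + 1 - s) powr (1 - \<alpha>) \<le> (3/2 - s) * (c - s) powr (1 - \<alpha>)"
    using \<alpha> assms by (intro mult_left_mono powr_mono2') auto
qed (use assms in \<open>auto intro!: integrable_continuous_real continuous_on_mult kernel_continuous_on continuous_intros\<close>)

text \<open>The weight \<open>3/2 - s\<close> is positive with integral 1, and the kernel is
  smallest at \<open>s = 0\<close>.\<close>

lemma integral_right_kernel_ge:
  assumes "1 < c"
  shows "c powr (1 - \<alpha>) \<le> integral {0..1} (\<lambda>s. (3/2 - s) * (c - s) powr (1 - \<alpha>))"
proof -
  have "((\<lambda>s::real. (3/2 - s) * c powr (1 - \<alpha>)) has_integral
      (- ((3/2 - 1)\<^sup>2 / 2 * c powr (1 - \<alpha>)) - - ((3/2 - 0)\<^sup>2 / 2 * c powr (1 - \<alpha>)))) {0..1}"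
    by (intro fundamental_theorem_of_calculus)
      (auto intro!: derivative_eq_intros simp: has_real_derivative_iff_has_vector_derivative[symmetric] field_simps)
  then have 1: "((\<lambda>s::real. (3/2 - s) * c powr (1 - \<alpha>)) has_integral c powr (1 - \<alpha>)) {0..1}"
    by (simp add: power2_eq_square)
  have "(\<lambda>s. (3/2 - s) * (c - s) powr (1 - \<alpha>)) integrable_on {0..1}" using assms
    by (auto intro!: integrable_continuous_real continuous_on_mult kernel_continuous_on continuous_intros)
  from 1 integrable_integral[OF this] show ?thesis
  proof (rule has_integral_le)
    fix s :: real assume "s \<in> {0..1}"
    then show "(3/2 - s) * c powr (1 - \<alpha>) \<le> (3/2 - s) * (c - s) powr (1 - \<alpha>)"
      using \<alpha> assms by (intro mult_left_mono powr_mono2') auto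
  qed
qed

section \<open>The convolution coefficients form an Alikhanov kernel\<close>

lemma integral_powr_head:
  "integral {0..sig \<alpha> + 1/2} (\<lambda>s. s powr (1 - \<alpha>)) = (sig \<alpha> + 1/2) powr (2 - \<alpha>) / (2 - \<alpha>)"
  using has_integral_powr_from_0[of "1 - \<alpha>" "sig \<alpha> + 1/2"] \<alpha> sig_bounds
  by (auto simp: has_integral_iff)

text \<open>Since \<open>3/2 - s = 1 - (s - 1/2)\<close>, the second integral in
  \<open>conv_coef\<close> is the plain kernel integral minus a centred one. That centred integral
  dominates the first summand, which belongs to the kernel shifted by one. The plain integral is at
  most the value of the kernel at \<open>s = 1\<close>.\<close>

lemma conv_coef_1_le: "conv_coef \<alpha> 1 \<le> (sig \<alpha> + 1/2) powr (1 - \<alpha>)"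
proof -
  let ?c = "sig \<alpha> + 3/2"
  let ?I = "\<lambda>f::real \<Rightarrow> real. integral {0..1} f"
  have c: "1 < ?c" using sig_bounds by simp
  have int: "(\<lambda>s. (?c - s) powr (1 - \<alpha>)) integrable_on {0..1}"
    "(\<lambda>s. (s - 1/2) * (?c - s) powr (1 - \<alpha>)) integrable_on {0..1}"
    using c by (auto intro!: integrable_continuous_real continuous_on_mult kernel_continuous_on continuous_intros)
  have "?I (\<lambda>s. (3/2 - s) * (?c - s) powr (1 - \<alpha>))
      = ?I (\<lambda>s. (?c - s) powr (1 - \<alpha>) - (s - 1/2) * (?c - s) powr (1 - \<alpha>))"
    by (intro integral_cong) (simp add: algebra_simps)
  also have "\<dots> = ?I (\<lambda>s. (?c - s) powr (1 - \<alpha>)) - ?I (\<lambda>s. (s - 1/2) * (?c - s) powr (1 - \<alpha>))"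
    by (intro integral_diff int)
  also have "?I (\<lambda>s. (?c - s) powr (1 - \<alpha>)) \<le> ?I (\<lambda>s. (sig \<alpha> + 1/2) powr (1 - \<alpha>))"
    by (rule integral_le[OF int(1)]) (use \<alpha> sig_bounds in \<open>auto intro!: powr_mono2'\<close>)
  finally show ?thesis
    using integral_centred_kernel_antimono[OF c] by (simp add: conv_coef_def algebra_simps)
qed

lemma conv_coef_0_ge: "(sig \<alpha> + 1/2) powr (2 - \<alpha>) / (2 - \<alpha>) \<le> conv_coef \<alpha> 0"
  using integral_centred_kernel_nonneg[of "sig \<alpha> + 3/2"] sig_bounds
  by (simp add: conv_coef_def integral_powr_head)

lemma head_powr_split: "(sig \<alpha> + 1/2) powr (2 - \<alpha>) = (sig \<alpha> + 1/2) * (sig \<alpha> + 1/2) powr (1 - \<alpha>)"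
  using sig_bounds powr_add[of "sig \<alpha> + 1/2" 1 "1 - \<alpha>"] by (simp add: algebra_simps)

text \<open>This amounts to \<open>2 - \<alpha> \<le> (3 - \<alpha>) / 2\<close>. It places the
  integral over the last interval above the bound for \<open>conv_coef \<alpha> 1\<close>.\<close>

lemma head_ge: "(sig \<alpha> + 1/2) powr (1 - \<alpha>) \<le> (sig \<alpha> + 1/2) powr (2 - \<alpha>) / (2 - \<alpha>)"
proof -
  have "1 * (sig \<alpha> + 1/2) powr (1 - \<alpha>) \<le> (sig \<alpha> + 1/2) / (2 - \<alpha>) * (sig \<alpha> + 1/2) powr (1 - \<alpha>)"
    using \<alpha> by (intro mult_right_mono) (auto simp: sig_def field_simps)
  then show ?thesis by (simp add: head_powr_split)
qed

lemma conv_coef_decreasing: "conv_coef \<alpha> (Suc m) \<le> conv_coef \<alpha> m"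
proof (cases "m = 0")
  case True
  then show ?thesis using conv_coef_1_le head_ge conv_coef_0_ge by simp
next
  case False
  then have c: "1 < real m + sig \<alpha> + 3/2" "1 < real m + sig \<alpha> + 1/2" using sig_bounds by auto
  show ?thesis
    using False integral_centred_kernel_antimono[OF c(1)] integral_right_kernel_antimono[OF c(2)]
    by (simp add: conv_coef_def algebra_simps)
qed

text \<open>The source of coercivity: for \<open>m < N\<close> it gives \<open>\<tau> powr (1 -
  \<alpha>) * conv_coef \<alpha> m \<ge> T powr (1 - \<alpha>)\<close>, uniformly in the step
  size.\<close>

lemma conv_coef_ge: "(real m + 1) powr (1 - \<alpha>) \<le> conv_coef \<alpha> m"
proof (cases "m = 0")
  case True
  have "1 \<le> (sig \<alpha> + 1/2) powr (1 - \<alpha>)"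
    using \<alpha> sig_bounds powr_mono2'[of "1 - \<alpha>" "sig \<alpha> + 1/2" 1] by simp
  then show ?thesis using True head_ge conv_coef_0_ge by simp
next
  case False
  then have c: "1 < real m + sig \<alpha> + 3/2" "1 < real m + sig \<alpha> + 1/2" using sig_bounds by auto
  have "(real m + 1) powr (1 - \<alpha>) \<le> (real m + sig \<alpha> + 1/2) powr (1 - \<alpha>)"
    using \<alpha> sig_bounds by (intro powr_mono2') auto
  then show ?thesis
    using False integral_centred_kernel_nonneg[OF c(1)] integral_right_kernel_ge[OF c(2)]
    by (simp add: conv_coef_def)
qed

lemma conv_coef_pos: "0 < conv_coef \<alpha> m"
  using conv_coef_ge[of m] by (smt (verit) of_nat_0_le_iff powr_gt_zero)

text \<open>The compatibility of offset and kernel. As \<open>2 * a - 1 = 2 - \<alpha>\<close>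
  cancels the denominator of the head integral, the right-hand side is at least
  \<open>a powr (2 - \<alpha>)\<close>, while the left-hand side is at most
  \<open>a^2 * a powr (1 - \<alpha>)\<close>; the spare factor \<open>a < 1\<close>
  suffices.\<close>

lemma conv_coef_0_1:
  "(1/2 + sig \<alpha>)\<^sup>2 * conv_coef \<alpha> 1 \<le> (2 * (1/2 + sig \<alpha>) - 1) * conv_coef \<alpha> 0"
proof -
  define a where "a = sig \<alpha> + 1/2"
  have a: "0 < a" "a < 1" "2 * a - 1 = 2 - \<alpha>" using sig_bounds by (auto simp: a_def sig_def)
  have "a\<^sup>2 * conv_coef \<alpha> 1 \<le> a\<^sup>2 * a powr (1 - \<alpha>)"
    using conv_coef_1_le by (intro mult_left_mono) (auto simp: a_def)
  also have "\<dots> \<le> a * a powr (1 - \<alpha>)"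
    using a by (intro mult_right_mono) (auto simp: power2_eq_square)
  also have "\<dots> = (2 - \<alpha>) * (a powr (2 - \<alpha>) / (2 - \<alpha>))"
    using \<alpha> head_powr_split by (simp add: a_def)
  also have "\<dots> \<le> (2 - \<alpha>) * conv_coef \<alpha> 0"
    using \<alpha> conv_coef_0_ge by (intro mult_left_mono) (auto simp: a_def)
  finally show ?thesis using a by (simp add: a_def add.commute)
qed

section \<open>Bounds for the coefficients that depend on the time level\<close>

lemma abs_integral_kernel_le:
  assumes "0 \<le> d" "d \<le> 1" "1 + sig \<alpha> \<le> c" "c - d \<ge> sig \<alpha> + 1/2" "continuous_on {0..d} g"
    "\<And>s. s \<in> {0..d} \<Longrightarrow> \<bar>g s\<bar> \<le> B"
  shows "\<bar>integral {0..d} (\<lambda>s. g s * (c - s) powr (1 - \<alpha>))\<bar> \<le> B * d * (sig \<alpha> + 1/2) powr (1 - \<alpha>)"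
proof -
  have "norm (integral {0..d} (\<lambda>s. g s * (c - s) powr (1 - \<alpha>)))
      \<le> (B * (sig \<alpha> + 1/2) powr (1 - \<alpha>)) * (d - 0)"
  proof (rule integral_bound)
    fix s assume s: "s \<in> {0..d}"
    have "(c - s) powr (1 - \<alpha>) \<le> (sig \<alpha> + 1/2) powr (1 - \<alpha>)"
      using s assms \<alpha> sig_bounds by (intro powr_mono2') auto
    moreover have "0 \<le> B" using assms(6)[OF s] by linarith
    ultimately show "norm (g s * (c - s) powr (1 - \<alpha>)) \<le> B * (sig \<alpha> + 1/2) powr (1 - \<alpha>)"
      using assms(6)[OF s] by (auto simp: abs_mult intro!: mult_mono)
  qed (use assms sig_bounds in \<open>auto intro!: continuous_on_mult kernel_continuous_on\<close>)
  then show ?thesis by (simp add: algebra_simps)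
qed

text \<open>The constant is the product of the prefactor 3/2, the bound 1/3 for the weight and the
  length 1/2 of the interval.\<close>

lemma abs_coef_a_1_le:
  assumes "1 \<le> k"
  shows "\<bar>coef_a \<alpha> 1 k 1\<bar> \<le> 1/4 * (sig \<alpha> + 1/2) powr (1 - \<alpha>)"
proof -
  have "\<bar>integral {0..1/2} (\<lambda>s. (s - 1/3) * (real k + sig \<alpha> - s) powr (1 - \<alpha>))\<bar>
      \<le> 1/3 * (1/2) * (sig \<alpha> + 1/2) powr (1 - \<alpha>)"
  proof (rule abs_integral_kernel_le)
    fix s :: real assume "s \<in> {0..1/2}"
    then have "0 \<le> s" "s \<le> 1/2" by simp_all
    then show "\<bar>s - 1/3\<bar> \<le> 1/3" by linarith
  qed (use assms sig_bounds in \<open>auto intro!: continuous_intros\<close>)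
  then show ?thesis by (simp add: coef_a_def abs_mult)
qed

text \<open>The weight in \<open>coef_a\<close> changes sign, so that summand is bounded in size and
  beaten by the head integral. The coefficient is a divisor in the estimate of the second time
  step.\<close>

lemma coef_c_0_1_pos: "0 < coef_c \<alpha> 1 1 0"
proof -
  have "0 < (sig \<alpha> + 1/2) powr (1 - \<alpha>)" using sig_bounds by simp
  moreover have "coef_c \<alpha> 1 1 0 = coef_a \<alpha> 1 1 1 + (sig \<alpha> + 1/2) powr (2 - \<alpha>) / (2 - \<alpha>)"
    by (simp add: coef_c_def coef_b_def integral_powr_head)
  ultimately show ?thesis
    using abs_coef_a_1_le[of 1] head_ge by linarith
qed

lemma abs_coef_c_last_le:
  assumes "1 \<le> k"
  shows "\<bar>coef_c \<alpha> 1 k k\<bar> \<le> (sig \<alpha> + 1/2) powr (1 - \<alpha>)"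
proof -
  have "\<bar>integral {0..1/2} (\<lambda>s. (1 - s) * (real k + sig \<alpha> - s) powr (1 - \<alpha>))\<bar>
      \<le> 1 * (1/2) * (sig \<alpha> + 1/2) powr (1 - \<alpha>)"
    using assms sig_bounds by (intro abs_integral_kernel_le) (auto intro!: continuous_intros)
  moreover have "0 \<le> (sig \<alpha> + 1/2) powr (1 - \<alpha>)" by simp
  ultimately show ?thesis by (simp add: coef_c_def abs_mult)
qed

lemma abs_coef_c_penultimate_le:
  assumes "1 \<le> k"
  shows "\<bar>coef_c \<alpha> 1 k (k - 1)\<bar> \<le> 3 * ((sig \<alpha> + 1/2) powr (2 - \<alpha>) / (2 - \<alpha>))"
proof -
  let ?p = "(sig \<alpha> + 1/2) powr (1 - \<alpha>)"
  have "\<bar>coef_b \<alpha> 1 k 1\<bar> \<le> 3/2 * ((sig \<alpha> + 1/2) powr (2 - \<alpha>) / (2 - \<alpha>))"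
  proof (cases "k = 1")
    case True
    moreover have "0 \<le> (sig \<alpha> + 1/2) powr (2 - \<alpha>) / (2 - \<alpha>)" using \<alpha> by simp
    moreover have "coef_b \<alpha> 1 1 1 = (sig \<alpha> + 1/2) powr (2 - \<alpha>) / (2 - \<alpha>)"
      by (simp add: coef_b_def integral_powr_head)
    ultimately show ?thesis unfolding True by linarith
  next
    case False
    have "\<bar>integral {0..1} (\<lambda>s. (3/2 - s) * (real k + sig \<alpha> - 1/2 - s) powr (1 - \<alpha>))\<bar> \<le> 3/2 * 1 * ?p"
      using False assms sig_bounds by (intro abs_integral_kernel_le) (auto intro!: continuous_intros)
    moreover have "coef_b \<alpha> 1 k 1 = integral {0..1} (\<lambda>s. (3/2 - s) * (real k + sig \<alpha> - 1/2 - s) powr (1 - \<alpha>))"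
      using False unfolding coef_b_def by (simp add: field_simps)
    ultimately have "\<bar>coef_b \<alpha> 1 k 1\<bar> \<le> 3/2 * ?p" by linarith
    then show ?thesis using head_ge by linarith
  qed
  moreover have "coef_c \<alpha> 1 k (k - 1) = coef_a \<alpha> 1 k 1 + coef_b \<alpha> 1 k 1"
    using assms by (simp add: coef_c_def)
  moreover have "0 \<le> ?p" by simp
  ultimately show ?thesis using abs_coef_a_1_le[OF assms] head_ge by linarith
qed

end

section \<open>Stability of the scheme\<close>

lemma sum_square_add_le:
  fixes x y :: "'a \<Rightarrow> real"
  shows "(\<Sum>i\<in>I. (b * x i + c * y i)\<^sup>2) \<le> 2 * b\<^sup>2 * (\<Sum>i\<in>I. (x i)\<^sup>2) + 2 * c\<^sup>2 * (\<Sum>i\<in>I. (y i)\<^sup>2)"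
proof -
  have "(b * x i + c * y i)\<^sup>2 \<le> 2 * b\<^sup>2 * (x i)\<^sup>2 + 2 * c\<^sup>2 * (y i)\<^sup>2" for i
    using zero_le_power2[of "b * x i - c * y i"] by (simp add: power2_eq_square algebra_simps)
  then show ?thesis by (simp add: sum_distrib_left sum.distrib[symmetric] sum_mono)
qed

text \<open>In the application \<open>g\<close> is a multiple of
  \<open>\<tau> powr (1 - \<alpha>)\<close>. Testing with \<open>v\<close> gives the first bound for
  Young's parameter \<open>g\<close>, and the third for \<open>2 * g\<close>, which absorbs all of
  \<open>v\<close>. The second bound is read off the equation and is free of \<open>g\<close>; this
  matters because \<open>dxx h e\<close> enters the source at level 0 without any power of
  \<open>\<tau>\<close>.\<close>

lemma first_step_estimate:
  fixes e v R :: "nat \<Rightarrow> real"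
  assumes pos: "0 < g" "0 < lam" "0 < \<tau>" "0 < h" "1 \<le> M"
    and bdry: "e 0 = 0" "e M = 0" and ev: "\<And>i. e i = \<tau> * v i"
    and eq: "\<And>i. \<lbrakk>1 \<le> i; i < M\<rbrakk> \<Longrightarrow> g * v i = lam * dxx h e i + R i"
    and R: "(\<Sum>i\<in>{1..<M}. (R i)\<^sup>2) \<le> Q"
  shows "(\<Sum>i\<in>{1..<M}. (v i)\<^sup>2) \<le> Q / g\<^sup>2"
    and "(\<Sum>i\<in>{1..<M}. (dxx h e i)\<^sup>2) \<le> 4 * Q / lam\<^sup>2"
    and "(\<Sum>i<M. (e (Suc i) - e i)\<^sup>2) / h\<^sup>2 \<le> \<tau> * Q / (4 * g * lam)"
proof -
  define V where "V = (\<Sum>i\<in>{1..<M}. (v i)\<^sup>2)"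
  define H where "H = (\<Sum>i<M. (e (Suc i) - e i)\<^sup>2) / h\<^sup>2"
  have H0: "0 \<le> H" by (simp add: H_def sum_nonneg)
  have "g * V = (\<Sum>i\<in>{1..<M}. lam / \<tau> * (dxx h e i * e i) + R i * v i)"
    unfolding V_def sum_distrib_left
  proof (rule sum.cong[OF refl])
    fix i assume "i \<in> {1..<M}"
    then have "g * v i = lam * dxx h e i + R i" using eq by simp
    then have "g * v i * v i = (lam * dxx h e i + R i) * v i" by simp
    then show "g * (v i)\<^sup>2 = lam / \<tau> * (dxx h e i * e i) + R i * v i"
      using pos by (simp add: ev power2_eq_square algebra_simps)
  qed
  also have "\<dots> = lam / \<tau> * (\<Sum>i\<in>{1..<M}. dxx h e i * e i) + (\<Sum>i\<in>{1..<M}. R i * v i)"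
    by (simp add: sum.distrib sum_distrib_left)
  also have "(\<Sum>i\<in>{1..<M}. dxx h e i * e i) = - H"
    using bdry pos by (subst sum_dxx_by_parts) (auto simp: H_def power2_eq_square)
  finally have en: "g * V + lam / \<tau> * H = (\<Sum>i\<in>{1..<M}. R i * v i)" by simp
  have young: "(\<Sum>i\<in>{1..<M}. R i * v i) \<le> \<mu> / 2 * V + Q / (2 * \<mu>)" if "0 < \<mu>" for \<mu>
  proof -
    have "(\<Sum>i\<in>{1..<M}. (R i)\<^sup>2) / (2 * \<mu>) \<le> Q / (2 * \<mu>)" using R that by (intro divide_right_mono) auto
    then show ?thesis using sum_mult_le_weighted_squares[OF that, of R v "{1..<M}"] by (simp add: V_def)
  qed
  have "0 \<le> lam / \<tau> * H" using pos H0 by simp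
  then have "g / 2 * V \<le> Q / (2 * g)" using en young[OF pos(1)] by (simp add: field_simps)
  then have V: "V \<le> Q / g\<^sup>2" using pos by (simp add: field_simps power2_eq_square)
  then show "(\<Sum>i\<in>{1..<M}. (v i)\<^sup>2) \<le> Q / g\<^sup>2" by (simp add: V_def)
  have "lam / \<tau> * H \<le> Q / (2 * (2 * g))" using en young[of "2 * g"] pos by simp
  then have "\<tau> / lam * (lam / \<tau> * H) \<le> \<tau> / lam * (Q / (2 * (2 * g)))" 
    using pos by (intro mult_left_mono) auto
  then show "(\<Sum>i<M. (e (Suc i) - e i)\<^sup>2) / h\<^sup>2 \<le> \<tau> * Q / (4 * g * lam)"
    using pos by (simp add: H_def mult_ac)
  have "(\<Sum>i\<in>{1..<M}. (dxx h e i)\<^sup>2) = (\<Sum>i\<in>{1..<M}. (g / lam * v i + (- 1 / lam) * R i)\<^sup>2)"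
    using eq pos by (intro sum.cong) (auto simp: field_simps)
  also have "\<dots> \<le> 2 * (g / lam)\<^sup>2 * V + 2 * (- 1 / lam)\<^sup>2 * (\<Sum>i\<in>{1..<M}. (R i)\<^sup>2)"
    unfolding V_def by (rule sum_square_add_le)
  also have "\<dots> \<le> 2 * (g / lam)\<^sup>2 * (Q / g\<^sup>2) + 2 * (- 1 / lam)\<^sup>2 * Q"
    using V R by (intro add_mono mult_left_mono) auto
  also have "\<dots> = 4 * Q / lam\<^sup>2" using pos by (simp add: power_divide)
  finally show "(\<Sum>i\<in>{1..<M}. (dxx h e i)\<^sup>2) \<le> 4 * Q / lam\<^sup>2" .
qed

text \<open>Testing with \<open>y\<close> discards the new gradient energy and keeps that of
  \<open>E1\<close>. The first step bounds \<open>d\<close> by a multiple of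
  \<open>\<tau> * Q / g\<close>, so the division by \<open>\<tau>\<close> is harmless and both terms
  become of order \<open>Q / g^2\<close>.\<close>

lemma second_step_estimate:
  fixes E1 E2 y F :: "nat \<Rightarrow> real"
  assumes pos: "0 < g" "0 \<le> G" "0 < \<tau>" "0 < h" "1 \<le> M"
    and bdry: "E1 0 = 0" "E1 M = 0" "E2 0 = 0" "E2 M = 0"
    and y: "\<And>i. \<lbrakk>1 \<le> i; i < M\<rbrakk> \<Longrightarrow> E2 i - E1 i = \<tau> * y i"
    and eq: "\<And>i. \<lbrakk>1 \<le> i; i < M\<rbrakk> \<Longrightarrow> g * y i = G * dxx h (\<lambda>m. (E2 m + E1 m) / 2) i + F i"
    and F: "(\<Sum>i\<in>{1..<M}. (F i)\<^sup>2) \<le> Q" and d: "(\<Sum>i<M. (E1 (Suc i) - E1 i)\<^sup>2) / h\<^sup>2 \<le> d"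
  shows "(\<Sum>i\<in>{1..<M}. (y i)\<^sup>2) \<le> 2 / g * (G * d / (2 * \<tau>) + Q / (2 * g))"
proof -
  define Y where "Y = (\<Sum>i\<in>{1..<M}. (y i)\<^sup>2)"
  define H1 where "H1 = (\<Sum>i<M. (E1 (Suc i) - E1 i)\<^sup>2)"
  define H2 where "H2 = (\<Sum>i<M. (E2 (Suc i) - E2 i)\<^sup>2)"
  have "g * Y = (\<Sum>i\<in>{1..<M}. G / \<tau> * (dxx h (\<lambda>m. (E2 m + E1 m) / 2) i * (E2 i - E1 i)) + F i * y i)"
    unfolding Y_def sum_distrib_left
  proof (rule sum.cong[OF refl])
    fix i assume i: "i \<in> {1..<M}"
    have "g * y i * y i = (G * dxx h (\<lambda>m. (E2 m + E1 m) / 2) i + F i) * y i" using eq[of i] i by simp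
    then show "g * (y i)\<^sup>2 = G / \<tau> * (dxx h (\<lambda>m. (E2 m + E1 m) / 2) i * (E2 i - E1 i)) + F i * y i"
      using pos y[of i] i by (simp add: power2_eq_square distrib_right)
  qed
  also have "\<dots> = G / \<tau> * ((H1 - H2) / (2 * h\<^sup>2)) + (\<Sum>i\<in>{1..<M}. F i * y i)"
    unfolding sum.distrib sum_distrib_left[symmetric] H1_def H2_def
    using bdry pos by (subst sum_dxx_average_increment) auto
  also have "\<dots> \<le> G / \<tau> * (d / 2) + (g / 2 * Y + Q / (2 * g))"
  proof (intro add_mono mult_left_mono)
    have "(H1 - H2) / (2 * h\<^sup>2) \<le> H1 / (2 * h\<^sup>2)"
      using sum_nonneg[of "{..<M}" "\<lambda>i. (E2 (Suc i) - E2 i)\<^sup>2"] by (intro divide_right_mono) (auto simp: H2_def)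
    also have "\<dots> = (H1 / h\<^sup>2) / 2" by simp
    also have "\<dots> \<le> d / 2" using d[folded H1_def] by (rule divide_right_mono) simp
    finally show "(H1 - H2) / (2 * h\<^sup>2) \<le> d / 2" .
    have "(\<Sum>i\<in>{1..<M}. (F i)\<^sup>2) / (2 * g) \<le> Q / (2 * g)" using F pos by (intro divide_right_mono) auto
    then show "(\<Sum>i\<in>{1..<M}. F i * y i) \<le> g / 2 * Y + Q / (2 * g)"
      using sum_mult_le_weighted_squares[OF pos(1), of F y "{1..<M}"] by (simp add: Y_def)
  qed (use pos in auto)
  finally have "g / 2 * Y \<le> G * d / (2 * \<tau>) + Q / (2 * g)" by (simp add: mult.commute)
  then have "2 / g * (g / 2 * Y) \<le> 2 / g * (G * d / (2 * \<tau>) + Q / (2 * g))"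
    using pos by (intro mult_left_mono) auto
  then show ?thesis using pos by (simp add: Y_def)
qed


text \<open>With the convention for \<^term>\<open>k = 0\<close>, consecutive values differ by \<^term>\<open>\<tau> * (a * v (Suc k) + (1 - a) * v k)\<close>
  for all \<^term>\<open>k\<close>, where \<^term>\<open>v\<close> is the backward difference quotient of the error and \<^term>\<open>v 0 = 0\<close>.\<close>
definition ebar :: "real \<Rightarrow> (nat \<Rightarrow> nat \<Rightarrow> real) \<Rightarrow> nat \<Rightarrow> nat \<Rightarrow> real" where
  "ebar a e i k = (if k = 0 then 0 else a * e i k + (1 - a) * e i (k - 1))"

lemma sum_square_add3_le:
  fixes x y z :: "'a \<Rightarrow> real"
  shows "(\<Sum>i\<in>I. (b * x i + c * y i + d * z i)\<^sup>2)
    \<le> 3 * b\<^sup>2 * (\<Sum>i\<in>I. (x i)\<^sup>2) + 3 * c\<^sup>2 * (\<Sum>i\<in>I. (y i)\<^sup>2) + 3 * d\<^sup>2 * (\<Sum>i\<in>I. (z i)\<^sup>2)"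
proof -
  have "(b * x i + c * y i + d * z i)\<^sup>2 \<le> 3 * b\<^sup>2 * (x i)\<^sup>2 + 3 * c\<^sup>2 * (y i)\<^sup>2 + 3 * d\<^sup>2 * (z i)\<^sup>2" for i
    using zero_le_power2[of "b * x i - c * y i"] zero_le_power2[of "b * x i - d * z i"]
      zero_le_power2[of "c * y i - d * z i"]
    by (simp add: power2_eq_square algebra_simps)
  then show ?thesis by (simp add: sum_distrib_left sum.distrib[symmetric] sum_mono)
qed

section \<open>The scheme as a convolution equation with perturbed initial coefficients\<close>

lemma dxx_cmult: "dxx h (\<lambda>m. c * v m) i = c * dxx h v i"
  by (simp add: dxx_def algebra_simps)

lemma dxx_linear: "dxx h (\<lambda>m. p * x m + q * y m) i = p * dxx h x i + q * dxx h y i"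
  by (simp add: dxx_def add_divide_distrib diff_divide_distrib algebra_simps)

lemma dxx_average: "dxx h (\<lambda>m. (x m + y m) / 2) i = (dxx h x i + dxx h y i) / 2"
  using dxx_linear[of h "1/2" x "1/2" y i] by (simp add: add_divide_distrib)

text \<open>After the reversal \<open>l = k - j\<close> only \<open>j = 0\<close> and
  \<open>j = 1\<close> deviate from the convolution kernel. The initial difference of the scheme is
  \<open>2 / \<tau>\<close> times \<open>v 1 - v 0\<close>, whence the factor 2 in front of
  \<open>coef_c \<alpha> 1 k k\<close>; the convention \<open>v 0 = 0\<close> expresses that the
  error has zero initial velocity.\<close>

lemma scheme_convolution_form:
  fixes e :: "nat \<Rightarrow> nat \<Rightarrow> real"
  assumes "1 \<le> k" "0 < \<tau>" and v0: "v 0 = 0" and v: "\<And>j. v (Suc j) = (e i (Suc j) - e i j) / \<tau>"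
  shows "\<tau> powr (1 - \<alpha>) * (\<Sum>j\<le>k. conv_coef \<alpha> (k - j) * (v (Suc j) - v j))
    = (\<Sum>l=0..k. coef_c \<alpha> \<tau> k l * dtt \<tau> h (\<lambda>_. 0) e i (k - l))
      + \<tau> powr (1 - \<alpha>) * ((conv_coef \<alpha> (k - 1) - coef_c \<alpha> 1 k (k - 1)) * (v 2 - v 1)
        + (conv_coef \<alpha> k - 2 * coef_c \<alpha> 1 k k) * v 1)"
proof -
  have t: "\<tau> powr (2 - \<alpha>) = \<tau> * \<tau> powr (1 - \<alpha>)"
    using assms powr_add[of \<tau> 1 "1 - \<alpha>"] by (simp add: algebra_simps)
  have d: "\<tau> * dtt \<tau> h (\<lambda>_. 0) e i j = (if j = 0 then 2 else 1) * (v (Suc j) - v j)" for j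
    using assms(2) v[of "j - 1"] v0
    by (cases j) (auto simp: dtt_def v field_simps power2_eq_square)
  have "(\<Sum>l=0..k. coef_c \<alpha> \<tau> k l * dtt \<tau> h (\<lambda>_. 0) e i (k - l))
      = (\<Sum>j\<le>k. coef_c \<alpha> \<tau> k (k - j) * dtt \<tau> h (\<lambda>_. 0) e i j)"
    by (rule sum.reindex_bij_witness[of _ "\<lambda>j. k - j" "\<lambda>j. k - j"]) auto
  also have "\<dots> = \<tau> powr (1 - \<alpha>) * (\<Sum>j\<le>k. coef_c \<alpha> 1 k (k - j) * ((if j = 0 then 2 else 1) * (v (Suc j) - v j)))"
    unfolding d[symmetric] sum_distrib_left
    by (intro sum.cong refl) (subst coef_c_scale, simp add: t)
  finally have 1: "(\<Sum>l=0..k. coef_c \<alpha> \<tau> k l * dtt \<tau> h (\<lambda>_. 0) e i (k - l)) = \<dots>" .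
  obtain m where k: "k = Suc m" using assms(1) by (cases k) auto
  have split: "(\<Sum>j\<le>k. f j) = f 0 + f 1 + (\<Sum>j\<in>{2..k}. f j)" for f :: "nat \<Rightarrow> real"
    using assms(1)
    by (simp add: atMost_atLeast0 sum.atLeast_Suc_atMost numeral_2_eq_2)
  have "(\<Sum>j\<in>{2..k}. coef_c \<alpha> 1 k (k - j) * ((if j = 0 then 2 else 1) * (v (Suc j) - v j)))
      = (\<Sum>j\<in>{2..k}. conv_coef \<alpha> (k - j) * (v (Suc j) - v j))"
    by (intro sum.cong refl) (auto simp: coef_c_eq_conv_coef)
  then show ?thesis unfolding 1 split v0 by (simp add: algebra_simps numeral_2_eq_2 v0)
qed

text \<open>The kernel of the scheme is a convolution only up to its last two coefficients; these act on the
  first two time steps, which are estimated beforehand, so that the deviation becomes a source term.\<close>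
lemma scheme_stability:
  fixes \<alpha> T L :: real
  assumes \<alpha>: "1 < \<alpha>" "\<alpha> < 2" and T: "0 < T" and L: "0 < L"
  shows "\<exists>C>0. \<forall>N M e R \<rho>. 1 \<le> N \<longrightarrow> 1 \<le> M \<longrightarrow> 0 \<le> \<rho> \<longrightarrow> (\<forall>i. e i 0 = 0) \<longrightarrow>
      (\<forall>k\<le>N. e 0 k = 0 \<and> e M k = 0) \<longrightarrow>
      (\<forall>i\<in>{1..<M}. 1 / Gamma (3 - \<alpha>) * ((1 - \<alpha>/3) * (T / real N)) powr (2 - \<alpha>)
          * dtt (T / real N) (L / real M) (\<lambda>_. 0) e i 0
        = (1 - \<alpha>/3) * dxx (L / real M) (\<lambda>m. e m 1) i + R i 0) \<longrightarrow>
      (\<forall>i\<in>{1..<M}. \<forall>k\<in>{1..<N}.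
         1 / Gamma (2 - \<alpha>) * (\<Sum>l=0..k. coef_c \<alpha> (T / real N) k l * dtt (T / real N) (L / real M) (\<lambda>_. 0) e i (k - l))
         = dxx (L / real M) (\<lambda>m. (ebar (1/2 + sig \<alpha>) e m (Suc k) + ebar (1/2 + sig \<alpha>) e m k) / 2) i + R i k) \<longrightarrow>
      (\<forall>i\<in>{1..<M}. \<forall>k<N. \<bar>R i k\<bar> \<le> \<rho>) \<longrightarrow>
      (\<forall>i\<le>M. \<forall>k\<le>N. \<bar>ebar (1/2 + sig \<alpha>) e i k\<bar> \<le> C * \<rho>)"
proof -
  note sg = sig_bounds[OF \<alpha>]
  define a where "a = 1/2 + sig \<alpha>"
  define \<Gamma> where "\<Gamma> = Gamma (2 - \<alpha>)"
  define lam where "lam = 1 - \<alpha>/3"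
  \<comment> \<open>Read off the first equation: with
    \<open>\<theta> = \<tau> powr (1 - \<alpha>)\<close> its left-hand side is
    \<open>p * \<theta> * v i 1\<close>.\<close>
  define p where "p = 2 / Gamma (3 - \<alpha>) * lam powr (2 - \<alpha>)"
  define c0 where "c0 = coef_c \<alpha> 1 1 0"
  \<comment> \<open>Solving \<open>y = a * v 2 + (1 - a) * v 1\<close> for \<open>v 2 - v 1\<close>
    turns the equation at level 1 into one for \<open>y\<close>; \<open>r\<close> is the coefficient
    left over for \<open>v 1\<close>.\<close>
  define r where "r = 2 * coef_c \<alpha> 1 1 1 - c0 / a"
  \<comment> \<open>\<open>K1 * Q\<close> and \<open>K2 * Q\<close> will bound
    \<open>\<theta>^2\<close> times the squared l2 norms of \<open>v 1\<close> and
    \<open>v 2 - v 1\<close>; \<open>KS0 * Q\<close> and \<open>KS1 * Q\<close> those of the source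
    at level 0 and at later levels.\<close>
  define K1 where "K1 = 1 / p\<^sup>2"
  define KF where "KF = 2 * \<Gamma>\<^sup>2 + 2 * r\<^sup>2 * K1"
  define KY where "KY = 2 * a / c0 * (\<Gamma> * a\<^sup>2 / (8 * p * lam) + a * KF / (2 * c0))"
  define K2 where "K2 = 2 * (1 / a)\<^sup>2 * KY + 2 * (-(1/a))\<^sup>2 * K1"
  define B where "B = conv_coef \<alpha> 0 + 3 * ((sig \<alpha> + 1/2) powr (2 - \<alpha>) / (2 - \<alpha>))"
  define KS0 where "KS0 = 2 * (conv_coef \<alpha> 0)\<^sup>2 * K1 + 2 * (\<Gamma> * a / 2)\<^sup>2 * (4 / lam\<^sup>2)"
  define KS1 where "KS1 = 3 * \<Gamma>\<^sup>2 + 3 * B\<^sup>2 * K2 + 3 * B\<^sup>2 * K1"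
  define \<mu> where "\<mu> = T powr (1 - \<alpha>)"
  define C where "C = L * sqrt (T * (KS0 + KS1) / (\<mu> * \<Gamma>)) + 1"
  have a: "1/2 < a" "a < 1" using sg by (auto simp: a_def)
  have \<Gamma>: "0 < \<Gamma>" using \<alpha> by (simp add: \<Gamma>_def Gamma_real_pos)
  have lam: "0 < lam" using \<alpha> by (simp add: lam_def)
  have "0 < Gamma (3 - \<alpha>)" using \<alpha> by (simp add: Gamma_real_pos)
  then have p: "0 < p" using lam by (simp add: p_def)
  have c0: "0 < c0" using coef_c_0_1_pos[OF \<alpha>] by (simp add: c0_def)
  have \<mu>: "0 < \<mu>" using T by (simp add: \<mu>_def)
  have K: "0 \<le> K1" "0 \<le> KF" "0 \<le> KY" "0 \<le> K2" "0 \<le> KS0" "0 \<le> KS1"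
    using a \<Gamma> p c0 lam by (auto simp: K1_def KF_def KY_def K2_def KS0_def KS1_def)
  have B0: "0 < B" using conv_coef_pos[OF \<alpha>, of 0] \<alpha> by (auto simp: B_def intro!: add_pos_nonneg)
  have conv_le: "conv_coef \<alpha> m \<le> conv_coef \<alpha> 0" for m
    by (rule lift_Suc_antimono_le[of "conv_coef \<alpha>"]) (auto simp: conv_coef_decreasing[OF \<alpha>])
  have B1: "\<bar>conv_coef \<alpha> (k - 1) - coef_c \<alpha> 1 k (k - 1)\<bar> \<le> B" if "1 \<le> k" for k
    using abs_coef_c_penultimate_le[OF \<alpha> that] conv_le[of "k - 1"] conv_coef_pos[OF \<alpha>, of "k - 1"]
    unfolding B_def by linarith
  have B2: "\<bar>conv_coef \<alpha> k - 2 * coef_c \<alpha> 1 k k\<bar> \<le> B" if "1 \<le> k" for k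
  proof -
    have "0 \<le> (sig \<alpha> + 1/2) powr (1 - \<alpha>)" by simp
    then show ?thesis
      using abs_coef_c_last_le[OF \<alpha> that] head_ge[OF \<alpha>] conv_le[of k] conv_coef_pos[OF \<alpha>, of k]
      unfolding B_def by linarith
  qed
  have C: "0 < C" using T L \<mu> \<Gamma> K by (auto simp: C_def intro!: add_nonneg_pos)
  show ?thesis
    unfolding a_def[symmetric] \<Gamma>_def[symmetric] lam_def[symmetric]
  proof (intro exI[of _ C] conjI C allI impI)
    fix N M :: nat and e R :: "nat \<Rightarrow> nat \<Rightarrow> real" and \<rho> :: real and i k :: nat
    define \<tau> where "\<tau> = T / real N"
    define h where "h = L / real M"
    assume N: "1 \<le> N" and M: "1 \<le> M" and \<rho>: "0 \<le> \<rho>" and e0: "\<forall>i. e i 0 = 0"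
      and bdry: "\<forall>k\<le>N. e 0 k = 0 \<and> e M k = 0"
      and first: "\<forall>i\<in>{1..<M}. 1 / Gamma (3 - \<alpha>) * (lam * (T / real N)) powr (2 - \<alpha>)
          * dtt (T / real N) (L / real M) (\<lambda>_. 0) e i 0
        = lam * dxx (L / real M) (\<lambda>m. e m 1) i + R i 0"
      and step: "\<forall>i\<in>{1..<M}. \<forall>k\<in>{1..<N}.
         1 / \<Gamma> * (\<Sum>l=0..k. coef_c \<alpha> (T / real N) k l * dtt (T / real N) (L / real M) (\<lambda>_. 0) e i (k - l))
         = dxx (L / real M) (\<lambda>m. (ebar a e m (Suc k) + ebar a e m k) / 2) i + R i k"
      and R: "\<forall>i\<in>{1..<M}. \<forall>k<N. \<bar>R i k\<bar> \<le> \<rho>" and i: "i \<le> M" and k: "k \<le> N"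
    note first = first[folded \<tau>_def h_def] and step = step[folded \<tau>_def h_def]
    have \<tau>: "0 < \<tau>" "real N * \<tau> = T" and h: "0 < h" "real M * h = L"
      using N M T L by (auto simp: \<tau>_def h_def)
    define \<theta> where "\<theta> = \<tau> powr (1 - \<alpha>)"
    have \<theta>: "0 < \<theta>" "\<tau> powr (2 - \<alpha>) = \<tau> * \<theta>"
      using \<tau> powr_add[of \<tau> 1 "1 - \<alpha>"] by (auto simp: \<theta>_def algebra_simps)
    \<comment> \<open>The l2 norms are unscaled, so \<open>Q\<close> grows with the number of nodes;
      the final Sobolev step compensates for this.\<close>
    define Q where "Q = real M * \<rho>\<^sup>2"
    have Q0: "0 \<le> Q" by (simp add: Q_def)
    have RQ: "(\<Sum>i\<in>{1..<M}. (R i k)\<^sup>2) \<le> Q" if "k < N" for k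
    proof -
      have "(\<Sum>i\<in>{1..<M}. (R i k)\<^sup>2) \<le> (\<Sum>i\<in>{1..<M}. \<rho>\<^sup>2)"
        using R that by (intro sum_mono) (auto simp: abs_le_square_iff[symmetric] abs_of_nonneg[OF \<rho>])
      also have "\<dots> \<le> Q" by (simp add: Q_def mult_right_mono)
      finally show ?thesis .
    qed
    define v where "v i j = (case j of 0 \<Rightarrow> 0 | Suc j \<Rightarrow> (e i (Suc j) - e i j) / \<tau>)" for i j
    have v0: "v i 0 = 0" and vS: "v i (Suc j) = (e i (Suc j) - e i j) / \<tau>" for i j
      by (auto simp: v_def)
    define E where "E = ebar a e"
    have E0: "E i 0 = 0" and E1: "E i (Suc 0) = a * e i 1" for i
      using e0 by (auto simp: E_def ebar_def)
    have Ebdry: "E 0 k = 0 \<and> E M k = 0" if "k \<le> N" for k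
      using bdry that by (auto simp: E_def ebar_def)
    have vE: "E i (Suc k) - E i k = \<tau> * (a * v i (Suc k) + (1 - a) * v i k)" for i k
      using \<tau> e0 by (cases k) (auto simp: E_def ebar_def v_def field_simps)

    define V1 where "V1 = (\<Sum>i\<in>{1..<M}. (v i 1)\<^sup>2)"
    have first': "p * \<theta> * v i 1 = lam * dxx h (\<lambda>m. e m 1) i + R i 0" if "1 \<le> i" "i < M" for i
    proof -
      have "1 / Gamma (3 - \<alpha>) * (lam * \<tau>) powr (2 - \<alpha>) * dtt \<tau> h (\<lambda>_. 0) e i 0 = p * \<theta> * v i 1"
        using \<tau> lam \<theta> by (simp add: dtt_def p_def powr_mult v_def)
      then show ?thesis using first that by auto
    qed
    have est1: "V1 \<le> Q / (p * \<theta>)\<^sup>2" "(\<Sum>i\<in>{1..<M}. (dxx h (\<lambda>m. e m 1) i)\<^sup>2) \<le> 4 * Q / lam\<^sup>2"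
       "(\<Sum>i<M. (e (Suc i) 1 - e i 1)\<^sup>2) / h\<^sup>2 \<le> \<tau> * Q / (4 * (p * \<theta>) * lam)"
      unfolding V1_def
      using first_step_estimate[of "p * \<theta>" lam \<tau> h M "\<lambda>m. e m 1" "\<lambda>m. v m 1" "\<lambda>m. R m 0" Q]
        p lam \<tau> h M N bdry e0 first' RQ[of 0] \<theta> by (auto simp: v_def)
    have V1: "\<theta>\<^sup>2 * V1 \<le> K1 * Q"
    proof -
      have "\<theta>\<^sup>2 * V1 \<le> \<theta>\<^sup>2 * (Q / (p * \<theta>)\<^sup>2)" using est1(1) by (intro mult_left_mono) auto
      also have "\<dots> = K1 * Q" using \<theta> p by (simp add: K1_def field_simps)
      finally show ?thesis .
    qed
    have conv: "\<theta> * (\<Sum>j\<le>k. conv_coef \<alpha> (k - j) * (v i (Suc j) - v i j))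
      = \<Gamma> * (dxx h (\<lambda>m. (E m (Suc k) + E m k) / 2) i + R i k)
        + \<theta> * ((conv_coef \<alpha> (k - 1) - coef_c \<alpha> 1 k (k - 1)) * (v i 2 - v i 1)
            + (conv_coef \<alpha> k - 2 * coef_c \<alpha> 1 k k) * v i 1)"
      if "1 \<le> i" "i < M" "1 \<le> k" "k < N" for i k
    proof -
      have "1 / \<Gamma> * (\<Sum>l=0..k. coef_c \<alpha> \<tau> k l * dtt \<tau> h (\<lambda>_. 0) e i (k - l))
        = dxx h (\<lambda>m. (E m (Suc k) + E m k) / 2) i + R i k"
        using step that by (auto simp: E_def)
      then have "(\<Sum>l=0..k. coef_c \<alpha> \<tau> k l * dtt \<tau> h (\<lambda>_. 0) e i (k - l))
        = \<Gamma> * (dxx h (\<lambda>m. (E m (Suc k) + E m k) / 2) i + R i k)"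
        using \<Gamma> by (simp add: field_simps)
      then show ?thesis
        using scheme_convolution_form[OF that(3) \<tau>(1), where i = i and e = e and v = "v i" and h = h and \<alpha> = \<alpha>]
        by (simp only: \<theta>_def v0 vS)
    qed

    define V21 where "V21 = (\<Sum>i\<in>{1..<M}. (v i 2 - v i 1)\<^sup>2)"
    have V21: "\<theta>\<^sup>2 * V21 \<le> K2 * Q" if "1 < N"
    proof -
      define y where "y i = a * v i 2 + (1 - a) * v i 1" for i
      define F where "F i = \<Gamma> * R i 1 + (- (\<theta> * r)) * v i 1" for i
      have "(\<Sum>i\<in>{1..<M}. (y i)\<^sup>2) \<le> 2 / (\<theta> * c0 / a) *
          (\<Gamma> * (a\<^sup>2 * (\<tau> * Q / (4 * (p * \<theta>) * lam))) / (2 * \<tau>) + (KF * Q) / (2 * (\<theta> * c0 / a)))"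
      proof (rule second_step_estimate[of _ _ _ h M "\<lambda>m. E m 1" "\<lambda>m. E m 2" _ F])
        fix i assume im: "1 \<le> i" "i < M"
        show "E i 2 - E i 1 = \<tau> * y i" using vE[of i 1] by (simp add: y_def numeral_2_eq_2)
        have "\<theta> * (c0 * (v i 2 - v i 1) + 2 * coef_c \<alpha> 1 1 1 * v i 1)
            = \<Gamma> * (dxx h (\<lambda>m. (E m 2 + E m 1) / 2) i + R i 1)"
          using conv[OF im, of 1] that by (simp add: numeral_2_eq_2 c0_def v0 algebra_simps)
        moreover have "c0 * (v i 2 - v i 1) + 2 * coef_c \<alpha> 1 1 1 * v i 1 = c0 / a * y i + r * v i 1"
          using a by (simp add: y_def r_def field_simps)
        ultimately have "\<theta> * (c0 / a * y i + r * v i 1) = \<Gamma> * (dxx h (\<lambda>m. (E m 2 + E m 1) / 2) i + R i 1)"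
          by (simp only:)
        then show "\<theta> * c0 / a * y i = \<Gamma> * dxx h (\<lambda>m. (E m 2 + E m 1) / 2) i + F i"
          by (simp add: F_def algebra_simps)
      next
        have "(\<Sum>i\<in>{1..<M}. (F i)\<^sup>2) \<le> 2 * \<Gamma>\<^sup>2 * (\<Sum>i\<in>{1..<M}. (R i 1)\<^sup>2) + 2 * (- (\<theta> * r))\<^sup>2 * V1"
          unfolding F_def V1_def by (rule sum_square_add_le)
        also have "2 * (- (\<theta> * r))\<^sup>2 * V1 = 2 * r\<^sup>2 * (\<theta>\<^sup>2 * V1)" by (simp add: power_mult_distrib)
        also have "2 * \<Gamma>\<^sup>2 * (\<Sum>i\<in>{1..<M}. (R i 1)\<^sup>2) + 2 * r\<^sup>2 * (\<theta>\<^sup>2 * V1)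
            \<le> 2 * \<Gamma>\<^sup>2 * Q + 2 * r\<^sup>2 * (K1 * Q)"
          using RQ[OF that] V1 by (intro add_mono mult_left_mono) auto
        finally show "(\<Sum>i\<in>{1..<M}. (F i)\<^sup>2) \<le> KF * Q" by (simp add: KF_def algebra_simps)
        \<comment> \<open>\<open>E\<close> at level 1 is \<open>a * e\<close>, so the gradient bound
          of the first step carries over with the factor \<open>a^2\<close>.\<close>
        have "(\<Sum>i<M. (E (Suc i) 1 - E i 1)\<^sup>2) / h\<^sup>2 = a\<^sup>2 * ((\<Sum>i<M. (e (Suc i) 1 - e i 1)\<^sup>2) / h\<^sup>2)"
          by (simp add: E1 right_diff_distrib[symmetric] power_mult_distrib sum_distrib_left[symmetric])
        also have "\<dots> \<le> a\<^sup>2 * (\<tau> * Q / (4 * (p * \<theta>) * lam))"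
          using est1(3) by (intro mult_left_mono) auto
        finally show "(\<Sum>i<M. (E (Suc i) 1 - E i 1)\<^sup>2) / h\<^sup>2 \<le> a\<^sup>2 * (\<tau> * Q / (4 * (p * \<theta>) * lam))" .
      qed (use \<theta> c0 a \<Gamma> \<tau> h M Ebdry[of 1] Ebdry[of 2] that in auto)
      also have "\<dots> = KY * Q / \<theta>\<^sup>2"
        unfolding KY_def using \<theta> c0 a p lam \<tau> by (simp add: field_simps power2_eq_square)
      finally have Y: "\<theta>\<^sup>2 * (\<Sum>i\<in>{1..<M}. (y i)\<^sup>2) \<le> KY * Q"
        using \<theta> by (simp add: field_simps)
      have "V21 = (\<Sum>i\<in>{1..<M}. (1 / a * y i + (- (1 / a)) * v i 1)\<^sup>2)"
      proof -
        have "v i 2 - v i 1 = 1 / a * y i + (- (1 / a)) * v i 1" for i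
          using a by (simp add: y_def field_simps)
        then show ?thesis by (simp only: V21_def)
      qed
      also have "\<dots> \<le> 2 * (1 / a)\<^sup>2 * (\<Sum>i\<in>{1..<M}. (y i)\<^sup>2) + 2 * (-(1/a))\<^sup>2 * V1"
        unfolding V1_def by (rule sum_square_add_le)
      finally have "\<theta>\<^sup>2 * V21 \<le> \<theta>\<^sup>2 * (2 * (1 / a)\<^sup>2 * (\<Sum>i\<in>{1..<M}. (y i)\<^sup>2) + 2 * (-(1/a))\<^sup>2 * V1)"
        by (intro mult_left_mono) auto
      also have "\<dots> = 2 * (1 / a)\<^sup>2 * (\<theta>\<^sup>2 * (\<Sum>i\<in>{1..<M}. (y i)\<^sup>2)) + 2 * (-(1/a))\<^sup>2 * (\<theta>\<^sup>2 * V1)"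
        by (simp add: algebra_simps)
      also have "\<dots> \<le> 2 * (1 / a)\<^sup>2 * (KY * Q) + 2 * (-(1/a))\<^sup>2 * (K1 * Q)"
        using Y V1 by (intro add_mono mult_left_mono) auto
      finally show ?thesis by (simp add: K2_def algebra_simps)
    qed

    \<comment> \<open>The scheme has no convolution equation at level 0. There the source is defined
      as whatever makes the equation hold: the convolution term
      \<open>\<theta> * conv_coef \<alpha> 0 * v i 1\<close> minus the diffusion of
      \<open>(E 1 + E 0) / 2 = a / 2 * e 1\<close>.\<close>
    define S where "S i k = (if k = 0
        then (\<theta> * conv_coef \<alpha> 0) * v i 1 + (- (\<Gamma> * a / 2)) * dxx h (\<lambda>m. e m 1) i
        else \<Gamma> * R i k + (\<theta> * (conv_coef \<alpha> (k - 1) - coef_c \<alpha> 1 k (k - 1))) * (v i 2 - v i 1)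
            + (\<theta> * (conv_coef \<alpha> k - 2 * coef_c \<alpha> 1 k k)) * v i 1)" for i k
    have S0: "(\<Sum>i\<in>{1..<M}. (S i 0)\<^sup>2) \<le> KS0 * Q"
    proof -
      have "(\<Sum>i\<in>{1..<M}. (S i 0)\<^sup>2) \<le> 2 * (\<theta> * conv_coef \<alpha> 0)\<^sup>2 * V1
          + 2 * (- (\<Gamma> * a / 2))\<^sup>2 * (\<Sum>i\<in>{1..<M}. (dxx h (\<lambda>m. e m 1) i)\<^sup>2)"
        unfolding S_def if_P[OF refl] V1_def by (rule sum_square_add_le)
      also have "\<dots> = 2 * (conv_coef \<alpha> 0)\<^sup>2 * (\<theta>\<^sup>2 * V1)
          + 2 * (\<Gamma> * a / 2)\<^sup>2 * (\<Sum>i\<in>{1..<M}. (dxx h (\<lambda>m. e m 1) i)\<^sup>2)"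
        by (simp add: power_mult_distrib)
      also have "\<dots> \<le> 2 * (conv_coef \<alpha> 0)\<^sup>2 * (K1 * Q) + 2 * (\<Gamma> * a / 2)\<^sup>2 * (4 * Q / lam\<^sup>2)"
        using V1 est1(2) by (intro add_mono mult_left_mono) auto
      finally show ?thesis by (simp add: KS0_def algebra_simps)
    qed
    have S1: "(\<Sum>i\<in>{1..<M}. (S i k)\<^sup>2) \<le> KS1 * Q" if k: "1 \<le> k" "k < N" for k
    proof -
      have k0: "k \<noteq> 0" using k by simp
      let ?x = "conv_coef \<alpha> (k - 1) - coef_c \<alpha> 1 k (k - 1)" and ?y = "conv_coef \<alpha> k - 2 * coef_c \<alpha> 1 k k"
      have "(\<Sum>i\<in>{1..<M}. (S i k)\<^sup>2) \<le> 3 * \<Gamma>\<^sup>2 * (\<Sum>i\<in>{1..<M}. (R i k)\<^sup>2)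
          + 3 * (\<theta> * ?x)\<^sup>2 * V21 + 3 * (\<theta> * ?y)\<^sup>2 * V1"
        unfolding S_def if_not_P[OF k0] V1_def V21_def by (rule sum_square_add3_le)
      also have "\<dots> = 3 * \<Gamma>\<^sup>2 * (\<Sum>i\<in>{1..<M}. (R i k)\<^sup>2) + 3 * (?x\<^sup>2 * (\<theta>\<^sup>2 * V21)) + 3 * (?y\<^sup>2 * (\<theta>\<^sup>2 * V1))"
        by (simp add: power_mult_distrib)
      also have "\<dots> \<le> 3 * \<Gamma>\<^sup>2 * Q + 3 * (B\<^sup>2 * (K2 * Q)) + 3 * (B\<^sup>2 * (K1 * Q))"
      proof -
        have "?x\<^sup>2 \<le> B\<^sup>2" "?y\<^sup>2 \<le> B\<^sup>2"
          using B1[OF k(1)] B2[OF k(1)] B0 by (auto simp: abs_le_square_iff[symmetric])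
        moreover have "0 \<le> V21" "0 \<le> V1" by (auto simp: V21_def V1_def sum_nonneg)
        ultimately have "?x\<^sup>2 * (\<theta>\<^sup>2 * V21) \<le> B\<^sup>2 * (K2 * Q)" "?y\<^sup>2 * (\<theta>\<^sup>2 * V1) \<le> B\<^sup>2 * (K1 * Q)"
          using V21 V1 k by (auto intro!: mult_mono)
        then show ?thesis
          using RQ[OF k(2)] by (intro add_mono mult_left_mono) auto
      qed
      finally show ?thesis by (simp add: KS1_def algebra_simps)
    qed
    have SQ: "(\<Sum>i\<in>{1..<M}. (S i k)\<^sup>2) \<le> (KS0 + KS1) * Q" if "k < N" for k
    proof -
      have "0 \<le> KS0 * Q" "0 \<le> KS1 * Q" using K Q0 by simp_all
      then show ?thesis unfolding distrib_right using S0 S1[of k] that by (cases "k = 0") force+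
    qed

    have H: "\<Gamma> * (\<Sum>i<M. (E (Suc i) (Suc n) - E i (Suc n))\<^sup>2) / h\<^sup>2 \<le> \<tau> * real (Suc n) * ((KS0 + KS1) * Q) / \<mu>"
      if n: "n < N" for n
    \<comment> \<open>The kernel carries an extra factor \<open>\<tau>\<close> because the energy
      estimate divides the convolution by \<open>\<tau>\<close>.\<close>
    proof (rule energy_estimate[where A = "\<lambda>m. \<tau> * \<theta> * conv_coef \<alpha> m" and v = v and E = E and S = S
          and a = a and N = N])
      show "\<tau> * \<theta> * conv_coef \<alpha> (Suc m) \<le> \<tau> * \<theta> * conv_coef \<alpha> m" for m
        using conv_coef_decreasing[OF \<alpha>, of m] \<tau> \<theta> by (intro mult_left_mono) auto
      show "0 \<le> \<tau> * \<theta> * conv_coef \<alpha> m" for m using conv_coef_pos[OF \<alpha>, of m] \<tau> \<theta> by simp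
      have "\<tau> * \<theta> * (a\<^sup>2 * conv_coef \<alpha> 1) \<le> \<tau> * \<theta> * ((2 * a - 1) * conv_coef \<alpha> 0)"
        using conv_coef_0_1[OF \<alpha>] \<tau> \<theta> by (intro mult_left_mono) (auto simp: a_def)
      then show "a\<^sup>2 * (\<tau> * \<theta> * conv_coef \<alpha> 1) \<le> (2 * a - 1) * (\<tau> * \<theta> * conv_coef \<alpha> 0)"
        by (simp only: mult_ac)
      \<comment> \<open>From \<open>real m + 1 \<le> real N\<close> and
        \<open>real N * \<tau> = T\<close> the lower bound becomes independent of the step
        size.\<close>
      show "\<mu> * \<tau> \<le> \<tau> * \<theta> * conv_coef \<alpha> m" if "m < N" for m
      proof -
        have "\<mu> = \<theta> * real N powr (1 - \<alpha>)"
          unfolding \<mu>_def \<theta>_def \<tau>(2)[symmetric]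
          by (subst powr_mult) (simp_all add: mult.commute less_imp_le[OF \<tau>(1)])
        also have "\<dots> \<le> \<theta> * (real m + 1) powr (1 - \<alpha>)"
          using \<theta> \<alpha> that by (intro mult_left_mono powr_mono2') auto
        also have "\<dots> \<le> \<theta> * conv_coef \<alpha> m"
          using \<theta> conv_coef_ge[OF \<alpha>, of m] by (intro mult_left_mono) auto
        finally show ?thesis using \<tau> by simp
      qed
      fix i k assume ik: "1 \<le> i" "i < M" "k < N"
      have s: "1 / \<tau> * (\<Sum>j\<le>k. \<tau> * \<theta> * conv_coef \<alpha> (k - j) * (v i (Suc j) - v i j))
          = \<theta> * (\<Sum>j\<le>k. conv_coef \<alpha> (k - j) * (v i (Suc j) - v i j))"
        using \<tau> by (simp add: sum_distrib_left mult.assoc)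
      show "1 / \<tau> * (\<Sum>j\<le>k. \<tau> * \<theta> * conv_coef \<alpha> (k - j) * (v i (Suc j) - v i j))
          = \<Gamma> * dxx h (\<lambda>m. (E m (Suc k) + E m k) / 2) i + S i k"
      proof (cases "k = 0")
        case True
        have "(\<lambda>m. (E m (Suc 0) + E m 0) / 2) = (\<lambda>m. a / 2 * e m 1)" by (simp add: E0 E1)
        then have d: "dxx h (\<lambda>m. (E m (Suc 0) + E m 0) / 2) i = a / 2 * dxx h (\<lambda>m. e m 1) i"
          by (simp only: dxx_cmult)
        show ?thesis unfolding s unfolding True d by (simp add: S_def v0)
      next
        case False
        then show ?thesis unfolding s using conv[of i k] ik by (simp add: S_def algebra_simps)
      qed
    qed (use a \<tau> \<mu> M h v0 E0 Ebdry vE SQ n in auto)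

    show "\<bar>ebar a e i k\<bar> \<le> C * \<rho>"
    proof (cases k)
      case 0
      then show ?thesis using C \<rho> by (simp add: ebar_def)
    next
      case (Suc n)
      define Hn where "Hn = (\<Sum>i<M. (E (Suc i) (Suc n) - E i (Suc n))\<^sup>2)"
      have "\<Gamma> * Hn / h\<^sup>2 \<le> \<tau> * real (Suc n) * ((KS0 + KS1) * Q) / \<mu>" using H[of n] Suc k by (simp add: Hn_def)
      also have "\<dots> \<le> T * ((KS0 + KS1) * Q) / \<mu>"
      proof -
        have "\<tau> * real (Suc n) \<le> \<tau> * real N" using \<tau> Suc k by (intro mult_left_mono) auto
        then have "\<tau> * real (Suc n) \<le> T" using \<tau>(2) by (simp add: mult.commute)
        then show ?thesis using K Q0 \<mu> by (intro divide_right_mono mult_right_mono) auto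
      qed
      finally have "h\<^sup>2 / \<Gamma> * (\<Gamma> * Hn / h\<^sup>2) \<le> h\<^sup>2 / \<Gamma> * (T * ((KS0 + KS1) * Q) / \<mu>)"
        using \<Gamma> by (intro mult_left_mono) auto
      then have Hn: "Hn \<le> h\<^sup>2 / \<Gamma> * (T * ((KS0 + KS1) * Q) / \<mu>)" using \<Gamma> h by simp
      have "(E i k)\<^sup>2 \<le> real M * Hn"
        unfolding Hn_def Suc using Ebdry[of "Suc n"] Suc k i by (intro discrete_sobolev) auto
      also have "\<dots> \<le> real M * (h\<^sup>2 / \<Gamma> * (T * ((KS0 + KS1) * Q) / \<mu>))" using Hn by (intro mult_left_mono) auto
      \<comment> \<open>The two factors \<open>real M\<close>, from the Sobolev inequality and from
        \<open>Q\<close>, are used up by \<open>h^2\<close>, since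
        \<open>real M * h = L\<close>.\<close>
      also have "\<dots> = (L * sqrt (T * (KS0 + KS1) / (\<mu> * \<Gamma>)) * \<rho>)\<^sup>2"
      proof -
        define s where "s = T * (KS0 + KS1) / (\<mu> * \<Gamma>)"
        have "0 \<le> s" using T K \<mu> \<Gamma> by (simp add: s_def)
        then have "(L * sqrt s * \<rho>)\<^sup>2 = (real M * h)\<^sup>2 * s * \<rho>\<^sup>2" by (simp add: power_mult_distrib h(2))
        also have "\<dots> = real M * (h\<^sup>2 / \<Gamma> * (T * ((KS0 + KS1) * Q) / \<mu>))"
          by (simp add: Q_def s_def power2_eq_square mult_ac)
        finally show ?thesis by (simp only: s_def)
      qed
      finally have "\<bar>E i k\<bar> \<le> \<bar>L * sqrt (T * (KS0 + KS1) / (\<mu> * \<Gamma>)) * \<rho>\<bar>" by (simp only: abs_le_square_iff)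
      also have "\<dots> \<le> C * \<rho>"
        using L T K \<mu> \<Gamma> \<rho> by (simp add: C_def abs_mult distrib_right)
      finally show ?thesis by (simp add: E_def)
    qed
  qed
qed

section \<open>Quadrature error\<close>

lemma has_integral_kernel:
  fixes p c X :: real
  assumes "-1 < p" "c \<le> X"
  shows "((\<lambda>y. (X - y) powr p) has_integral (X - c) powr (p + 1) / (p + 1)) {c..X}"
proof -
  have "((\<lambda>x. x powr p) has_integral (X - c) powr (p + 1) / (p + 1)) {0..X - c}"
    using assms by (intro has_integral_powr_from_0) auto
  then have "((\<lambda>x. (x + (X - c)) powr p) has_integral (X - c) powr (p + 1) / (p + 1)) {-(X - c)..0}"
    using has_integral_affinity'[of "\<lambda>x. x powr p" _ 0 "X - c" 1 "X - c"] by simp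
  then have "((\<lambda>x. (X - c - x) powr p) has_integral (X - c) powr (p + 1) / (p + 1)) {0..X - c}"
    using has_integral_reflect_real[of "\<lambda>x. (x + (X - c)) powr p" _ 0 "- (X - c)"] by simp
  then show ?thesis
    using has_integral_affinity'[of "\<lambda>x. (X - c - x) powr p" _ 0 "X - c" 1 "-c"] by (simp add: algebra_simps)
qed

text \<open>The kernel may be singular at \<open>X\<close> but is absolutely integrable, and
  \<open>q\<close> is bounded and measurable.\<close>

lemma integrable_mult_kernel:
  fixes p c X :: real
  assumes "-1 < p" "continuous_on {c..X} q"
  shows "(\<lambda>y. q y * (X - y) powr p) integrable_on {c..X}"
proof (cases "c \<le> X")
  case True
  have "(\<lambda>y. (X - y) powr p) absolutely_integrable_on {c..X}"
    using has_integral_kernel[OF assms(1) True]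
    by (intro nonnegative_absolutely_integrable_1) (auto simp: has_integral_iff)
  then have "(\<lambda>y. q y * (X - y) powr p) absolutely_integrable_on {c..X}"
    using assms(2)
    by (intro absolutely_integrable_bounded_measurable_product_real
        continuous_imp_measurable_on_sets_lebesgue compact_imp_bounded compact_continuous_image) auto
  then show ?thesis by (simp add: absolutely_integrable_on_def)
qed auto

lemma weighted_integral_diff_le:
  fixes F P W :: "real \<Rightarrow> real"
  assumes "(\<lambda>y. F y * W y) integrable_on S" "(\<lambda>y. P y * W y) integrable_on S" "W integrable_on S"
    and "\<And>y. y \<in> S \<Longrightarrow> \<bar>P y - F y\<bar> \<le> E" and "\<And>y. y \<in> S \<Longrightarrow> 0 \<le> W y"
  shows "\<bar>integral S (\<lambda>y. P y * W y) - integral S (\<lambda>y. F y * W y)\<bar> \<le> E * integral S W"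
proof -
  have "norm (integral S (\<lambda>y. P y * W y - F y * W y)) \<le> integral S (\<lambda>y. E * W y)"
    using assms
    by (intro integral_norm_bound_integral integrable_diff integrable_on_mult_right)
      (auto simp: left_diff_distrib[symmetric] abs_mult intro!: mult_right_mono)
  then show ?thesis using assms by (simp add: integral_diff)
qed

lemma abs_mult_le: "\<lbrakk>\<bar>a\<bar> \<le> A; \<bar>b\<bar> \<le> B\<rbrakk> \<Longrightarrow> \<bar>a * b\<bar> \<le> A * B" for a b :: real
  unfolding abs_mult by (rule mult_mono) auto

lemma abs_add3_diff_le:
  "\<lbrakk>\<bar>a\<bar> \<le> A; \<bar>b\<bar> \<le> B; \<bar>c\<bar> \<le> C; \<bar>d\<bar> \<le> D\<rbrakk> \<Longrightarrow> \<bar>a + b + c - d\<bar> \<le> A + B + C + D"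
  for a b c d :: real
  by linarith

lemma abs_add5_diff_le:
  "\<lbrakk>\<bar>a\<bar> \<le> A; \<bar>b\<bar> \<le> B; \<bar>c\<bar> \<le> C; \<bar>d\<bar> \<le> D; \<bar>e\<bar> \<le> E; \<bar>f\<bar> \<le> F\<rbrakk>
    \<Longrightarrow> \<bar>a + b + c + d + e - f\<bar> \<le> A + B + C + D + E + F"
  for a b c d e f :: real
  using abs_add3_diff_le[of a A b B c C 0 0] abs_add3_diff_le[of "a + b + c" "A + B + C" d D e E f F] by simp

lemma sum_integral_half_intervals:
  fixes f :: "real \<Rightarrow> real"
  assumes "1 \<le> k" "f integrable_on {1/2..real k - 1/2}"
  shows "(\<Sum>j\<in>{1..<k}. integral {real j - 1/2..real j + 1/2} f) = integral {1/2..real k - 1/2} f"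
  using assms
proof (induction k rule: nat_induct_at_least)
  case base
  then show ?case by simp
next
  case (Suc n)
  have "f integrable_on {1/2..real n - 1/2}"
    using Suc.prems by (rule integrable_on_subinterval) auto
  with Suc have "(\<Sum>j\<in>{1..<n}. integral {real j - 1/2..real j + 1/2} f) = integral {1/2..real n - 1/2} f"
    by blast
  moreover have "integral {1/2..real n - 1/2} f + integral {real n - 1/2..real (Suc n) - 1/2} f
      = integral {1/2..real (Suc n) - 1/2} f"
    using Suc by (intro Henstock_Kurzweil_Integration.integral_combine) auto
  ultimately show ?case using Suc.hyps by (simp add: algebra_simps)
qed

context
  fixes \<alpha> :: real
  assumes \<alpha>: "1 < \<alpha>" "\<alpha> < 2"
begin

lemma has_integral_kernel_frac:
  "c \<le> X \<Longrightarrow> ((\<lambda>y. (X - y) powr (1 - \<alpha>)) has_integral (X - c) powr (2 - \<alpha>) / (2 - \<alpha>)) {c..X}"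
  using has_integral_kernel[of "1 - \<alpha>" c X] \<alpha> by simp

text \<open>The node is the barycentre of the kernel, so the rule is exact on affine functions.\<close>
lemma one_point_rule_error:
  assumes "c < X" and q: "continuous_on {c..X} q" and z: "z = c + (X - c) / (3 - \<alpha>)"
    and E: "\<And>y. y \<in> {c..X} \<Longrightarrow> \<bar>q y - q0 - (y - z) * q1\<bar> \<le> E"
  shows "\<bar>q0 * ((X - c) powr (2 - \<alpha>) / (2 - \<alpha>)) - integral {c..X} (\<lambda>y. q y * (X - y) powr (1 - \<alpha>))\<bar>
    \<le> E * ((X - c) powr (2 - \<alpha>) / (2 - \<alpha>))"
proof -
  let ?W = "\<lambda>y. (X - y) powr (1 - \<alpha>)"
  let ?J = "(X - c) powr (2 - \<alpha>) / (2 - \<alpha>)"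
  have J: "(?W has_integral ?J) {c..X}" using has_integral_kernel_frac assms by simp
  \<comment> \<open>The first moment about \<open>z\<close> is rewritten by
    \<open>y - z = (X - z) - (X - y)\<close>, which raises the exponent of the kernel by one; it
    vanishes by the choice of \<open>z\<close>.\<close>
  have "((\<lambda>y. (X - z) * ?W y - (X - y) powr (2 - \<alpha>)) has_integral
      ((X - z) * ?J - (X - c) powr (2 - \<alpha> + 1) / (2 - \<alpha> + 1))) {c..X}"
    using assms(1) \<alpha> by (intro has_integral_diff has_integral_mult_right J has_integral_kernel) auto
  moreover have "(X - z) * ?J - (X - c) powr (2 - \<alpha> + 1) / (2 - \<alpha> + 1) = 0"
  proof -
    have "X - z = (X - c) * (2 - \<alpha>) / (3 - \<alpha>)" using \<alpha> by (simp add: z field_simps)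
    moreover have "(X - c) powr (2 - \<alpha> + 1) = (X - c) powr (2 - \<alpha>) * (X - c)"
      using assms(1) by (subst powr_add) simp
    moreover have "2 - \<alpha> + 1 = 3 - \<alpha>" by simp
    ultimately show ?thesis using \<alpha> by simp
  qed
  moreover have "(X - z) * ?W y - (X - y) powr (2 - \<alpha>) = (y - z) * ?W y" if "y \<in> {c..X}" for y
  proof -
    have "(X - y) powr (2 - \<alpha>) = (X - y) * ?W y"
      using that powr_add[of "X - y" 1 "1 - \<alpha>"] by (simp add: algebra_simps)
    then show ?thesis by (simp add: algebra_simps)
  qed
  ultimately have lin: "((\<lambda>y. (y - z) * ?W y) has_integral 0) {c..X}"
    by (metis (no_types, lifting) has_integral_cong)
  have P: "((\<lambda>y. (q0 + (y - z) * q1) * ?W y) has_integral (q0 * ?J + q1 * 0)) {c..X}"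
    using has_integral_add[OF has_integral_mult_right[OF J, of q0] has_integral_mult_right[OF lin, of q1]]
    by (simp add: algebra_simps)
  have "\<bar>integral {c..X} (\<lambda>y. (q0 + (y - z) * q1) * ?W y) - integral {c..X} (\<lambda>y. q y * ?W y)\<bar>
      \<le> E * integral {c..X} ?W"
  proof (rule weighted_integral_diff_le)
    show "\<bar>q0 + (y - z) * q1 - q y\<bar> \<le> E" if "y \<in> {c..X}" for y using E[OF that] by linarith
  qed (use P J q \<alpha> in \<open>auto simp: has_integral_iff intro!: integrable_mult_kernel\<close>)
  then show ?thesis using P J by (simp add: has_integral_iff)
qed

text \<open>Time is measured in steps: \<open>q\<close> stands for the rescaled u_tt and
  \<open>G\<close> for the difference quotients. The integral is cut at half-integers. The
  coefficients replace \<open>q\<close> by lines on all pieces but the last, where the constant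
  \<open>G k\<close> is exact on affine functions. Every replacement costs \<open>4 * E\<close>
  times the kernel mass of its piece, and the masses add up.\<close>

lemma caputo_quadrature_error:
  assumes k: "1 \<le> k" and X: "X = real k + sig \<alpha>" and q: "continuous_on {0..X} q"
    and taylor: "\<And>y z. \<lbrakk>y \<in> {0..X}; z \<in> {0..X}\<rbrakk> \<Longrightarrow> \<bar>q y - q z - (y - z) * q' z\<bar> \<le> E * (y - z)\<^sup>2"
    and G: "\<And>j. \<lbrakk>1 \<le> j; j \<le> k\<rbrakk> \<Longrightarrow> \<bar>G j - q (real j)\<bar> \<le> E" and G0: "\<bar>G 0 - (q 0 + q' 0 / 3)\<bar> \<le> E"
  shows "\<bar>(\<Sum>l=0..k. coef_c \<alpha> 1 k l * G (k - l)) - integral {0..X} (\<lambda>y. q y * (X - y) powr (1 - \<alpha>))\<bar>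
    \<le> 4 * E * (X powr (2 - \<alpha>) / (2 - \<alpha>))"
proof -
  let ?W = "\<lambda>y. (X - y) powr (1 - \<alpha>)"
  let ?F = "\<lambda>y. q y * ?W y"
  note sg = sig_bounds[OF \<alpha>]
  have E: "0 \<le> E" using G0 by linarith
  have X1: "0 < X" "real k < X" "1 < X" using X k sg by auto
  have W: "?W integrable_on {c..X}" if "c \<le> X" for c
    using has_integral_kernel_frac[OF that] by (auto simp: has_integral_iff)
  have sub: "f integrable_on {c..d}" if "f integrable_on {0..X}" "0 \<le> c" "d \<le> X" for f :: "real \<Rightarrow> real" and c d
    using that by (meson atLeastatMost_subset_iff integrable_on_subinterval)
  have Fint: "?F integrable_on {0..X}" using q \<alpha> by (intro integrable_mult_kernel) auto
  have affint: "(\<lambda>y. (u + v * y) * ?W y) integrable_on {0..X}" for u v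
    using \<alpha> by (intro integrable_mult_kernel continuous_intros) auto
  let ?d = "real k - 1/2"
  have k2: "1/2 \<le> ?d" "?d \<le> X" using k X1 by auto

  have first: "\<bar>(coef_c \<alpha> 1 k k * G 0 + coef_a \<alpha> 1 k 1 * G 1) - integral {0..1/2} ?F\<bar>
      \<le> 4 * E * integral {0..1/2} ?W"
  proof -
    \<comment> \<open>The line with value \<open>G 0\<close> at 1/3 and \<open>G 1\<close> at 1: the
      initial quotient approximates \<open>q\<close> at 1/3, not at 0.\<close>
    let ?P = "\<lambda>y. (3/2 * G 0 - 1/2 * G 1) + (3/2 * G 1 - 3/2 * G 0) * y"
    have i: "(\<lambda>y. (1 - y) * ?W y) integrable_on {0..1/2}" "(\<lambda>y. (y - 1/3) * ?W y) integrable_on {0..1/2}"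
      using sub[OF affint[of 1 "-1"], of 0 "1/2"] sub[OF affint[of "-1/3" 1], of 0 "1/2"] X1
      by (auto simp: algebra_simps)
    have ca: "2/3 * coef_c \<alpha> 1 k k = integral {0..1/2} (\<lambda>y. (1 - y) * ?W y)"
      "2/3 * coef_a \<alpha> 1 k 1 = integral {0..1/2} (\<lambda>y. (y - 1/3) * ?W y)"
      by (simp_all add: coef_c_def coef_a_def X)
    have "((\<lambda>y. 3/2 * G 0 * ((1 - y) * ?W y) + 3/2 * G 1 * ((y - 1/3) * ?W y)) has_integral
        (3/2 * G 0 * (2/3 * coef_c \<alpha> 1 k k) + 3/2 * G 1 * (2/3 * coef_a \<alpha> 1 k 1))) {0..1/2}"
      unfolding ca by (intro has_integral_add has_integral_mult_right integrable_integral i)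
    from integral_unique[OF this] have "coef_c \<alpha> 1 k k * G 0 + coef_a \<alpha> 1 k 1 * G 1
        = integral {0..1/2} (\<lambda>y. 3/2 * G 0 * ((1 - y) * ?W y) + 3/2 * G 1 * ((y - 1/3) * ?W y))"
      by (simp only:) simp
    also have "\<dots> = integral {0..1/2} (\<lambda>y. ?P y * ?W y)"
      by (intro integral_cong) (simp add: algebra_simps)
    finally have eq: "coef_c \<alpha> 1 k k * G 0 + coef_a \<alpha> 1 k 1 * G 1 = integral {0..1/2} (\<lambda>y. ?P y * ?W y)" .
    show ?thesis unfolding eq
    proof (rule weighted_integral_diff_le)
      fix y :: real assume y: "y \<in> {0..1/2}"
      have "?P y - q y = 3/2 * (1 - y) * (G 0 - (q 0 + q' 0 / 3)) + 3/2 * (y - 1/3) * (G 1 - q 1)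
         + 3/2 * (y - 1/3) * (q 1 - q 0 - (1 - 0) * q' 0) - (q y - q 0 - (y - 0) * q' 0)"
        by (simp add: field_simps)
      also have "\<bar>\<dots>\<bar> \<le> 3/2 * E + 1/2 * E + 1/2 * E + 1 * E"
      proof (rule abs_add3_diff_le)
        have y1: "\<bar>3/2 * (1 - y)\<bar> \<le> 3/2" "\<bar>3/2 * (y - 1/3)\<bar> \<le> 1/2" using y by (auto simp: abs_le_iff)
        show "\<bar>3/2 * (1 - y) * (G 0 - (q 0 + q' 0 / 3))\<bar> \<le> 3/2 * E"
          by (rule abs_mult_le[OF y1(1) G0])
        show "\<bar>3/2 * (y - 1/3) * (G 1 - q 1)\<bar> \<le> 1/2 * E"
          by (rule abs_mult_le[OF y1(2)]) (use G[of 1] k in simp)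
        have "\<bar>q 1 - q 0 - (1 - 0) * q' 0\<bar> \<le> E" using taylor[of 1 0] X1 by simp
        then show "\<bar>3/2 * (y - 1/3) * (q 1 - q 0 - (1 - 0) * q' 0)\<bar> \<le> 1/2 * E"
          by (rule abs_mult_le[OF y1(2)])
        have "\<bar>q y - q 0 - (y - 0) * q' 0\<bar> \<le> E * (y - 0)\<^sup>2" using taylor[of y 0] X1 y by simp
        also have "\<dots> \<le> E * 1" using y E by (intro mult_left_mono) (auto simp: power_le_one)
        finally show "\<bar>q y - q 0 - (y - 0) * q' 0\<bar> \<le> 1 * E" by simp
      qed
      \<comment> \<open>The four constants add up to 7/2, rounded up to 4.\<close>
      finally show "\<bar>?P y - q y\<bar> \<le> 4 * E" using E by linarith
    qed (use sub[OF Fint] sub[OF affint] sub[OF W[of 0]] X1 in auto)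
  qed

  have middle: "\<bar>(coef_b \<alpha> 1 k j * G j + coef_a \<alpha> 1 k (Suc j) * G (Suc j)) - integral {real j - 1/2..real j + 1/2} ?F\<bar>
      \<le> 4 * E * integral {real j - 1/2..real j + 1/2} ?W" if j: "j \<in> {1..<k}" for j
  proof -
    \<comment> \<open>The line through the values at \<open>j\<close> and \<open>j + 1\<close>,
      which extrapolates on the left half of the piece.\<close>
    let ?P = "\<lambda>y. ((real j + 1) * G j - real j * G (Suc j)) + (G (Suc j) - G j) * y"
    let ?c = "real j - 1/2"
    have jX: "real j + 1 \<le> real k" "1 \<le> real j" using j by auto
    have i: "(\<lambda>y. (real j + 1 - y) * ?W y) integrable_on {?c..real j + 1/2}"
        "(\<lambda>y. (y - real j) * ?W y) integrable_on {?c..real j + 1/2}"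
      using sub[OF affint[of "real j + 1" "-1"], of ?c "real j + 1/2"]
        sub[OF affint[of "- real j" 1], of ?c "real j + 1/2"] X1 jX
      by (auto simp: algebra_simps)
    have b: "coef_b \<alpha> 1 k j = integral {?c..real j + 1/2} (\<lambda>y. (real j + 1 - y) * ?W y)"
      using integral_shift_real_ivl[of ?c ?c "real j + 1/2" "\<lambda>y. (real j + 1 - y) * ?W y"] j
      by (simp add: coef_b_def X algebra_simps)
    have a: "coef_a \<alpha> 1 k (Suc j) = integral {?c..real j + 1/2} (\<lambda>y. (y - real j) * ?W y)"
      using integral_shift_real_ivl[of ?c ?c "real j + 1/2" "\<lambda>y. (y - real j) * ?W y"] j
      by (simp add: coef_a_def X algebra_simps)
    have "((\<lambda>y. G j * ((real j + 1 - y) * ?W y) + G (Suc j) * ((y - real j) * ?W y)) has_integral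
        (G j * coef_b \<alpha> 1 k j + G (Suc j) * coef_a \<alpha> 1 k (Suc j))) {?c..real j + 1/2}"
      unfolding a b by (intro has_integral_add has_integral_mult_right integrable_integral i)
    from integral_unique[OF this] have "coef_b \<alpha> 1 k j * G j + coef_a \<alpha> 1 k (Suc j) * G (Suc j)
        = integral {?c..real j + 1/2} (\<lambda>y. G j * ((real j + 1 - y) * ?W y) + G (Suc j) * ((y - real j) * ?W y))"
      by (simp only:) simp
    also have "\<dots> = integral {?c..real j + 1/2} (\<lambda>y. ?P y * ?W y)"
      by (intro integral_cong) (simp add: algebra_simps)
    finally have eq: "coef_b \<alpha> 1 k j * G j + coef_a \<alpha> 1 k (Suc j) * G (Suc j)
      = integral {?c..real j + 1/2} (\<lambda>y. ?P y * ?W y)" .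
    show ?thesis unfolding eq
    proof (rule weighted_integral_diff_le)
      fix y :: real assume y: "y \<in> {?c..real j + 1/2}"
      let ?R = "q (real (Suc j)) - q (real j) - (real (Suc j) - real j) * q' (real j)"
      let ?S = "q y - q (real j) - (y - real j) * q' (real j)"
      have "?P y - q y = (real j + 1 - y) * (G j - q (real j)) + (y - real j) * (G (Suc j) - q (real (Suc j)))
         + (y - real j) * ?R - ?S"
        by (simp add: algebra_simps)
      also have "\<bar>\<dots>\<bar> \<le> 3/2 * E + 1/2 * E + 1/2 * E + 1 * E"
      proof (rule abs_add3_diff_le)
        have "real j - 1/2 \<le> y" "y \<le> real j + 1/2" using y by simp_all
        then have y1: "\<bar>real j + 1 - y\<bar> \<le> 3/2" "\<bar>y - real j\<bar> \<le> 1/2" by linarith+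
        show "\<bar>(real j + 1 - y) * (G j - q (real j))\<bar> \<le> 3/2 * E"
          by (rule abs_mult_le[OF y1(1)]) (use G[of j] j in simp)
        show "\<bar>(y - real j) * (G (Suc j) - q (real (Suc j)))\<bar> \<le> 1/2 * E"
          by (rule abs_mult_le[OF y1(2) G]) (use j in auto)
        have "\<bar>?R\<bar> \<le> E" using taylor[of "real (Suc j)" "real j"] X1 jX by simp
        then show "\<bar>(y - real j) * ?R\<bar> \<le> 1/2 * E"
          by (rule abs_mult_le[OF y1(2)])
        have "\<bar>?S\<bar> \<le> E * (y - real j)\<^sup>2" using taylor[of y "real j"] X1 jX y by auto
        also have "\<dots> \<le> E * 1"
        proof (rule mult_left_mono[OF _ E])
          have "\<bar>y - real j\<bar> \<le> 1" using y1(2) by linarith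
          then show "(y - real j)\<^sup>2 \<le> 1" by (simp only: abs_square_le_1)
        qed
        finally show "\<bar>?S\<bar> \<le> 1 * E" by simp
      qed
      finally show "\<bar>?P y - q y\<bar> \<le> 4 * E" using E by linarith
    qed (use sub[OF Fint] sub[OF affint] sub[OF W[of 0]] X1 jX in auto)
  qed

  have last: "\<bar>coef_b \<alpha> 1 k k * G k - integral {?d..X} ?F\<bar> \<le> 4 * E * integral {?d..X} ?W"
  proof -
    have d: "X - ?d = sig \<alpha> + 1/2" by (simp add: X)
    have Wd: "integral {?d..X} ?W = (sig \<alpha> + 1/2) powr (2 - \<alpha>) / (2 - \<alpha>)"
      using has_integral_kernel_frac[of ?d X] k2 unfolding d by (simp add: has_integral_iff)
    have "\<bar>G k * ((X - ?d) powr (2 - \<alpha>) / (2 - \<alpha>)) - integral {?d..X} ?F\<bar>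
        \<le> 4 * E * ((X - ?d) powr (2 - \<alpha>) / (2 - \<alpha>))"
    proof (rule one_point_rule_error)
      show "?d < X" using X1 by simp
      show "continuous_on {?d..X} q" using q k2 by (rule_tac continuous_on_subset[OF q]) auto
      \<comment> \<open>This is where the value of \<sigma> matters:
        \<open>sig \<alpha> + 1/2 = (3 - \<alpha>) / 2\<close> puts the barycentre half a step after
        the cut, exactly at the node \<open>k\<close>.\<close>
      show "real k = ?d + (X - ?d) / (3 - \<alpha>)" unfolding d using \<alpha> by (simp add: sig_def field_simps)
      fix y assume y: "y \<in> {?d..X}"
      then have y1: "\<bar>y - real k\<bar> \<le> 1" using X sg by auto
      have "\<bar>q y - q (real k) - (y - real k) * q' (real k)\<bar> \<le> E * (y - real k)\<^sup>2"
        using taylor[of y "real k"] y k2 X1 by auto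
      also have "\<dots> \<le> E * 1" by (rule mult_left_mono[OF _ E]) (simp only: abs_square_le_1 y1)
      finally show "\<bar>q y - G k - (y - real k) * q' (real k)\<bar> \<le> 4 * E" using G[of k] k E by linarith
    qed
    then show ?thesis by (simp add: Wd d coef_b_def integral_powr_head[OF \<alpha>] mult.commute)
  qed

  have split: "integral {0..X} f = integral {0..1/2} f
      + (\<Sum>j\<in>{1..<k}. integral {real j - 1/2..real j + 1/2} f) + integral {?d..X} f"
    if "f integrable_on {0..X}" for f :: "real \<Rightarrow> real"
    using sum_integral_half_intervals[OF k sub[OF that]] k2
      Henstock_Kurzweil_Integration.integral_combine[of 0 "1/2" X f]
      Henstock_Kurzweil_Integration.integral_combine[of "1/2" ?d X f] that sub[OF that] X1 by simp
  have sums: "(\<Sum>l=0..k. coef_c \<alpha> 1 k l * G (k - l)) = (coef_c \<alpha> 1 k k * G 0 + coef_a \<alpha> 1 k 1 * G 1)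
      + (\<Sum>j\<in>{1..<k}. coef_b \<alpha> 1 k j * G j + coef_a \<alpha> 1 k (Suc j) * G (Suc j)) + coef_b \<alpha> 1 k k * G k"
  proof -
    have "(\<Sum>l=0..k. coef_c \<alpha> 1 k l * G (k - l)) = (\<Sum>j=0..k. coef_c \<alpha> 1 k (k - j) * G j)"
      by (rule sum.reindex_bij_witness[of _ "\<lambda>j. k - j" "\<lambda>j. k - j"]) auto
    also have "\<dots> = coef_c \<alpha> 1 k k * G 0 + (\<Sum>j=1..k. coef_c \<alpha> 1 k (k - j) * G j)"
      by (simp add: sum.atLeast_Suc_atMost)
    also have "(\<Sum>j=1..k. coef_c \<alpha> 1 k (k - j) * G j)
        = (\<Sum>j=1..k. coef_a \<alpha> 1 k j * G j) + (\<Sum>j=1..k. coef_b \<alpha> 1 k j * G j)"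
      unfolding sum.distrib[symmetric] by (intro sum.cong) (auto simp: coef_c_def algebra_simps)
    also have "(\<Sum>j=1..k. coef_a \<alpha> 1 k j * G j)
        = coef_a \<alpha> 1 k 1 * G 1 + (\<Sum>j\<in>{1..<k}. coef_a \<alpha> 1 k (Suc j) * G (Suc j))"
    proof -
      have "(\<Sum>j=1..k. coef_a \<alpha> 1 k j * G j) = coef_a \<alpha> 1 k 1 * G 1 + (\<Sum>j=Suc 1..k. coef_a \<alpha> 1 k j * G j)"
        using k by (simp add: sum.atLeast_Suc_atMost)
      also have "(\<Sum>j=Suc 1..k. coef_a \<alpha> 1 k j * G j) = (\<Sum>j\<in>{1..<k}. coef_a \<alpha> 1 k (Suc j) * G (Suc j))"
        by (rule sum.reindex_bij_witness[of _ Suc "\<lambda>j. j - 1"]) auto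
      finally show ?thesis .
    qed
    also have "(\<Sum>j=1..k. coef_b \<alpha> 1 k j * G j) = (\<Sum>j\<in>{1..<k}. coef_b \<alpha> 1 k j * G j) + coef_b \<alpha> 1 k k * G k"
      using k by (subst atLeastLessThanSuc_atLeastAtMost[symmetric]) simp
    finally show ?thesis by (simp add: sum.distrib)
  qed
  have "\<bar>(\<Sum>j\<in>{1..<k}. coef_b \<alpha> 1 k j * G j + coef_a \<alpha> 1 k (Suc j) * G (Suc j))
      - (\<Sum>j\<in>{1..<k}. integral {real j - 1/2..real j + 1/2} ?F)\<bar>
      \<le> 4 * E * (\<Sum>j\<in>{1..<k}. integral {real j - 1/2..real j + 1/2} ?W)"
    unfolding sum_subtractf[symmetric] sum_distrib_left
    by (intro order_trans[OF sum_abs] sum_mono middle)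
  then have "\<bar>(\<Sum>l=0..k. coef_c \<alpha> 1 k l * G (k - l)) - integral {0..X} ?F\<bar> \<le> 4 * E * integral {0..X} ?W"
    using first last unfolding split[OF Fint] split[OF W[OF less_imp_le[OF X1(1)]]] sums distrib_left
    by linarith
  then show ?thesis
    using has_integral_kernel_frac[of 0 X] X1 by (simp add: has_integral_iff)
qed

end

section \<open>Truncation error\<close>

lemma taylor_affine_error:
  fixes f :: "nat \<Rightarrow> real \<Rightarrow> real"
  assumes "\<And>i x. \<lbrakk>x \<in> {0..T}; i \<le> 1\<rbrakk> \<Longrightarrow> (f i has_real_derivative f (Suc i) x) (at x within {0..T})"
    and "\<And>x. x \<in> {0..T} \<Longrightarrow> \<bar>f 2 x\<bar> \<le> K" and "t \<in> {0..T}" "s \<in> {0..T}"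
  shows "\<bar>f 0 s - f 0 t - (s - t) * f 1 t\<bar> \<le> K * (s - t)\<^sup>2"
  using field_Taylor[of "{0..T}" 1 f K t s] assms
  by (simp add: numeral_2_eq_2 algebra_simps)

lemma taylor_cubic_error:
  fixes f :: "nat \<Rightarrow> real \<Rightarrow> real"
  assumes "\<And>i x. \<lbrakk>x \<in> {0..T}; i \<le> 3\<rbrakk> \<Longrightarrow> (f i has_real_derivative f (Suc i) x) (at x within {0..T})"
    and K: "\<And>x. x \<in> {0..T} \<Longrightarrow> \<bar>f 4 x\<bar> \<le> K" and t: "t \<in> {0..T}" "t + d \<in> {0..T}"
  shows "\<bar>f 0 (t + d) - (f 0 t + d * f 1 t + d\<^sup>2 / 2 * f 2 t + d ^ 3 / 6 * f 3 t)\<bar> \<le> K * d ^ 4"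
proof -
  have "norm (f 0 (t + d) - (\<Sum>i\<le>3. f i t * (t + d - t) ^ i / fact i)) \<le> K * norm (t + d - t) ^ Suc 3 / fact 3"
    using assms by (intro field_Taylor[of "{0..T}"]) auto
  also have "(\<Sum>i\<le>3. f i t * (t + d - t) ^ i / fact i) = f 0 t + d * f 1 t + d\<^sup>2 / 2 * f 2 t + d ^ 3 / 6 * f 3 t"
    by (simp add: eval_nat_numeral algebra_simps)
  also have "K * norm (t + d - t) ^ Suc 3 / fact 3 \<le> K * d ^ 4"
  proof -
    have "0 \<le> K" using K[OF t(1)] by linarith
    then have "0 \<le> K * d ^ 4" by simp
    then show ?thesis by (simp add: fact_numeral)
  qed
  finally show ?thesis by simp
qed

lemma second_difference_error:
  fixes f :: "nat \<Rightarrow> real \<Rightarrow> real"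
  assumes deriv: "\<And>i x. \<lbrakk>x \<in> {0..T}; i \<le> 3\<rbrakk> \<Longrightarrow> (f i has_real_derivative f (Suc i) x) (at x within {0..T})"
    and K: "\<And>x. x \<in> {0..T} \<Longrightarrow> \<bar>f 4 x\<bar> \<le> K" and t: "0 < d" "0 \<le> t - d" "t + d \<le> T"
  shows "\<bar>(f 0 (t + d) - 2 * f 0 t + f 0 (t - d)) / d\<^sup>2 - f 2 t\<bar> \<le> 2 * K * d\<^sup>2"
proof -
  define P where "P = f 0 (t + d) - (f 0 t + d * f 1 t + d\<^sup>2 / 2 * f 2 t + d ^ 3 / 6 * f 3 t)"
  define S where "S = f 0 (t + - d) - (f 0 t + (- d) * f 1 t + (- d)\<^sup>2 / 2 * f 2 t + (- d) ^ 3 / 6 * f 3 t)"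
  have "\<bar>P\<bar> \<le> K * d ^ 4" unfolding P_def using t by (intro taylor_cubic_error[OF deriv K]) auto
  moreover have "\<bar>S\<bar> \<le> K * (- d) ^ 4" unfolding S_def using t by (intro taylor_cubic_error[OF deriv K]) auto
  ultimately have "\<bar>P + S\<bar> \<le> 2 * K * d ^ 4" by simp
  then have "\<bar>P + S\<bar> / d\<^sup>2 \<le> 2 * K * d ^ 4 / d\<^sup>2" by (rule divide_right_mono) simp
  moreover have "(f 0 (t + d) - 2 * f 0 t + f 0 (t - d)) / d\<^sup>2 - f 2 t = (P + S) / d\<^sup>2"
    using t by (simp add: P_def S_def field_simps power2_eq_square power3_eq_cube)
  moreover have "2 * K * d ^ 4 / d\<^sup>2 = 2 * K * d\<^sup>2"
    using t by (simp add: power2_eq_square eval_nat_numeral)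
  ultimately show ?thesis by simp
qed

text \<open>The third-order Taylor term survives the division by \<open>d^2 / 2\<close>. Up to
  second order the quotient is therefore the value of the second derivative at \<open>d / 3\<close>,
  which explains the node 1/3 in the first coefficients.\<close>

lemma initial_difference_error:
  fixes f :: "nat \<Rightarrow> real \<Rightarrow> real"
  assumes deriv: "\<And>i x. \<lbrakk>x \<in> {0..T}; i \<le> 3\<rbrakk> \<Longrightarrow> (f i has_real_derivative f (Suc i) x) (at x within {0..T})"
    and K: "\<And>x. x \<in> {0..T} \<Longrightarrow> \<bar>f 4 x\<bar> \<le> K" and t: "0 < d" "d \<le> T"
  shows "\<bar>2 / d * ((f 0 d - f 0 0) / d - f 1 0) - (f 2 0 + d / 3 * f 3 0)\<bar> \<le> 2 * K * d\<^sup>2"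
proof -
  define P where "P = f 0 (0 + d) - (f 0 0 + d * f 1 0 + d\<^sup>2 / 2 * f 2 0 + d ^ 3 / 6 * f 3 0)"
  have "\<bar>P\<bar> \<le> K * d ^ 4" unfolding P_def using t by (intro taylor_cubic_error[OF deriv K]) auto
  then have "2 / d\<^sup>2 * \<bar>P\<bar> \<le> 2 / d\<^sup>2 * (K * d ^ 4)" by (rule mult_left_mono) simp
  moreover have "2 / d * ((f 0 d - f 0 0) / d - f 1 0) - (f 2 0 + d / 3 * f 3 0) = 2 / d\<^sup>2 * P"
    using t by (simp add: P_def field_simps power2_eq_square power3_eq_cube)
  moreover have "2 / d\<^sup>2 * (K * d ^ 4) = 2 * K * d\<^sup>2"
    using t by (simp add: power2_eq_square eval_nat_numeral)
  ultimately show ?thesis by (simp add: abs_mult)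
qed

lemma integral_kernel_rescale:
  fixes g :: "real \<Rightarrow> real"
  assumes "0 < \<tau>" "0 \<le> X"
  shows "integral {0..\<tau> * X} (\<lambda>s. g s * (\<tau> * X - s) powr (1 - \<alpha>))
    = \<tau> powr (2 - \<alpha>) * integral {0..X} (\<lambda>y. g (\<tau> * y) * (X - y) powr (1 - \<alpha>))"
proof -
  let ?f = "\<lambda>s. g s * (\<tau> * X - s) powr (1 - \<alpha>)"
  have im: "(\<lambda>x. x / \<tau>) ` {0..\<tau> * X} = {0..X}"
    using assms by (subst image_divide_atLeastAtMost) auto
  have "integral {0..X} (\<lambda>y. ?f (\<tau> * y)) = 1 / \<tau> * integral {0..\<tau> * X} ?f"
    using integral_stretch_real[of \<tau> 0 "\<tau> * X" ?f] assms im by simp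
  moreover have "integral {0..X} (\<lambda>y. ?f (\<tau> * y))
      = integral {0..X} (\<lambda>y. \<tau> powr (1 - \<alpha>) * (g (\<tau> * y) * (X - y) powr (1 - \<alpha>)))"
  proof (intro integral_cong)
    fix y assume "y \<in> {0..X}"
    then have "(\<tau> * X - \<tau> * y) powr (1 - \<alpha>) = \<tau> powr (1 - \<alpha>) * (X - y) powr (1 - \<alpha>)"
      using assms by (simp add: powr_mult right_diff_distrib[symmetric])
    then show "?f (\<tau> * y) = \<tau> powr (1 - \<alpha>) * (g (\<tau> * y) * (X - y) powr (1 - \<alpha>))" by simp
  qed
  moreover have t: "\<tau> powr (2 - \<alpha>) = \<tau> * \<tau> powr (1 - \<alpha>)"
    using assms powr_add[of \<tau> 1 "1 - \<alpha>"] by (simp add: algebra_simps)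
  ultimately have "integral {0..\<tau> * X} ?f
      = \<tau> * (\<tau> powr (1 - \<alpha>) * integral {0..X} (\<lambda>y. g (\<tau> * y) * (X - y) powr (1 - \<alpha>)))"
    using assms by simp
  then show ?thesis by (simp add: t mult.assoc)
qed

lemma C44_bounded:
  assumes "C44 L T u D"
  obtains K where "0 \<le> K" "\<forall>i\<le>4. \<forall>j\<le>4. \<forall>x\<in>{0..L}. \<forall>t\<in>{0..T}. \<bar>D i j x t\<bar> \<le> K"
proof -
  have "\<exists>B. \<forall>x\<in>{0..L}. \<forall>t\<in>{0..T}. \<bar>D i j x t\<bar> \<le> B" if "i \<le> 4" "j \<le> 4" for i j
  proof -
    have "compact ((\<lambda>(x,t). D i j x t) ` ({0..L} \<times> {0..T}))"
      using assms(1) that by (intro compact_continuous_image compact_Times) (auto simp: C44_def)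
    then obtain B where "\<forall>y\<in>(\<lambda>(x,t). D i j x t) ` ({0..L} \<times> {0..T}). norm y \<le> B"
      using compact_imp_bounded bounded_iff by blast
    then show ?thesis by (intro exI[of _ B]) auto
  qed
  then obtain B where B: "\<And>i j x t. \<lbrakk>i \<le> 4; j \<le> 4; x \<in> {0..L}; t \<in> {0..T}\<rbrakk> \<Longrightarrow> \<bar>D i j x t\<bar> \<le> B i j"
    by metis
  show ?thesis
  proof (rule that)
    \<comment> \<open>The sum of the finitely many bounds serves as one constant for all
      derivatives.\<close>
    show "0 \<le> (\<Sum>i\<le>4::nat. \<Sum>j\<le>4::nat. \<bar>B i j\<bar>)" by (simp add: sum_nonneg)
    show "\<forall>i\<le>4. \<forall>j\<le>4. \<forall>x\<in>{0..L}. \<forall>t\<in>{0..T}. \<bar>D i j x t\<bar> \<le> (\<Sum>i\<le>4::nat. \<Sum>j\<le>4::nat. \<bar>B i j\<bar>)"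
    proof (intro allI ballI impI)
      fix i j :: nat and x t assume ij: "i \<le> 4" "j \<le> 4" and "x \<in> {0..L}" "t \<in> {0..T}"
      then have "\<bar>D i j x t\<bar> \<le> \<bar>B i j\<bar>" using B[of i j x t] by linarith
      also have "\<dots> \<le> (\<Sum>j\<le>4. \<bar>B i j\<bar>)" using ij by (intro member_le_sum) auto
      also have "\<dots> \<le> (\<Sum>i\<le>4::nat. \<Sum>j\<le>4::nat. \<bar>B i j\<bar>)"
        using ij by (intro member_le_sum[where f = "\<lambda>i. \<Sum>j\<le>4. \<bar>B i j\<bar>"]) (auto simp: sum_nonneg)
      finally show "\<bar>D i j x t\<bar> \<le> (\<Sum>i\<le>4::nat. \<Sum>j\<le>4::nat. \<bar>B i j\<bar>)" .
    qed
  qed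
qed

section \<open>Consistency of the scheme at an interior node\<close>

context
  fixes \<alpha> L T K :: real and \<phi> \<psi> :: "real \<Rightarrow> real" and f u :: "real \<Rightarrow> real \<Rightarrow> real"
    and D :: "nat \<Rightarrow> nat \<Rightarrow> real \<Rightarrow> real \<Rightarrow> real"
  assumes \<alpha>: "1 < \<alpha>" "\<alpha> < 2" and L: "0 < L" and T: "0 < T" and C44: "C44 L T u D"
    and sol: "is_solution \<alpha> L T \<phi> \<psi> f u D" and K0: "0 \<le> K"
    and K_all: "\<forall>i\<le>4. \<forall>j\<le>4. \<forall>x\<in>{0..L}. \<forall>t\<in>{0..T}. \<bar>D i j x t\<bar> \<le> K"
begin

lemma D_bounded: "\<lbrakk>i \<le> 4; j \<le> 4; x \<in> {0..L}; t \<in> {0..T}\<rbrakk> \<Longrightarrow> \<bar>D i j x t\<bar> \<le> K"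
  using K_all by blast

lemma u_eq: "u x t = D 0 0 x t"
  using C44 by (simp add: C44_def)

lemma D_dx: "\<lbrakk>i < 4; j \<le> 4; x \<in> {0..L}; t \<in> {0..T}\<rbrakk> \<Longrightarrow>
    ((\<lambda>y. D i j y t) has_real_derivative D (Suc i) j x t) (at x within {0..L})"
  using C44 by (auto simp: C44_def)

lemma D_dt: "\<lbrakk>i \<le> 4; j < 4; x \<in> {0..L}; t \<in> {0..T}\<rbrakk> \<Longrightarrow>
    (D i j x has_real_derivative D i (Suc j) x t) (at t within {0..T})"
  using C44 by (auto simp: C44_def)

lemma taylor_time:
  assumes "i \<le> 4" "j \<le> 2" "x \<in> {0..L}" "s \<in> {0..T}" "t \<in> {0..T}"
  shows "\<bar>D i j x s - D i j x t - (s - t) * D i (Suc j) x t\<bar> \<le> K * (s - t)\<^sup>2"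
  using taylor_affine_error[of T "\<lambda>n. D i (j + n) x" K t s] D_dt[of i _ x] D_bounded[of i "j + 2" x] assms by simp

context
  fixes N M :: nat and \<tau> h :: real and U :: "nat \<Rightarrow> nat \<Rightarrow> real" and i :: nat
  assumes NM: "1 \<le> N" "1 \<le> M" and \<tau>_def: "\<tau> = T / real N" and h_def: "h = L / real M"
    and U_def: "U = (\<lambda>i j. u (real i * h) (real j * \<tau>))"
    and i: "1 \<le> i" "i < M"
begin

lemma step_sizes: "0 < \<tau>" "real N * \<tau> = T" "0 < h" "real M * h = L"
  using NM T L by (auto simp: \<tau>_def h_def)

lemma time_node: "0 \<le> y \<Longrightarrow> y \<le> real N \<Longrightarrow> y * \<tau> \<in> {0..T}"
  using step_sizes mult_right_mono[of y "real N" \<tau>] by auto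

lemma space_node: "0 < real i * h" "real i * h < L" "real (Suc i) * h \<le> L"
proof -
  have "real (Suc i) * h \<le> real M * h" using i step_sizes by (intro mult_right_mono) auto
  then show "real (Suc i) * h \<le> L" using step_sizes by simp
  then show "real i * h < L" using step_sizes by (simp add: algebra_simps)
qed (use i step_sizes in auto)

lemma dxx_error:
  assumes "j \<le> N"
  shows "\<bar>dxx h (\<lambda>m. U m j) i - D 2 0 (real i * h) (real j * \<tau>)\<bar> \<le> 2 * K * h\<^sup>2"
proof -
  have t: "real j * \<tau> \<in> {0..T}" using time_node[of "real j"] assms by simp
  have "\<bar>(D 0 0 (real i * h + h) (real j * \<tau>) - 2 * D 0 0 (real i * h) (real j * \<tau>) + D 0 0 (real i * h - h) (real j * \<tau>)) / h\<^sup>2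
      - D 2 0 (real i * h) (real j * \<tau>)\<bar> \<le> 2 * K * h\<^sup>2"
  proof (rule second_difference_error[of L "\<lambda>n y. D n 0 y (real j * \<tau>)"])
    show "0 \<le> real i * h - h" using mult_right_mono[of 1 "real i" h] i step_sizes by simp
    show "real i * h + h \<le> L" using space_node by (simp add: algebra_simps)
  qed (use t step_sizes D_dx D_bounded in auto)
  moreover have "real (i + 1) * h = real i * h + h" "real (i - 1) * h = real i * h - h"
    using i by (auto simp: algebra_simps of_nat_diff)
  ultimately show ?thesis by (simp add: dxx_def U_def u_eq)
qed

lemma dtt_error:
  assumes "1 \<le> j" "j < N"
  shows "\<bar>dtt \<tau> h \<psi> U i j - D 0 2 (real i * h) (real j * \<tau>)\<bar> \<le> 2 * K * \<tau>\<^sup>2"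
proof -
  let ?x = "real i * h"
  have x: "?x \<in> {0..L}" using space_node by auto
  have "\<bar>(D 0 0 ?x (real j * \<tau> + \<tau>) - 2 * D 0 0 ?x (real j * \<tau>) + D 0 0 ?x (real j * \<tau> - \<tau>)) / \<tau>\<^sup>2
      - D 0 2 ?x (real j * \<tau>)\<bar> \<le> 2 * K * \<tau>\<^sup>2"
  proof (rule second_difference_error[of T "\<lambda>n. D 0 n ?x"])
    show "0 \<le> real j * \<tau> - \<tau>" using mult_right_mono[of 1 "real j" \<tau>] assms step_sizes by simp
    show "real j * \<tau> + \<tau> \<le> T" using time_node[of "real j + 1"] assms by (simp add: algebra_simps)
  qed (use x step_sizes D_dt D_bounded in auto)
  moreover have "real (j + 1) * \<tau> = real j * \<tau> + \<tau>" "real (j - 1) * \<tau> = real j * \<tau> - \<tau>"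
    using assms by (auto simp: algebra_simps of_nat_diff)
  ultimately show ?thesis using assms by (simp add: dtt_def U_def u_eq)
qed

lemma dtt_0_error:
  "\<bar>dtt \<tau> h \<psi> U i 0 - (D 0 2 (real i * h) 0 + \<tau> / 3 * D 0 3 (real i * h) 0)\<bar> \<le> 2 * K * \<tau>\<^sup>2"
proof -
  let ?x = "real i * h"
  have x: "?x \<in> {0..L}" using space_node by auto
  have "\<tau> \<le> T" using time_node[of 1] NM by simp
  then have "\<bar>2 / \<tau> * ((D 0 0 ?x \<tau> - D 0 0 ?x 0) / \<tau> - D 0 1 ?x 0) - (D 0 2 ?x 0 + \<tau> / 3 * D 0 3 ?x 0)\<bar> \<le> 2 * K * \<tau>\<^sup>2"
    using x step_sizes D_dt D_bounded by (intro initial_difference_error[of T "\<lambda>n. D 0 n ?x"]) auto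
  moreover have "\<psi> ?x = D 0 1 ?x 0" using sol x by (auto simp: is_solution_def)
  ultimately show ?thesis by (simp add: dtt_def U_def u_eq)
qed

text \<open>The differential equation is used at t_k + \<sigma>\<tau>. On the right-hand side the
  levels k+1, k, k-1 receive the weights 1/4 + \<sigma>/2, 1/2, 1/4 - \<sigma>/2; they are
  nonnegative, sum to 1 and have first moment \<sigma> about level k, so the linear time terms
  cancel.\<close>

lemma truncation_error_step:
  assumes k: "1 \<le> k" "k < N"
  shows "\<bar>1 / Gamma (2 - \<alpha>) * (\<Sum>l=0..k. coef_c \<alpha> \<tau> k l * dtt \<tau> h \<psi> U i (k - l))
      - ((1/2 + sig \<alpha>) * dxx h (\<lambda>m. (U m k + U m (k + 1)) / 2) i
         + (1/2 - sig \<alpha>) * dxx h (\<lambda>m. (U m (k - 1) + U m k) / 2) i)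
      - f (real i * h) (real k * \<tau> + sig \<alpha> * \<tau>)\<bar>
    \<le> (8 * K * T powr (2 - \<alpha>) / ((2 - \<alpha>) * Gamma (2 - \<alpha>)) + 2 * K) * (\<tau>\<^sup>2 + h\<^sup>2)"
proof -
  let ?x = "real i * h"
  define X where "X = real k + sig \<alpha>"
  define \<Gamma> where "\<Gamma> = Gamma (2 - \<alpha>)"
  note sg = sig_bounds[OF \<alpha>]
  have \<Gamma>: "0 < \<Gamma>" using \<alpha> by (simp add: \<Gamma>_def Gamma_real_pos)
  have x: "?x \<in> {0..L}" using space_node by auto
  have "real k + 1 \<le> real N" using k by linarith
  then have X: "0 < X" "X \<le> real N" using sg k by (auto simp: X_def)
  have t: "\<tau> * y \<in> {0..T}" if "y \<in> {0..X}" for y using time_node[of y] that X by (simp add: mult.commute)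
  have cont: "continuous_on {0..T} (D 0 2 ?x)"
    by (rule DERIV_continuous_on[OF D_dt]) (use x in auto)
  let ?I = "integral {0..X} (\<lambda>y. D 0 2 ?x (\<tau> * y) * (X - y) powr (1 - \<alpha>))"
  \<comment> \<open>The quadrature lemma is applied with \<open>E = 2 * K * \<tau>^2\<close>, which
    covers both the Taylor remainder and the errors of the difference quotients; hence the 8 in the
    bound.\<close>
  have "\<bar>(\<Sum>l=0..k. coef_c \<alpha> 1 k l * dtt \<tau> h \<psi> U i (k - l)) - ?I\<bar> \<le> 4 * (2 * K * \<tau>\<^sup>2) * (X powr (2 - \<alpha>) / (2 - \<alpha>))"
  proof (rule caputo_quadrature_error[OF \<alpha> k(1) X_def, where q' = "\<lambda>y. \<tau> * D 0 3 ?x (\<tau> * y)"])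
    show "continuous_on {0..X} (\<lambda>y. D 0 2 ?x (\<tau> * y))"
      using t by (intro continuous_on_compose2[OF cont] continuous_intros) auto
    fix y z assume yz: "y \<in> {0..X}" "z \<in> {0..X}"
    have "\<bar>D 0 2 ?x (\<tau> * y) - D 0 2 ?x (\<tau> * z) - (\<tau> * y - \<tau> * z) * D 0 (Suc 2) ?x (\<tau> * z)\<bar> \<le> K * (\<tau> * y - \<tau> * z)\<^sup>2"
      using yz t x by (intro taylor_time) auto
    also have "K * (\<tau> * y - \<tau> * z)\<^sup>2 = K * \<tau>\<^sup>2 * (y - z)\<^sup>2" by (simp add: power2_eq_square algebra_simps)
    also have "\<dots> \<le> 2 * K * \<tau>\<^sup>2 * (y - z)\<^sup>2" using K0 by (intro mult_right_mono) auto
    finally show "\<bar>D 0 2 ?x (\<tau> * y) - D 0 2 ?x (\<tau> * z) - (y - z) * (\<tau> * D 0 3 ?x (\<tau> * z))\<bar> \<le> 2 * K * \<tau>\<^sup>2 * (y - z)\<^sup>2"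
      by (simp add: algebra_simps numeral_3_eq_3)
  next
    fix j assume "1 \<le> j" "j \<le> k"
    then show "\<bar>dtt \<tau> h \<psi> U i j - D 0 2 ?x (\<tau> * real j)\<bar> \<le> 2 * K * \<tau>\<^sup>2"
      using dtt_error[of j] k by (simp add: mult.commute)
  next
    show "\<bar>dtt \<tau> h \<psi> U i 0 - (D 0 2 ?x (\<tau> * 0) + \<tau> * D 0 3 ?x (\<tau> * 0) / 3)\<bar> \<le> 2 * K * \<tau>\<^sup>2"
      using dtt_0_error by simp
  qed
  then have "\<tau> powr (2 - \<alpha>) / \<Gamma> * \<bar>(\<Sum>l=0..k. coef_c \<alpha> 1 k l * dtt \<tau> h \<psi> U i (k - l)) - ?I\<bar>
      \<le> \<tau> powr (2 - \<alpha>) / \<Gamma> * (4 * (2 * K * \<tau>\<^sup>2) * (X powr (2 - \<alpha>) / (2 - \<alpha>)))"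
    using \<Gamma> by (intro mult_left_mono) auto
  also have "\<dots> = 8 * K * (\<tau> * X) powr (2 - \<alpha>) / ((2 - \<alpha>) * \<Gamma>) * \<tau>\<^sup>2"
    using step_sizes X by (simp add: powr_mult field_simps)
  also have "\<dots> \<le> 8 * K * T powr (2 - \<alpha>) / ((2 - \<alpha>) * \<Gamma>) * \<tau>\<^sup>2"
    using t[of X] X K0 \<alpha> \<Gamma> by (intro mult_right_mono divide_right_mono mult_left_mono powr_mono2) auto
  finally have time: "\<tau> powr (2 - \<alpha>) / \<Gamma> * \<bar>(\<Sum>l=0..k. coef_c \<alpha> 1 k l * dtt \<tau> h \<psi> U i (k - l)) - ?I\<bar>
      \<le> 8 * K * T powr (2 - \<alpha>) / ((2 - \<alpha>) * \<Gamma>) * \<tau>\<^sup>2" .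
  have tX: "real k * \<tau> + sig \<alpha> * \<tau> = \<tau> * X" by (simp add: X_def algebra_simps)
  have "caputo \<alpha> (D 0 2 ?x) (\<tau> * X) = D 2 0 ?x (\<tau> * X) + f ?x (\<tau> * X)"
    using sol space_node t[of X] X step_sizes by (auto simp: is_solution_def)
  moreover have "caputo \<alpha> (D 0 2 ?x) (\<tau> * X) = \<tau> powr (2 - \<alpha>) / \<Gamma> * ?I"
    unfolding caputo_def using integral_kernel_rescale[of \<tau> X "D 0 2 ?x" \<alpha>] step_sizes X by (simp add: \<Gamma>_def)
  ultimately have pde: "D 2 0 ?x (\<tau> * X) + f ?x (\<tau> * X) = \<tau> powr (2 - \<alpha>) / \<Gamma> * ?I" by simp
  have lhs: "1 / \<Gamma> * (\<Sum>l=0..k. coef_c \<alpha> \<tau> k l * dtt \<tau> h \<psi> U i (k - l))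
      = \<tau> powr (2 - \<alpha>) / \<Gamma> * (\<Sum>l=0..k. coef_c \<alpha> 1 k l * dtt \<tau> h \<psi> U i (k - l))"
    by (subst coef_c_scale) (simp add: sum_distrib_left mult_ac)

  define Z where "Z j = dxx h (\<lambda>m. U m j) i" for j
  define g where "g j = D 2 0 ?x (real j * \<tau>)" for j
  define g' where "g' = D 2 1 ?x (real k * \<tau>)"
  define zp where "zp = Z (k + 1) - g (k + 1)"
  define zk where "zk = Z k - g k"
  define zm where "zm = Z (k - 1) - g (k - 1)"
  define gp where "gp = g (k + 1) - g k - \<tau> * g'"
  define gm where "gm = g (k - 1) - g k + \<tau> * g'"
  define gs where "gs = D 2 0 ?x (\<tau> * X) - g k - sig \<alpha> * \<tau> * g'"
  have z: "\<bar>zp\<bar> \<le> 2 * K * h\<^sup>2" "\<bar>zk\<bar> \<le> 2 * K * h\<^sup>2" "\<bar>zm\<bar> \<le> 2 * K * h\<^sup>2"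
    using dxx_error[of "k + 1"] dxx_error[of k] dxx_error[of "k - 1"] k
    by (auto simp: zp_def zk_def zm_def Z_def g_def)
  have g: "\<bar>gp\<bar> \<le> K * \<tau>\<^sup>2" "\<bar>gm\<bar> \<le> K * \<tau>\<^sup>2" "\<bar>gs\<bar> \<le> K * \<tau>\<^sup>2"
  proof -
    have nodes: "real (k + 1) * \<tau> \<in> {0..T}" "real k * \<tau> \<in> {0..T}" "real (k - 1) * \<tau> \<in> {0..T}"
      using time_node[of "real (k + 1)"] time_node[of "real k"] time_node[of "real (k - 1)"] k by auto
    have dk: "real (k + 1) * \<tau> - real k * \<tau> = \<tau>" "real (k - 1) * \<tau> - real k * \<tau> = - \<tau>"
        "\<tau> * X - real k * \<tau> = sig \<alpha> * \<tau>"
      using k by (auto simp: X_def algebra_simps of_nat_diff)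
    show "\<bar>gp\<bar> \<le> K * \<tau>\<^sup>2"
      using taylor_time[of 2 0 ?x "real (k + 1) * \<tau>" "real k * \<tau>"] nodes x unfolding dk
      by (simp add: gp_def g_def g'_def)
    show "\<bar>gm\<bar> \<le> K * \<tau>\<^sup>2"
      using taylor_time[of 2 0 ?x "real (k - 1) * \<tau>" "real k * \<tau>"] nodes x unfolding dk
      by (simp add: gm_def g_def g'_def)
    have "\<bar>gs\<bar> \<le> K * (sig \<alpha> * \<tau>)\<^sup>2"
      using taylor_time[of 2 0 ?x "\<tau> * X" "real k * \<tau>"] nodes x t[of X] X unfolding dk
      by (simp add: gs_def g_def g'_def)
    also have "\<dots> \<le> K * \<tau>\<^sup>2"
      using K0 sg by (intro mult_left_mono) (auto simp: power_mult_distrib mult_left_le_one_le power_le_one)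
    finally show "\<bar>gs\<bar> \<le> K * \<tau>\<^sup>2" .
  qed
  define rhs where "rhs = (1/2 + sig \<alpha>) * dxx h (\<lambda>m. (U m k + U m (k + 1)) / 2) i
         + (1/2 - sig \<alpha>) * dxx h (\<lambda>m. (U m (k - 1) + U m k) / 2) i"
  have "rhs = (1/2 + sig \<alpha>) * ((Z k + Z (k + 1)) / 2) + (1/2 - sig \<alpha>) * ((Z (k - 1) + Z k) / 2)"
    by (simp add: rhs_def Z_def dxx_def add_divide_distrib diff_divide_distrib algebra_simps)
  then have split: "rhs - D 2 0 ?x (\<tau> * X) = (1/4 + sig \<alpha> / 2) * zp + 1/2 * zk + (1/4 - sig \<alpha> / 2) * zm
      + (1/4 + sig \<alpha> / 2) * gp + (1/4 - sig \<alpha> / 2) * gm - gs"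
    by (simp add: zp_def zk_def zm_def gp_def gm_def gs_def field_simps)
  have "\<bar>rhs - D 2 0 ?x (\<tau> * X)\<bar> \<le> (1/4 + sig \<alpha> / 2) * (2 * K * h\<^sup>2) + 1/2 * (2 * K * h\<^sup>2) + (1/4 - sig \<alpha> / 2) * (2 * K * h\<^sup>2)
      + (1/4 + sig \<alpha> / 2) * (K * \<tau>\<^sup>2) + (1/4 - sig \<alpha> / 2) * (K * \<tau>\<^sup>2) + K * \<tau>\<^sup>2"
    unfolding split using sg by (intro abs_add5_diff_le abs_mult_le z g) auto
  also have "\<dots> = 2 * K * h\<^sup>2 + 3/2 * (K * \<tau>\<^sup>2)"
  proof -
    have "(1/4 + s / 2) * A + 1/2 * A + (1/4 - s / 2) * A + (1/4 + s / 2) * B + (1/4 - s / 2) * B + B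
        = A + 3/2 * B" for s A B :: real
      by (simp add: algebra_simps)
    then show ?thesis .
  qed
  also have "\<dots> \<le> 2 * K * (\<tau>\<^sup>2 + h\<^sup>2)"
    using K0 by (simp add: distrib_left)
  finally have space: "\<bar>rhs - D 2 0 ?x (\<tau> * X)\<bar> \<le> 2 * K * (\<tau>\<^sup>2 + h\<^sup>2)" .

  let ?A = "(\<Sum>l=0..k. coef_c \<alpha> 1 k l * dtt \<tau> h \<psi> U i (k - l))"
  have "1 / \<Gamma> * (\<Sum>l=0..k. coef_c \<alpha> \<tau> k l * dtt \<tau> h \<psi> U i (k - l)) - rhs - f ?x (\<tau> * X)
      = \<tau> powr (2 - \<alpha>) / \<Gamma> * (?A - ?I) - (rhs - D 2 0 ?x (\<tau> * X))"
    unfolding lhs right_diff_distrib pde[symmetric] by simp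
  then have "\<bar>1 / \<Gamma> * (\<Sum>l=0..k. coef_c \<alpha> \<tau> k l * dtt \<tau> h \<psi> U i (k - l)) - rhs - f ?x (\<tau> * X)\<bar>
      \<le> \<bar>\<tau> powr (2 - \<alpha>) / \<Gamma> * (?A - ?I)\<bar> + \<bar>rhs - D 2 0 ?x (\<tau> * X)\<bar>"
    by (simp only: abs_triangle_ineq4)
  also have "\<dots> \<le> 8 * K * T powr (2 - \<alpha>) / ((2 - \<alpha>) * \<Gamma>) * (\<tau>\<^sup>2 + h\<^sup>2) + 2 * K * (\<tau>\<^sup>2 + h\<^sup>2)"
  proof (rule add_mono[OF _ space])
    have "\<bar>\<tau> powr (2 - \<alpha>) / \<Gamma> * (?A - ?I)\<bar> = \<tau> powr (2 - \<alpha>) / \<Gamma> * \<bar>?A - ?I\<bar>"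
      using \<Gamma> by (simp add: abs_mult)
    also have "\<dots> \<le> 8 * K * T powr (2 - \<alpha>) / ((2 - \<alpha>) * \<Gamma>) * (\<tau>\<^sup>2 + h\<^sup>2)"
      using K0 \<alpha> \<Gamma> by (intro order_trans[OF time] mult_left_mono) auto
    finally show "\<bar>\<tau> powr (2 - \<alpha>) / \<Gamma> * (?A - ?I)\<bar>
      \<le> 8 * K * T powr (2 - \<alpha>) / ((2 - \<alpha>) * \<Gamma>) * (\<tau>\<^sup>2 + h\<^sup>2)" .
  qed
  also have "\<dots> = (8 * K * T powr (2 - \<alpha>) / ((2 - \<alpha>) * \<Gamma>) + 2 * K) * (\<tau>\<^sup>2 + h\<^sup>2)"
    by (rule distrib_right[symmetric])
  finally show ?thesis by (simp only: tX \<Gamma>_def rhs_def)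
qed

text \<open>For the end point \<open>(1 - \<alpha>/3) * \<tau>\<close> the barycentre of the kernel
  is \<open>\<tau> / 3\<close>, where the initial quotient is accurate to second order. The weights
  \<open>1 - \<alpha>/3\<close> and \<open>\<alpha>/3\<close> interpolate linearly to the same end
  point.\<close>

lemma truncation_error_first:
  "\<bar>1 / Gamma (3 - \<alpha>) * ((1 - \<alpha>/3) * \<tau>) powr (2 - \<alpha>) * dtt \<tau> h \<psi> U i 0
      - dxx h (\<lambda>m. (1 - \<alpha>/3) * U m 1 + \<alpha>/3 * U m 0) i - f (real i * h) ((1 - \<alpha>/3) * \<tau>)\<bar>
    \<le> (8 * K * T powr (2 - \<alpha>) / ((2 - \<alpha>) * Gamma (2 - \<alpha>)) + 2 * K) * (\<tau>\<^sup>2 + h\<^sup>2)"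
proof -
  let ?x = "real i * h"
  define lam where "lam = 1 - \<alpha>/3"
  define t where "t = lam * \<tau>"
  define \<Gamma> where "\<Gamma> = Gamma (2 - \<alpha>)"
  have \<Gamma>: "0 < \<Gamma>" using \<alpha> by (simp add: \<Gamma>_def Gamma_real_pos)
  have \<Gamma>3: "Gamma (3 - \<alpha>) = (2 - \<alpha>) * \<Gamma>"
    using Gamma_plus1[of "2 - \<alpha>"] nonpos_Ints_nonpos[of "2 - \<alpha>"] \<alpha> by (force simp: \<Gamma>_def)
  have lam: "0 < lam" "lam < 1" using \<alpha> by (auto simp: lam_def)
  have x: "?x \<in> {0..L}" using space_node by auto
  have \<tau>T: "0 < \<tau>" "\<tau> \<le> T" using time_node[of 1] NM step_sizes by auto
  have t: "0 < t" "t \<le> \<tau>" "t \<le> T" using lam \<tau>T by (auto simp: t_def mult_left_le_one_le intro: order_trans[of _ \<tau>])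
  have cont: "continuous_on {0..t} (D 0 2 ?x)"
    by (rule continuous_on_subset[OF DERIV_continuous_on[OF D_dt]]) (use x t in auto)
  let ?I = "integral {0..t} (\<lambda>y. D 0 2 ?x y * (t - y) powr (1 - \<alpha>))"
  let ?G = "dtt \<tau> h \<psi> U i 0"
  have "\<bar>?G * ((t - 0) powr (2 - \<alpha>) / (2 - \<alpha>)) - ?I\<bar> \<le> 8 * K * \<tau>\<^sup>2 * ((t - 0) powr (2 - \<alpha>) / (2 - \<alpha>))"
  proof (rule one_point_rule_error[OF \<alpha> t(1) cont])
    show "\<tau> / 3 = 0 + (t - 0) / (3 - \<alpha>)" using \<alpha> by (simp add: t_def lam_def field_simps)
    fix y assume y: "y \<in> {0..t}"
    have "\<bar>D 0 2 ?x y - D 0 2 ?x 0 - (y - 0) * D 0 (Suc 2) ?x 0\<bar> \<le> K * (y - 0)\<^sup>2"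
      using y t x T by (intro taylor_time) auto
    also have "\<dots> \<le> K * \<tau>\<^sup>2" using y t K0 by (intro mult_left_mono power_mono) auto
    finally have 1: "\<bar>D 0 2 ?x y - D 0 2 ?x 0 - y * D 0 3 ?x 0\<bar> \<le> K * \<tau>\<^sup>2" by (simp add: numeral_3_eq_3)
    have "D 0 2 ?x y - ?G - (y - \<tau> / 3) * D 0 3 ?x 0
      = (D 0 2 ?x y - D 0 2 ?x 0 - y * D 0 3 ?x 0) - (?G - (D 0 2 ?x 0 + \<tau> / 3 * D 0 3 ?x 0))"
      by (simp add: algebra_simps)
    also have "\<bar>\<dots>\<bar> \<le> K * \<tau>\<^sup>2 + 2 * K * \<tau>\<^sup>2"
      by (rule order_trans[OF abs_triangle_ineq4 add_mono[OF 1 dtt_0_error]])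
    \<comment> \<open>The constant 3 is enlarged to 8 so that all equations share one bound.\<close>
    also have "\<dots> \<le> 8 * K * \<tau>\<^sup>2" using K0 by (simp add: algebra_simps)
    finally show "\<bar>D 0 2 ?x y - ?G - (y - \<tau> / 3) * D 0 3 ?x 0\<bar> \<le> 8 * K * \<tau>\<^sup>2" .
  qed
  then have "1 / \<Gamma> * \<bar>?G * (t powr (2 - \<alpha>) / (2 - \<alpha>)) - ?I\<bar> \<le> 1 / \<Gamma> * (8 * K * \<tau>\<^sup>2 * (t powr (2 - \<alpha>) / (2 - \<alpha>)))"
    using \<Gamma> by (intro mult_left_mono) auto
  also have "\<dots> \<le> 1 / \<Gamma> * (8 * K * \<tau>\<^sup>2 * (T powr (2 - \<alpha>) / (2 - \<alpha>)))"
    using t K0 \<alpha> \<Gamma> by (intro mult_left_mono divide_right_mono powr_mono2) auto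
  also have "\<dots> = 8 * K * T powr (2 - \<alpha>) / ((2 - \<alpha>) * \<Gamma>) * \<tau>\<^sup>2" by (simp add: mult_ac)
  also have "\<dots> \<le> 8 * K * T powr (2 - \<alpha>) / ((2 - \<alpha>) * \<Gamma>) * (\<tau>\<^sup>2 + h\<^sup>2)"
    using K0 \<alpha> \<Gamma> by (intro mult_left_mono) auto
  finally have time: "1 / \<Gamma> * \<bar>?G * (t powr (2 - \<alpha>) / (2 - \<alpha>)) - ?I\<bar>
      \<le> 8 * K * T powr (2 - \<alpha>) / ((2 - \<alpha>) * \<Gamma>) * (\<tau>\<^sup>2 + h\<^sup>2)" .
  have "caputo \<alpha> (D 0 2 ?x) t = D 2 0 ?x t + f ?x t"
    using sol space_node t by (auto simp: is_solution_def)
  then have pde: "D 2 0 ?x t + f ?x t = 1 / \<Gamma> * ?I" by (simp add: caputo_def \<Gamma>_def)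

  define Z where "Z j = dxx h (\<lambda>m. U m j) i" for j
  define g where "g j = D 2 0 ?x (real j * \<tau>)" for j
  define g' where "g' = D 2 1 ?x 0"
  have z: "\<bar>Z 1 - g 1\<bar> \<le> 2 * K * h\<^sup>2" "\<bar>Z 0 - g 0\<bar> \<le> 2 * K * h\<^sup>2"
    using dxx_error[of 1] dxx_error[of 0] NM by (auto simp: Z_def g_def)
  have g1: "\<bar>g 1 - g 0 - \<tau> * g'\<bar> \<le> K * \<tau>\<^sup>2"
    using taylor_time[of 2 0 ?x \<tau> 0] x \<tau>T T by (simp add: g_def g'_def)
  have "\<bar>D 2 0 ?x t - g 0 - t * g'\<bar> \<le> K * t\<^sup>2"
    using taylor_time[of 2 0 ?x t 0] x t T by (simp add: g_def g'_def)
  also have "\<dots> \<le> K * \<tau>\<^sup>2" using t K0 by (intro mult_left_mono power_mono) auto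
  finally have gt: "\<bar>D 2 0 ?x t - g 0 - t * g'\<bar> \<le> K * \<tau>\<^sup>2" .
  define rhs where "rhs = dxx h (\<lambda>m. lam * U m 1 + (1 - lam) * U m 0) i"
  have "rhs = lam * Z 1 + (1 - lam) * Z 0"
    by (simp add: rhs_def Z_def dxx_def add_divide_distrib diff_divide_distrib algebra_simps)
  then have "rhs - D 2 0 ?x t = lam * (Z 1 - g 1) + (1 - lam) * (Z 0 - g 0)
      + lam * (g 1 - g 0 - \<tau> * g') - (D 2 0 ?x t - g 0 - t * g')"
    by (simp add: t_def algebra_simps)
  also have "\<bar>\<dots>\<bar> \<le> lam * (2 * K * h\<^sup>2) + (1 - lam) * (2 * K * h\<^sup>2) + 1 * (K * \<tau>\<^sup>2) + K * \<tau>\<^sup>2"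
    using lam by (intro abs_add3_diff_le abs_mult_le z g1 gt) auto
  also have "\<dots> = 2 * K * (\<tau>\<^sup>2 + h\<^sup>2)" by (simp add: algebra_simps)
  finally have space: "\<bar>rhs - D 2 0 ?x t\<bar> \<le> 2 * K * (\<tau>\<^sup>2 + h\<^sup>2)" .

  have "1 / Gamma (3 - \<alpha>) * t powr (2 - \<alpha>) * ?G - rhs - f ?x t
      = 1 / \<Gamma> * (?G * (t powr (2 - \<alpha>) / (2 - \<alpha>)) - ?I) - (rhs - D 2 0 ?x t)"
    unfolding right_diff_distrib pde[symmetric] \<Gamma>3 by (simp add: mult_ac)
  then have "\<bar>1 / Gamma (3 - \<alpha>) * t powr (2 - \<alpha>) * ?G - rhs - f ?x t\<bar>
      \<le> \<bar>1 / \<Gamma> * (?G * (t powr (2 - \<alpha>) / (2 - \<alpha>)) - ?I)\<bar> + \<bar>rhs - D 2 0 ?x t\<bar>"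
    by (simp only: abs_triangle_ineq4)
  also have "\<bar>1 / \<Gamma> * (?G * (t powr (2 - \<alpha>) / (2 - \<alpha>)) - ?I)\<bar> = 1 / \<Gamma> * \<bar>?G * (t powr (2 - \<alpha>) / (2 - \<alpha>)) - ?I\<bar>"
    using \<Gamma> by (simp add: abs_mult)
  finally have "\<bar>1 / Gamma (3 - \<alpha>) * t powr (2 - \<alpha>) * ?G - rhs - f ?x t\<bar>
      \<le> (8 * K * T powr (2 - \<alpha>) / ((2 - \<alpha>) * \<Gamma>) + 2 * K) * (\<tau>\<^sup>2 + h\<^sup>2)"
    unfolding distrib_right[of _ _ "\<tau>\<^sup>2 + h\<^sup>2"] using time space by linarith
  moreover have "rhs = dxx h (\<lambda>m. (1 - \<alpha>/3) * U m 1 + \<alpha>/3 * U m 0) i" by (simp add: rhs_def lam_def)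
  ultimately show ?thesis by (simp only: \<Gamma>_def t_def lam_def)
qed

end

end

section \<open>Convergence\<close>

text \<open>With b = 1/2 - \<sigma>, the two averages belong to the times t_k - b\<tau> and t_k -
  (1+b)\<tau>, and the weights 1+b and -b extrapolate linearly to t_k. The bound
  \<open>2 \<le> k\<close> keeps both indices away from the conventional value of
  \<open>ebar\<close> at 0.\<close>

lemma uhat_ebar:
  assumes "2 \<le> k"
  shows "uhat \<alpha> e i k = (3/2 - sig \<alpha>) * ebar (1/2 + sig \<alpha>) e i k - (1/2 - sig \<alpha>) * ebar (1/2 + sig \<alpha>) e i (k - 1)"
proof -
  have "k - 1 - 1 = k - 2" "k \<noteq> 0" "k - 1 \<noteq> 0" using assms by auto
  then show ?thesis by (simp add: uhat_def ebar_def Let_def)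
qed

lemma uhat_diff: "uhat \<alpha> (\<lambda>i k. U i k - w i k) i k = uhat \<alpha> U i k - uhat \<alpha> w i k"
  by (simp add: uhat_def Let_def algebra_simps)

theorem theorem3:
  fixes \<alpha> L T :: real and \<phi> \<psi> :: "real \<Rightarrow> real" and f u :: "real \<Rightarrow> real \<Rightarrow> real"
    and D :: "nat \<Rightarrow> nat \<Rightarrow> real \<Rightarrow> real \<Rightarrow> real"
  assumes "1 < \<alpha>" and "\<alpha> < 2" and "0 < L" and "0 < T"
    and "C44 L T u D"
    and "is_solution \<alpha> L T \<phi> \<psi> f u D"
    and "\<forall>v Dv. C44 L T v Dv \<and> is_solution \<alpha> L T \<phi> \<psi> f v Dv \<longrightarrow>
           (\<forall>x\<in>{0..L}. \<forall>t\<in>{0..T}. v x t = u x t)"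
  shows "\<exists>c5>0. \<forall>N M w. 1 \<le> N \<longrightarrow> 1 \<le> M \<longrightarrow> is_scheme_solution \<alpha> L T \<phi> \<psi> f N M w \<longrightarrow>
           (\<forall>k\<le>N. max_norm M (\<lambda>i. err_hat \<alpha> L T u N M w i k)
                     \<le> c5 * ((T / real N)\<^sup>2 + (L / real M)\<^sup>2))"
proof -
  note \<alpha> = assms(1,2) and L = assms(3) and T = assms(4) and C44 = assms(5) and sol = assms(6)
  note sg = sig_bounds[OF \<alpha>]
  obtain K where K0: "0 \<le> K" and K: "\<forall>i\<le>4. \<forall>j\<le>4. \<forall>x\<in>{0..L}. \<forall>t\<in>{0..T}. \<bar>D i j x t\<bar> \<le> K"
    using C44_bounded[OF C44] .
  note regular = \<alpha> L T C44 sol K0 K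
  define a where "a = 1/2 + sig \<alpha>"
  obtain C where C: "0 < C" and stab: "\<forall>N M e R \<rho>. 1 \<le> N \<longrightarrow> 1 \<le> M \<longrightarrow> 0 \<le> \<rho> \<longrightarrow> (\<forall>i. e i 0 = 0) \<longrightarrow>
      (\<forall>k\<le>N. e 0 k = 0 \<and> e M k = 0) \<longrightarrow>
      (\<forall>i\<in>{1..<M}. 1 / Gamma (3 - \<alpha>) * ((1 - \<alpha>/3) * (T / real N)) powr (2 - \<alpha>)
          * dtt (T / real N) (L / real M) (\<lambda>_. 0) e i 0
        = (1 - \<alpha>/3) * dxx (L / real M) (\<lambda>m. e m 1) i + R i 0) \<longrightarrow>
      (\<forall>i\<in>{1..<M}. \<forall>k\<in>{1..<N}.
         1 / Gamma (2 - \<alpha>) * (\<Sum>l=0..k. coef_c \<alpha> (T / real N) k l * dtt (T / real N) (L / real M) (\<lambda>_. 0) e i (k - l))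
         = dxx (L / real M) (\<lambda>m. (ebar a e m (Suc k) + ebar a e m k) / 2) i + R i k) \<longrightarrow>
      (\<forall>i\<in>{1..<M}. \<forall>k<N. \<bar>R i k\<bar> \<le> \<rho>) \<longrightarrow>
      (\<forall>i\<le>M. \<forall>k\<le>N. \<bar>ebar a e i k\<bar> \<le> C * \<rho>)"
    using scheme_stability[OF \<alpha> T L, folded a_def] by (elim exE conjE) (rule that)
  define Ct where "Ct = 8 * K * T powr (2 - \<alpha>) / ((2 - \<alpha>) * Gamma (2 - \<alpha>)) + 2 * K"
  have "0 < Gamma (2 - \<alpha>)" using \<alpha> by (simp add: Gamma_real_pos)
  then have Ct: "0 \<le> Ct" using K0 \<alpha> by (simp add: Ct_def)
  \<comment> \<open>The first 2 bounds the extrapolation weights and also \<open>1 / a\<close>,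
    needed at level 1; \<open>2 * K\<close> covers the extrapolation error of the exact solution,
    and the added 1 ensures positivity.\<close>
  define c5 where "c5 = 2 * (C * Ct) + 2 * K + 1"
  have c5: "0 < c5" using C Ct K0 by (simp add: c5_def add_nonneg_pos)
  show ?thesis
  proof (intro exI[of _ c5] conjI c5 allI impI)
    fix N M k :: nat and w :: "nat \<Rightarrow> nat \<Rightarrow> real"
    assume N: "1 \<le> N" and M: "1 \<le> M" and scheme: "is_scheme_solution \<alpha> L T \<phi> \<psi> f N M w" and k: "k \<le> N"
    define \<tau> where "\<tau> = T / real N"
    define h where "h = L / real M"
    define U where "U = (\<lambda>i j. u (real i * h) (real j * \<tau>))"
    define \<rho> where "\<rho> = Ct * (\<tau>\<^sup>2 + h\<^sup>2)"
    have \<rho>: "0 \<le> \<rho>" using Ct by (simp add: \<rho>_def)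
    have step_sizes: "0 < \<tau>" "real N * \<tau> = T" "0 < h" "real M * h = L"
      using N M T L by (auto simp: \<tau>_def h_def)
    have sch1: "1 / Gamma (3 - \<alpha>) * ((1 - \<alpha>/3) * \<tau>) powr (2 - \<alpha>) * dtt \<tau> h \<psi> w i 0
         = dxx h (\<lambda>m. (1 - \<alpha>/3) * w m 1 + \<alpha>/3 * w m 0) i + f (real i * h) ((1 - \<alpha>/3) * \<tau>)"
      if "1 \<le> i" "i < M" for i
      using scheme that by (auto simp: is_scheme_solution_def Let_def \<tau>_def h_def)
    have sch2: "1 / Gamma (2 - \<alpha>) * (\<Sum>l = 0..k. coef_c \<alpha> \<tau> k l * dtt \<tau> h \<psi> w i (k - l))
         = (1/2 + sig \<alpha>) * dxx h (\<lambda>m. (w m k + w m (k + 1)) / 2) i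
           + (1/2 - sig \<alpha>) * dxx h (\<lambda>m. (w m (k - 1) + w m k) / 2) i
           + f (real i * h) (real k * \<tau> + sig \<alpha> * \<tau>)" if "1 \<le> i" "i < M" "1 \<le> k" "k < N" for i k
    proof -
      have "i \<le> M - 1" "k \<le> N - 1" using that by auto
      then show ?thesis using scheme that unfolding is_scheme_solution_def Let_def \<tau>_def h_def by blast
    qed
    have init: "w i 0 = \<phi> (real i * h)" if "1 \<le> i" "i < M" for i
      using scheme that by (auto simp: is_scheme_solution_def Let_def h_def)
    have wb: "w 0 k = 0" "w M k = 0" if "k \<le> N" for k
      using scheme that by (auto simp: is_scheme_solution_def Let_def)
    have tn: "real k * \<tau> \<in> {0..T}" if "k \<le> N" for k
      using step_sizes that mult_right_mono[of "real k" "real N" \<tau>] by auto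
    have xn: "real i * h \<in> {0..L}" if "i \<le> M" for i
      using step_sizes that mult_right_mono[of "real i" "real M" h] by auto
    \<comment> \<open>Extended by zero beyond \<open>M\<close>, since the stability result asks for
      vanishing initial values at every index.\<close>
    define e where "e i k = (if i \<le> M then U i k - w i k else 0)" for i k
    have Ub: "U 0 k = 0" "U M k = 0" if "k \<le> N" for k
      using sol tn[OF that] step_sizes by (auto simp: U_def is_solution_def)
    have eb: "\<forall>k\<le>N. e 0 k = 0 \<and> e M k = 0" using wb Ub by (auto simp: e_def)
    have e0: "\<forall>i. e i 0 = 0"
    proof
      fix i
      \<comment> \<open>The scheme prescribes initial values only at interior nodes; at the two end
        nodes the boundary condition supplies them.\<close>
      consider "i = 0" | "i = M" | "1 \<le> i" "i < M" | "M < i" by linarith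
      then show "e i 0 = 0"
      proof cases
        case 3
        then have "u (real i * h) 0 = \<phi> (real i * h)" using sol xn[of i] by (auto simp: is_solution_def)
        then show ?thesis using init[OF 3] by (simp add: e_def U_def)
      qed (use eb in \<open>auto simp: e_def\<close>)
    qed
    have dtt_e: "dtt \<tau> h (\<lambda>_. 0) e i j = dtt \<tau> h \<psi> U i j - dtt \<tau> h \<psi> w i j" if "i < M" for i j
      using that by (simp add: dtt_def e_def diff_divide_distrib add_divide_distrib algebra_simps)
    have dxx_e: "dxx h (\<lambda>m. e m j) i = dxx h (\<lambda>m. U m j) i - dxx h (\<lambda>m. w m j) i" if "i \<in> {1..<M}" for i j
    proof -
      have "i - 1 \<le> M" "i \<le> M" "i + 1 \<le> M" using that by auto
      then show ?thesis by (simp only: dxx_def e_def if_True diff_divide_distrib[symmetric]) (simp add: algebra_simps)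
    qed
    define R where "R i k = (if k = 0
        then 1 / Gamma (3 - \<alpha>) * ((1 - \<alpha>/3) * \<tau>) powr (2 - \<alpha>) * dtt \<tau> h \<psi> U i 0
          - dxx h (\<lambda>m. (1 - \<alpha>/3) * U m 1 + \<alpha>/3 * U m 0) i - f (real i * h) ((1 - \<alpha>/3) * \<tau>)
        else 1 / Gamma (2 - \<alpha>) * (\<Sum>l=0..k. coef_c \<alpha> \<tau> k l * dtt \<tau> h \<psi> U i (k - l))
          - ((1/2 + sig \<alpha>) * dxx h (\<lambda>m. (U m k + U m (k + 1)) / 2) i
             + (1/2 - sig \<alpha>) * dxx h (\<lambda>m. (U m (k - 1) + U m k) / 2) i)
          - f (real i * h) (real k * \<tau> + sig \<alpha> * \<tau>))" for i k
    have R: "\<forall>i\<in>{1..<M}. \<forall>k<N. \<bar>R i k\<bar> \<le> \<rho>"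
    proof (intro ballI allI impI)
      fix i k assume i: "i \<in> {1..<M}" and k: "k < N"
      have i': "1 \<le> i" "i < M" using i by auto
      show "\<bar>R i k\<bar> \<le> \<rho>"
      proof (cases "k = 0")
        case True
        then show ?thesis unfolding R_def \<rho>_def Ct_def
          using truncation_error_first[OF regular N M \<tau>_def h_def U_def i'] by simp
      next
        case False
        then have "1 \<le> k" by simp
        then show ?thesis unfolding R_def \<rho>_def Ct_def if_not_P[OF False]
          by (intro truncation_error_step[OF regular N M \<tau>_def h_def U_def i' _ k])
      qed
    qed
    have first: "\<forall>i\<in>{1..<M}. 1 / Gamma (3 - \<alpha>) * ((1 - \<alpha>/3) * \<tau>) powr (2 - \<alpha>) * dtt \<tau> h (\<lambda>_. 0) e i 0
        = (1 - \<alpha>/3) * dxx h (\<lambda>m. e m 1) i + R i 0"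
    proof
      fix i assume i: "i \<in> {1..<M}"
      have "dxx h (\<lambda>m. (1 - \<alpha>/3) * e m 1 + \<alpha>/3 * e m 0) i
        = dxx h (\<lambda>m. (1 - \<alpha>/3) * U m 1 + \<alpha>/3 * U m 0) i - dxx h (\<lambda>m. (1 - \<alpha>/3) * w m 1 + \<alpha>/3 * w m 0) i"
        using i by (simp only: dxx_linear dxx_e) (simp add: dxx_e right_diff_distrib)
      moreover have "dxx h (\<lambda>m. (1 - \<alpha>/3) * e m 1 + \<alpha>/3 * e m 0) i = (1 - \<alpha>/3) * dxx h (\<lambda>m. e m 1) i"
        using e0 by (simp add: dxx_cmult)
      ultimately show "1 / Gamma (3 - \<alpha>) * ((1 - \<alpha>/3) * \<tau>) powr (2 - \<alpha>) * dtt \<tau> h (\<lambda>_. 0) e i 0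
        = (1 - \<alpha>/3) * dxx h (\<lambda>m. e m 1) i + R i 0"
        using sch1[of i] i unfolding R_def by (simp add: dtt_e right_diff_distrib)
    qed
    have step: "\<forall>i\<in>{1..<M}. \<forall>k\<in>{1..<N}.
         1 / Gamma (2 - \<alpha>) * (\<Sum>l=0..k. coef_c \<alpha> \<tau> k l * dtt \<tau> h (\<lambda>_. 0) e i (k - l))
         = dxx h (\<lambda>m. (ebar a e m (Suc k) + ebar a e m k) / 2) i + R i k"
    proof (intro ballI)
      fix i k assume i: "i \<in> {1..<M}" and k: "k \<in> {1..<N}"
      define P where "P z = (1/2 + sig \<alpha>) * dxx h (\<lambda>m. (z m k + z m (k + 1)) / 2) i
             + (1/2 - sig \<alpha>) * dxx h (\<lambda>m. (z m (k - 1) + z m k) / 2) i" for z :: "nat \<Rightarrow> nat \<Rightarrow> real"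
      \<comment> \<open>Weighting two midpoint averages by \<open>a\<close> and \<open>1 - a\<close>
        is the same as averaging two consecutive \<open>ebar\<close>; \<open>1 \<le> k\<close>
        excludes the conventional value.\<close>
      have "(\<lambda>m. (ebar a e m (Suc k) + ebar a e m k) / 2)
          = (\<lambda>m. a * ((e m k + e m (k + 1)) / 2) + (1 - a) * ((e m (k - 1) + e m k) / 2))"
        using k by (intro ext) (simp add: ebar_def field_simps)
      then have "dxx h (\<lambda>m. (ebar a e m (Suc k) + ebar a e m k) / 2) i = P e"
        by (simp only: P_def dxx_linear a_def) simp
      also have "\<dots> = P U - P w"
        unfolding P_def dxx_average dxx_e[OF i] by (simp add: field_simps)
      finally have "dxx h (\<lambda>m. (ebar a e m (Suc k) + ebar a e m k) / 2) i = P U - P w" .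
      moreover have "1 / Gamma (2 - \<alpha>) * (\<Sum>l=0..k. coef_c \<alpha> \<tau> k l * dtt \<tau> h (\<lambda>_. 0) e i (k - l))
          = 1 / Gamma (2 - \<alpha>) * (\<Sum>l=0..k. coef_c \<alpha> \<tau> k l * dtt \<tau> h \<psi> U i (k - l))
            - 1 / Gamma (2 - \<alpha>) * (\<Sum>l=0..k. coef_c \<alpha> \<tau> k l * dtt \<tau> h \<psi> w i (k - l))"
        using i by (simp add: dtt_e right_diff_distrib sum_subtractf diff_divide_distrib)
      moreover have "1 / Gamma (2 - \<alpha>) * (\<Sum>l=0..k. coef_c \<alpha> \<tau> k l * dtt \<tau> h \<psi> w i (k - l))
          = P w + f (real i * h) (real k * \<tau> + sig \<alpha> * \<tau>)"
        using sch2[of i k] i k by (simp only: P_def) auto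
      moreover have "R i k = 1 / Gamma (2 - \<alpha>) * (\<Sum>l=0..k. coef_c \<alpha> \<tau> k l * dtt \<tau> h \<psi> U i (k - l))
          - P U - f (real i * h) (real k * \<tau> + sig \<alpha> * \<tau>)"
        using k by (simp only: R_def P_def) auto
      ultimately show "1 / Gamma (2 - \<alpha>) * (\<Sum>l=0..k. coef_c \<alpha> \<tau> k l * dtt \<tau> h (\<lambda>_. 0) e i (k - l))
         = dxx h (\<lambda>m. (ebar a e m (Suc k) + ebar a e m k) / 2) i + R i k" by linarith
    qed
    have bar: "\<bar>ebar a e i j\<bar> \<le> C * \<rho>" if "i \<le> M" "j \<le> N" for i j
      using stab[THEN spec[of _ N], THEN spec[of _ M], THEN spec[of _ e], THEN spec[of _ R], THEN spec[of _ \<rho>],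
          folded \<tau>_def h_def, THEN mp[OF _ N], THEN mp[OF _ M], THEN mp[OF _ \<rho>], THEN mp[OF _ e0],
          THEN mp[OF _ eb], THEN mp[OF _ first], THEN mp[OF _ step], THEN mp[OF _ R]] that by blast
    have C\<rho>: "0 \<le> C * \<rho>" using C \<rho> by simp
    have c5_ge: "2 * (C * \<rho>) + 2 * K * \<tau>\<^sup>2 \<le> c5 * (\<tau>\<^sup>2 + h\<^sup>2)"
    proof -
      have "2 * K * \<tau>\<^sup>2 \<le> (2 * K + 1) * (\<tau>\<^sup>2 + h\<^sup>2)" using K0 by (intro mult_mono) auto
      then show ?thesis by (simp add: c5_def \<rho>_def algebra_simps)
    qed
    have "\<bar>err_hat \<alpha> L T u N M w i k\<bar> \<le> 2 * (C * \<rho>) + 2 * K * \<tau>\<^sup>2" if i: "i \<le> M" for i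
    proof -
      have eU: "U i j - w i j = e i j" for j using i by (simp add: e_def)
      have K\<tau>: "0 \<le> K * \<tau>\<^sup>2" using K0 by simp
      consider "k = 0" | "k = 1" | "2 \<le> k" by linarith
      then show ?thesis
      proof cases
        case 1
        then have "err_hat \<alpha> L T u N M w i k = e i 0" using eU[of 0] by (simp add: err_hat_def U_def h_def \<tau>_def)
        then show ?thesis using e0 C\<rho> K\<tau> by simp
      next
        \<comment> \<open>No extrapolation here: \<open>ebar\<close> at level 1 is
          \<open>a * e i 1\<close> with \<open>a > 1/2\<close>, so \<open>e i 1\<close> itself is
          controlled.\<close>
        case 2
        then have "err_hat \<alpha> L T u N M w i k = e i 1" using eU[of 1] by (simp add: err_hat_def U_def h_def \<tau>_def)
        moreover have "ebar a e i 1 = a * e i 1" using e0 by (simp add: ebar_def)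
        then have "a * \<bar>e i 1\<bar> \<le> C * \<rho>" using bar[of i 1] i N sg by (simp add: abs_mult a_def)
        moreover have "1/2 * \<bar>e i 1\<bar> \<le> a * \<bar>e i 1\<bar>" using sg by (intro mult_right_mono) (auto simp: a_def)
        ultimately show ?thesis using K\<tau> by simp
      next
        case 3
        let ?x = "real i * h" and ?t = "real k * \<tau>"
        define b where "b = 1/2 - sig \<alpha>"
        have b: "0 \<le> b" "b \<le> 1/2" using sg by (auto simp: b_def)
        have sig_b: "1/2 - sig \<alpha> = b" "3/2 - sig \<alpha> = 1 + b" by (simp_all add: b_def)
        have b2: "b\<^sup>2 \<le> 1/4" using power_mono[of b "1/2" 2] b by (simp add: power2_eq_square)
        have "err_hat \<alpha> L T u N M w i k = (U i k - uhat \<alpha> U i k) + uhat \<alpha> (\<lambda>i k. U i k - w i k) i k"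
          using 3 by (simp add: err_hat_def uhat_diff U_def h_def \<tau>_def)
        moreover have "uhat \<alpha> (\<lambda>i k. U i k - w i k) i k = (1 + b) * ebar a e i k - b * ebar a e i (k - 1)"
        proof -
          have "uhat \<alpha> (\<lambda>i k. U i k - w i k) i k = uhat \<alpha> e i k" by (simp add: uhat_def eU)
          then show ?thesis using uhat_ebar[OF 3, of \<alpha> e i, folded a_def] by (simp only: sig_b)
        qed
        moreover have "\<bar>(1 + b) * ebar a e i k - b * ebar a e i (k - 1)\<bar> \<le> (1 + b) * (C * \<rho>) + b * (C * \<rho>)"
          using b bar[OF i, of k] bar[OF i, of "k - 1"] k
          by (intro order_trans[OF abs_triangle_ineq4 add_mono] abs_mult_le) auto
        moreover have "(1 + b) * (C * \<rho>) + b * (C * \<rho>) \<le> 2 * (C * \<rho>)"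
          using mult_right_mono[of "1 + b + b" 2 "C * \<rho>"] b C\<rho> by (simp add: algebra_simps)
        moreover have "\<bar>U i k - uhat \<alpha> U i k\<bar> \<le> 2 * K * \<tau>\<^sup>2"
        proof -
          define g1 where "g1 = U i (k - 1) - U i k + \<tau> * D 0 1 ?x ?t"
          define g2 where "g2 = U i (k - 2) - U i k + 2 * \<tau> * D 0 1 ?x ?t"
          have n: "real (k - 1) * \<tau> - ?t = - \<tau>" "real (k - 2) * \<tau> - ?t = - 2 * \<tau>"
            using 3 by (auto simp: of_nat_diff algebra_simps)
          have g1: "\<bar>g1\<bar> \<le> K * \<tau>\<^sup>2"
            using taylor_time[OF regular, of 0 0 ?x "real (k - 1) * \<tau>" ?t] tn[of "k - 1"] tn[of k] xn[OF i] k n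
            by (simp add: g1_def U_def u_eq[OF regular])
          have g2: "\<bar>g2\<bar> \<le> 4 * (K * \<tau>\<^sup>2)"
            using taylor_time[OF regular, of 0 0 ?x "real (k - 2) * \<tau>" ?t] tn[of "k - 2"] tn[of k] xn[OF i] k n
            by (simp add: g2_def U_def u_eq[OF regular] power_mult_distrib)
          have "uhat \<alpha> U i k = (1 + b) * ((1 - b) * U i k + b * U i (k - 1)) - b * ((1 - b) * U i (k - 1) + b * U i (k - 2))"
          proof -
            have "1/2 + sig \<alpha> = 1 - b" by (simp add: b_def)
            then show ?thesis by (simp only: uhat_def Let_def sig_b)
          qed
          \<comment> \<open>The defect is \<open>b^2\<close> times the second difference of
            \<open>U\<close> over the last three levels; \<open>g1\<close> and \<open>g2\<close> are
            its Taylor remainders about level \<open>k\<close>, whose linear parts cancel.\<close>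
          then have "U i k - uhat \<alpha> U i k = b\<^sup>2 * (g2 - 2 * g1)"
            by (simp add: g1_def g2_def power2_eq_square algebra_simps)
          also have "\<bar>\<dots>\<bar> \<le> 1/4 * (4 * (K * \<tau>\<^sup>2) + 2 * (K * \<tau>\<^sup>2))"
            using b2 g1 g2 by (intro abs_mult_le) auto
          also have "\<dots> \<le> 2 * K * \<tau>\<^sup>2" using K\<tau> by simp
          finally show ?thesis .
        qed
        ultimately show ?thesis by linarith
      qed
    qed
    then have "\<forall>x\<in>(\<lambda>i. \<bar>err_hat \<alpha> L T u N M w i k\<bar>) ` {0..M}. x \<le> c5 * (\<tau>\<^sup>2 + h\<^sup>2)"
      using c5_ge by fastforce
    then show "max_norm M (\<lambda>i. err_hat \<alpha> L T u N M w i k) \<le> c5 * ((T / real N)\<^sup>2 + (L / real M)\<^sup>2)"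
      unfolding max_norm_def \<tau>_def h_def by (subst Max_le_iff) auto
  qed
qed

end
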